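(* Let $\mathcal A=\mathcal B\ltimes\mathsf F$ be a right trivial extension, and let $(\mathcal X,\mathcal Y)$ be a hereditary complete cotorsion pair in $\mathcal B$. If $L_1\mathsf F(\mathcal X)=0$ and $\mathsf F(\mathcal X)\subseteq\mathcal Y$, then $\bigl({}^\perp\mathsf U^{-1}(\mathcal Y),\mathsf U^{-1}(\mathcal Y)\bigr)$ is a hereditary complete cotorsion pair in $\mathcal A$.
   Context: Conventions: abelian categories under consideration (in particular $\mathcal B$ and $\mathcal A$) have enough projective and enough injective objects; subcategories are full, additive and closed under isomorphisms. $L_i\mathsf F$ denotes the $i$-th left derived functor, and $L_1\mathsf F(\mathcal X)=0$ means $L_1\mathsf F(X)=0$ for all $X\in\mathcal X$. Let $\mathcal B$ be an abelian category and $\mathsf F:\mathcal B\to\mathcal B$ a covariant right exact additive functor. The right trivial extension $\mathcal B\ltimes\mathsf F$ is the category whose objects are pairs $(B,f)$ with $B\in\mathcal B$ and $f:\mathsf F(B)\to B$ satisfying $f\,\mathsf F(f)=0$, and whose morphisms $(B,f)\to(B',f')$ are morphisms $\alpha:B\to B'$ with $\alpha f=f'\mathsf F(\alpha)$. It is abelian, with exactness detected in $\mathcal B$. $\mathsf U(X,f)=X$ and $\mathsf U^{-1}(\mathcal Y)=\{(Y,g)\in\mathcal A\mid Y\in\mathcal Y\}$. For a class $\mathcal M$ in an abelian category $\mathcal E$: $\mathcal M^\perp=\{N\mid\operatorname{Ext}^1_{\mathcal E}(M,N)=0\ \forall M\in\mathcal M\}$ and ${}^\perp\mathcal M=\{N\mid\operatorname{Ext}^1_{\mathcal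 E}(N,M)=0\ \forall M\in\mathcal M\}$. $(\mathcal X,\mathcal Y)$ is a cotorsion pair if $\mathcal X={}^\perp\mathcal Y$ and $\mathcal Y=\mathcal X^\perp$; it is complete if every object $E$ admits short exact sequences $0\to Y_E\to X_E\to E\to0$ and $0\to E\to Y^E\to X^E\to0$ with $X_E,X^E\in\mathcal X$ and $Y_E,Y^E\in\mathcal Y$; it is hereditary if $\operatorname{Ext}^i_{\mathcal E}(\mathcal X,\mathcal Y)=0$ for all $i\ge1$. *)

theory Defs
  imports "HOL-Algebra.Elementary_Groups"
begin

section \<open>Categories with addition on morphisms\<close>

text \<open>
  A category is given by its objects and, for each pair of objects, a set of morphisms.  Different
  hom-sets may overlap (the same underlying map may be a morphism between several pairs of objects,
  as happens for the trivial extension below), so every notion about a morphism mentions its source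
  and target.  Composition and addition act on raw morphisms; when the hom-sets are disjoint this is
  no restriction, and every category is isomorphic to one with disjoint hom-sets.
\<close>

record ('o, 'm) cat =
  Ob :: "'o set"
  Hom :: "'o \<Rightarrow> 'o \<Rightarrow> 'm set"
  Comp :: "'m \<Rightarrow> 'm \<Rightarrow> 'm"  (infixl "\<cdot>\<index>" 70)
  Ident :: "'o \<Rightarrow> 'm"
  Add :: "'m \<Rightarrow> 'm \<Rightarrow> 'm"
  Zero :: "'o \<Rightarrow> 'o \<Rightarrow> 'm"

definition hom_group :: "('o, 'm) cat \<Rightarrow> 'o \<Rightarrow> 'o \<Rightarrow> 'm monoid" where
  "hom_group C a b = \<lparr>carrier = Hom C a b, monoid.mult = Add C, one = Zero C a b\<rparr>"

locale category =
  fixes C :: "('o, 'm) cat" (structure)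
  assumes ident_in_hom: "a \<in> Ob C \<Longrightarrow> Ident C a \<in> Hom C a a"
    and comp_in_hom: "\<lbrakk>a \<in> Ob C; b \<in> Ob C; c \<in> Ob C; f \<in> Hom C a b; g \<in> Hom C b c\<rbrakk>
          \<Longrightarrow> g \<cdot> f \<in> Hom C a c"
    and comp_ident: "\<lbrakk>a \<in> Ob C; b \<in> Ob C; f \<in> Hom C a b\<rbrakk> \<Longrightarrow> f \<cdot> Ident C a = f"
    and ident_comp: "\<lbrakk>a \<in> Ob C; b \<in> Ob C; f \<in> Hom C a b\<rbrakk> \<Longrightarrow> Ident C b \<cdot> f = f"
    and comp_assoc: "\<lbrakk>a \<in> Ob C; b \<in> Ob C; c \<in> Ob C; e \<in> Ob C;
          f \<in> Hom C a b; g \<in> Hom C b c; h \<in> Hom C c e\<rbrakk> \<Longrightarrow> (h \<cdot> g) \<cdot> f = h \<cdot> (g \<cdot> f)"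

locale preadditive_category = category +
  assumes hom_comm_group: "\<lbrakk>a \<in> Ob C; b \<in> Ob C\<rbrakk> \<Longrightarrow> comm_group (hom_group C a b)"
    and comp_add: "\<lbrakk>a \<in> Ob C; b \<in> Ob C; c \<in> Ob C;
          f \<in> Hom C a b; f' \<in> Hom C a b; g \<in> Hom C b c\<rbrakk>
          \<Longrightarrow> g \<cdot> Add C f f' = Add C (g \<cdot> f) (g \<cdot> f')"
    and add_comp: "\<lbrakk>a \<in> Ob C; b \<in> Ob C; c \<in> Ob C;
          f \<in> Hom C a b; g \<in> Hom C b c; g' \<in> Hom C b c\<rbrakk>
          \<Longrightarrow> Add C g g' \<cdot> f = Add C (g \<cdot> f) (g' \<cdot> f)"

definition is_zero_object :: "('o, 'm) cat \<Rightarrow> 'o \<Rightarrow> bool" where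
  "is_zero_object C z \<longleftrightarrow> z \<in> Ob C \<and>
     (\<forall>a\<in>Ob C. (\<exists>!f. f \<in> Hom C z a) \<and> (\<exists>!f. f \<in> Hom C a z))"

definition is_biproduct ::
  "('o, 'm) cat \<Rightarrow> 'o \<Rightarrow> 'o \<Rightarrow> 'o \<Rightarrow> 'm \<Rightarrow> 'm \<Rightarrow> 'm \<Rightarrow> 'm \<Rightarrow> bool" where
  "is_biproduct C a b s i j p q \<longleftrightarrow> s \<in> Ob C \<and>
     i \<in> Hom C a s \<and> j \<in> Hom C b s \<and> p \<in> Hom C s a \<and> q \<in> Hom C s b \<and>
     p \<cdot>\<^bsub>C\<^esub> i = Ident C a \<and> q \<cdot>\<^bsub>C\<^esub> j = Ident C b \<and>
     p \<cdot>\<^bsub>C\<^esub> j = Zero C b a \<and> q \<cdot>\<^bsub>C\<^esub> i = Zero C a b \<and>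
     Add C (i \<cdot>\<^bsub>C\<^esub> p) (j \<cdot>\<^bsub>C\<^esub> q) = Ident C s"

definition monic :: "('o, 'm) cat \<Rightarrow> 'o \<Rightarrow> 'o \<Rightarrow> 'm \<Rightarrow> bool" where
  "monic C a b f \<longleftrightarrow> f \<in> Hom C a b \<and>
     (\<forall>x\<in>Ob C. \<forall>g\<in>Hom C x a. \<forall>h\<in>Hom C x a. f \<cdot>\<^bsub>C\<^esub> g = f \<cdot>\<^bsub>C\<^esub> h \<longrightarrow> g = h)"

definition epic :: "('o, 'm) cat \<Rightarrow> 'o \<Rightarrow> 'o \<Rightarrow> 'm \<Rightarrow> bool" where
  "epic C a b f \<longleftrightarrow> f \<in> Hom C a b \<and>
     (\<forall>x\<in>Ob C. \<forall>g\<in>Hom C b x. \<forall>h\<in>Hom C b x. g \<cdot>\<^bsub>C\<^esub> f = h \<cdot>\<^bsub>C\<^esub> f \<longrightarrow> g = h)"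

text \<open>In \<open>is_kernel C k i a f b\<close> the arrows are \<open>i : k \<rightarrow> a\<close> and \<open>f : a \<rightarrow> b\<close>;
  in \<open>is_cokernel C a f b p q\<close> they are \<open>f : a \<rightarrow> b\<close> and \<open>p : b \<rightarrow> q\<close>.\<close>

definition is_kernel :: "('o, 'm) cat \<Rightarrow> 'o \<Rightarrow> 'm \<Rightarrow> 'o \<Rightarrow> 'm \<Rightarrow> 'o \<Rightarrow> bool" where
  "is_kernel C k i a f b \<longleftrightarrow> k \<in> Ob C \<and> i \<in> Hom C k a \<and> f \<in> Hom C a b \<and>
     f \<cdot>\<^bsub>C\<^esub> i = Zero C k b \<and>
     (\<forall>x\<in>Ob C. \<forall>g\<in>Hom C x a. f \<cdot>\<^bsub>C\<^esub> g = Zero C x b \<longrightarrow>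
        (\<exists>!u. u \<in> Hom C x k \<and> i \<cdot>\<^bsub>C\<^esub> u = g))"

definition is_cokernel :: "('o, 'm) cat \<Rightarrow> 'o \<Rightarrow> 'm \<Rightarrow> 'o \<Rightarrow> 'm \<Rightarrow> 'o \<Rightarrow> bool" where
  "is_cokernel C a f b p q \<longleftrightarrow> q \<in> Ob C \<and> p \<in> Hom C b q \<and> f \<in> Hom C a b \<and>
     p \<cdot>\<^bsub>C\<^esub> f = Zero C a q \<and>
     (\<forall>x\<in>Ob C. \<forall>g\<in>Hom C b x. g \<cdot>\<^bsub>C\<^esub> f = Zero C a x \<longrightarrow>
        (\<exists>!u. u \<in> Hom C q x \<and> u \<cdot>\<^bsub>C\<^esub> p = g))"

locale abelian_category = preadditive_category +
  assumes zero_object: "\<exists>z. is_zero_object C z"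
    and biproducts: "\<lbrakk>a \<in> Ob C; b \<in> Ob C\<rbrakk> \<Longrightarrow> \<exists>s i j p q. is_biproduct C a b s i j p q"
    and kernels: "\<lbrakk>a \<in> Ob C; b \<in> Ob C; f \<in> Hom C a b\<rbrakk> \<Longrightarrow> \<exists>k i. is_kernel C k i a f b"
    and cokernels: "\<lbrakk>a \<in> Ob C; b \<in> Ob C; f \<in> Hom C a b\<rbrakk> \<Longrightarrow> \<exists>p q. is_cokernel C a f b p q"
    and monic_normal: "\<lbrakk>a \<in> Ob C; b \<in> Ob C; monic C a b f\<rbrakk>
          \<Longrightarrow> \<exists>c\<in>Ob C. \<exists>g. is_kernel C a f b g c"
    and epic_normal: "\<lbrakk>a \<in> Ob C; b \<in> Ob C; epic C a b f\<rbrakk>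
          \<Longrightarrow> \<exists>c\<in>Ob C. \<exists>g. is_cokernel C c g a f b"


section \<open>Exactness, projectives and injectives\<close>

text \<open>The image of \<open>f\<close> is the kernel of its cokernel, and \<open>a \<rightarrow> b \<rightarrow> c\<close> is exact at \<open>b\<close> if the
  image of the first arrow is the kernel of the second.\<close>

definition is_image :: "('o, 'm) cat \<Rightarrow> 'o \<Rightarrow> 'm \<Rightarrow> 'o \<Rightarrow> 'm \<Rightarrow> 'o \<Rightarrow> bool" where
  "is_image C k i a f b \<longleftrightarrow> (\<exists>p q. is_cokernel C a f b p q \<and> is_kernel C k i b p q)"

definition exact_at :: "('o, 'm) cat \<Rightarrow> 'o \<Rightarrow> 'm \<Rightarrow> 'o \<Rightarrow> 'm \<Rightarrow> 'o \<Rightarrow> bool" where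
  "exact_at C a f b g c \<longleftrightarrow> f \<in> Hom C a b \<and> g \<in> Hom C b c \<and>
     (\<exists>k i. is_image C k i a f b \<and> is_kernel C k i b g c)"

definition short_exact :: "('o, 'm) cat \<Rightarrow> 'o \<Rightarrow> 'm \<Rightarrow> 'o \<Rightarrow> 'm \<Rightarrow> 'o \<Rightarrow> bool" where
  "short_exact C a f b g c \<longleftrightarrow> a \<in> Ob C \<and> b \<in> Ob C \<and> c \<in> Ob C \<and>
     monic C a b f \<and> exact_at C a f b g c \<and> epic C b c g"

definition projective :: "('o, 'm) cat \<Rightarrow> 'o \<Rightarrow> bool" where
  "projective C p \<longleftrightarrow> p \<in> Ob C \<and>
     (\<forall>a\<in>Ob C. \<forall>b\<in>Ob C. \<forall>e f. epic C a b e \<and> f \<in> Hom C p b \<longrightarrow>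
        (\<exists>g\<in>Hom C p a. e \<cdot>\<^bsub>C\<^esub> g = f))"

definition injective :: "('o, 'm) cat \<Rightarrow> 'o \<Rightarrow> bool" where
  "injective C j \<longleftrightarrow> j \<in> Ob C \<and>
     (\<forall>a\<in>Ob C. \<forall>b\<in>Ob C. \<forall>m f. monic C a b m \<and> f \<in> Hom C a j \<longrightarrow>
        (\<exists>g\<in>Hom C b j. g \<cdot>\<^bsub>C\<^esub> m = f))"

definition enough_projectives :: "('o, 'm) cat \<Rightarrow> bool" where
  "enough_projectives C \<longleftrightarrow> (\<forall>a\<in>Ob C. \<exists>p e. projective C p \<and> epic C p a e)"

definition enough_injectives :: "('o, 'm) cat \<Rightarrow> bool" where
  "enough_injectives C \<longleftrightarrow> (\<forall>a\<in>Ob C. \<exists>j m. injective C j \<and> monic C a j m)"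


section \<open>Projective resolutions and Ext groups\<close>

text \<open>A resolution is a triple \<open>(P, d, e)\<close> with \<open>d n : P (n+1) \<rightarrow> P n\<close> and
  augmentation \<open>e : P 0 \<rightarrow> m\<close>.\<close>

definition is_projective_resolution ::
  "('o, 'm) cat \<Rightarrow> 'o \<Rightarrow> (nat \<Rightarrow> 'o) \<times> (nat \<Rightarrow> 'm) \<times> 'm \<Rightarrow> bool" where
  "is_projective_resolution C m = (\<lambda>(P, d, e).
     (\<forall>n. projective C (P n)) \<and>
     (\<forall>n. exact_at C (P (Suc (Suc n))) (d (Suc n)) (P (Suc n)) (d n) (P n)) \<and>
     exact_at C (P (Suc 0)) (d 0) (P 0) e m \<and>
     epic C (P 0) m e)"

text \<open>Derived functors are computed from a fixed choice of resolution for each object.\<close>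

definition proj_res :: "('o, 'm) cat \<Rightarrow> 'o \<Rightarrow> (nat \<Rightarrow> 'o) \<times> (nat \<Rightarrow> 'm) \<times> 'm" where
  "proj_res C m = (SOME R. is_projective_resolution C m R)"

definition res_ob :: "('o, 'm) cat \<Rightarrow> 'o \<Rightarrow> nat \<Rightarrow> 'o" where
  "res_ob C m = fst (proj_res C m)"

definition res_diff :: "('o, 'm) cat \<Rightarrow> 'o \<Rightarrow> nat \<Rightarrow> 'm" where
  "res_diff C m = fst (snd (proj_res C m))"

definition ext_cocycles :: "('o, 'm) cat \<Rightarrow> nat \<Rightarrow> 'o \<Rightarrow> 'o \<Rightarrow> 'm set" where
  "ext_cocycles C n m x =
     {f \<in> Hom C (res_ob C m n) x. f \<cdot>\<^bsub>C\<^esub> res_diff C m n = Zero C (res_ob C m (Suc n)) x}"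

fun ext_coboundaries :: "('o, 'm) cat \<Rightarrow> nat \<Rightarrow> 'o \<Rightarrow> 'o \<Rightarrow> 'm set" where
  "ext_coboundaries C 0 m x = {Zero C (res_ob C m 0) x}"
| "ext_coboundaries C (Suc n) m x = (\<lambda>f. f \<cdot>\<^bsub>C\<^esub> res_diff C m n) ` Hom C (res_ob C m n) x"

text \<open>\<open>Ext C n m x\<close> is the \<open>n\<close>-th cohomology group of the complex \<open>Hom(P, x)\<close>, where \<open>P\<close>
  resolves \<open>m\<close>.\<close>

definition Ext :: "('o, 'm) cat \<Rightarrow> nat \<Rightarrow> 'o \<Rightarrow> 'o \<Rightarrow> 'm set monoid" where
  "Ext C n m x =
     (hom_group C (res_ob C m n) x)\<lparr>carrier := ext_cocycles C n m x\<rparr> Mod ext_coboundaries C n m x"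


section \<open>Functors and left derived functors\<close>

record ('o, 'm, 'p, 'n) functor_data =
  on_ob :: "'o \<Rightarrow> 'p"
  on_mor :: "'m \<Rightarrow> 'n"

definition additive_functor ::
  "('o, 'm) cat \<Rightarrow> ('p, 'n) cat \<Rightarrow> ('o, 'm, 'p, 'n) functor_data \<Rightarrow> bool" where
  "additive_functor C D F \<longleftrightarrow>
     (\<forall>a\<in>Ob C. on_ob F a \<in> Ob D) \<and>
     (\<forall>a\<in>Ob C. \<forall>b\<in>Ob C. \<forall>f\<in>Hom C a b. on_mor F f \<in> Hom D (on_ob F a) (on_ob F b)) \<and>
     (\<forall>a\<in>Ob C. on_mor F (Ident C a) = Ident D (on_ob F a)) \<and>
     (\<forall>a\<in>Ob C. \<forall>b\<in>Ob C. \<forall>c\<in>Ob C. \<forall>f\<in>Hom C a b. \<forall>g\<in>Hom C b c.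
        on_mor F (g \<cdot>\<^bsub>C\<^esub> f) = on_mor F g \<cdot>\<^bsub>D\<^esub> on_mor F f) \<and>
     (\<forall>a\<in>Ob C. \<forall>b\<in>Ob C. \<forall>f\<in>Hom C a b. \<forall>g\<in>Hom C a b.
        on_mor F (Add C f g) = Add D (on_mor F f) (on_mor F g))"

definition right_exact ::
  "('o, 'm) cat \<Rightarrow> ('p, 'n) cat \<Rightarrow> ('o, 'm, 'p, 'n) functor_data \<Rightarrow> bool" where
  "right_exact C D F \<longleftrightarrow> (\<forall>a f b g c. short_exact C a f b g c \<longrightarrow>
     exact_at D (on_ob F a) (on_mor F f) (on_ob F b) (on_mor F g) (on_ob F c) \<and>
     epic D (on_ob F b) (on_ob F c) (on_mor F g))"

text \<open>The homology at \<open>b\<close> of \<open>a \<rightarrow> b \<rightarrow> c\<close>: the cokernel of the arrow that \<open>a \<rightarrow> b\<close> induces into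
  the kernel of \<open>b \<rightarrow> c\<close>.\<close>

definition is_homology :: "('o, 'm) cat \<Rightarrow> 'o \<Rightarrow> 'm \<Rightarrow> 'o \<Rightarrow> 'm \<Rightarrow> 'o \<Rightarrow> 'o \<Rightarrow> bool" where
  "is_homology C a f b g c h \<longleftrightarrow> (\<exists>k i u p. is_kernel C k i b g c \<and>
     u \<in> Hom C a k \<and> i \<cdot>\<^bsub>C\<^esub> u = f \<and> is_cokernel C a u k p h)"

fun is_left_derived ::
  "('o, 'm) cat \<Rightarrow> ('p, 'n) cat \<Rightarrow> ('o, 'm, 'p, 'n) functor_data \<Rightarrow> nat \<Rightarrow> 'o \<Rightarrow> 'p \<Rightarrow> bool" where
  "is_left_derived C D F 0 m h \<longleftrightarrow>
     (\<exists>p. is_cokernel D (on_ob F (res_ob C m 1)) (on_mor F (res_diff C m 0))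
        (on_ob F (res_ob C m 0)) p h)"
| "is_left_derived C D F (Suc n) m h \<longleftrightarrow>
     is_homology D (on_ob F (res_ob C m (Suc (Suc n)))) (on_mor F (res_diff C m (Suc n)))
       (on_ob F (res_ob C m (Suc n))) (on_mor F (res_diff C m n)) (on_ob F (res_ob C m n)) h"

definition left_derived ::
  "('o, 'm) cat \<Rightarrow> ('p, 'n) cat \<Rightarrow> ('o, 'm, 'p, 'n) functor_data \<Rightarrow> nat \<Rightarrow> 'o \<Rightarrow> 'p" where
  "left_derived C D F n m = (SOME h. is_left_derived C D F n m h)"


section \<open>Cotorsion pairs\<close>

definition right_perp :: "('o, 'm) cat \<Rightarrow> 'o set \<Rightarrow> 'o set" where
  "right_perp C M = {x \<in> Ob C. \<forall>m\<in>M. trivial_group (Ext C 1 m x)}"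

definition left_perp :: "('o, 'm) cat \<Rightarrow> 'o set \<Rightarrow> 'o set" where
  "left_perp C M = {x \<in> Ob C. \<forall>m\<in>M. trivial_group (Ext C 1 x m)}"

text \<open>The classes are sets of objects, regarded as full subcategories.  Over an abelian category with
  enough projectives, both classes of a cotorsion pair are automatically closed under isomorphisms
  and finite direct sums, so these conditions are not repeated.\<close>

definition cotorsion_pair :: "('o, 'm) cat \<Rightarrow> 'o set \<Rightarrow> 'o set \<Rightarrow> bool" where
  "cotorsion_pair C X Y \<longleftrightarrow> X = left_perp C Y \<and> Y = right_perp C X"

definition complete_cotorsion_pair :: "('o, 'm) cat \<Rightarrow> 'o set \<Rightarrow> 'o set \<Rightarrow> bool" where
  "complete_cotorsion_pair C X Y \<longleftrightarrow> cotorsion_pair C X Y \<and>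
     (\<forall>e\<in>Ob C.
        (\<exists>x\<in>X. \<exists>y\<in>Y. \<exists>f g. short_exact C y f x g e) \<and>
        (\<exists>x\<in>X. \<exists>y\<in>Y. \<exists>f g. short_exact C e f y g x))"

definition hereditary_cotorsion_pair :: "('o, 'm) cat \<Rightarrow> 'o set \<Rightarrow> 'o set \<Rightarrow> bool" where
  "hereditary_cotorsion_pair C X Y \<longleftrightarrow> cotorsion_pair C X Y \<and>
     (\<forall>i\<ge>1. \<forall>x\<in>X. \<forall>y\<in>Y. trivial_group (Ext C i x y))"


section \<open>Right trivial extensions\<close>

definition right_trivial_extension ::
  "('o, 'm) cat \<Rightarrow> ('o, 'm, 'o, 'm) functor_data \<Rightarrow> ('o \<times> 'm, 'm) cat" where
  "right_trivial_extension B F =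
     \<lparr>Ob = {(b, f). b \<in> Ob B \<and> f \<in> Hom B (on_ob F b) b \<and>
              f \<cdot>\<^bsub>B\<^esub> on_mor F f = Zero B (on_ob F (on_ob F b)) b},
      Hom = (\<lambda>(b, f) (b', f'). {\<alpha> \<in> Hom B b b'. \<alpha> \<cdot>\<^bsub>B\<^esub> f = f' \<cdot>\<^bsub>B\<^esub> on_mor F \<alpha>}),
      Comp = Comp B,
      Ident = (\<lambda>(b, f). Ident B b),
      Add = Add B,
      Zero = (\<lambda>(b, f) (b', f'). Zero B b b')\<rparr>"

definition forgetful :: "('o \<times> 'm, 'm, 'o, 'm) functor_data" where
  "forgetful = \<lparr>on_ob = fst, on_mor = id\<rparr>"

definition preimage_class ::
  "('o, 'm) cat \<Rightarrow> ('o, 'm, 'p, 'n) functor_data \<Rightarrow> 'p set \<Rightarrow> 'o set" where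
  "preimage_class C F Y = {a \<in> Ob C. on_ob F a \<in> Y}"

end

theory Submission
  imports Defs
begin

text \<open>
  Write \<open>U\<close> for the forgetful functor from the trivial extension and \<open>T\<close> for its left adjoint,
  so that \<open>U T b = b \<oplus> F b\<close>.  For \<open>x \<in> X\<close>, \<open>Ext\<^sup>1(T x, n) = 0\<close> if and only if
  \<open>Ext\<^sup>1(x, U n) = 0\<close>: from right to left one lifts maps along the adjunction; for the converse,
  \<open>L\<^sub>1 F x = 0\<close> makes \<open>T\<close> preserve the monomorphism from a syzygy of \<open>x\<close> to a projective, so maps from
  the syzygy to \<open>U j\<close> extend when \<open>j\<close> is injective.  Hence the preimage of \<open>Y\<close> is the right orthogonal
  of \<open>T X\<close>, which gives a cotorsion pair.  A special precover of \<open>(b, f)\<close> is the map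
  \<open>T x \<rightarrow> (b, f)\<close> adjoint to a special precover \<open>x \<rightarrow> b\<close> with kernel \<open>k\<close>, since its kernel is an
  extension of \<open>F x \<in> Y\<close> by \<open>k \<in> Y\<close>.  Special preenvelopes follow by pulling back along an injective
  embedding, and heredity by dimension shifting, as the preimage of \<open>Y\<close> is closed under cokernels of
  monomorphisms.
\<close>

section \<open>Preadditive categories\<close>

text \<open>\<open>T\<close> is only right exact, so applying it to a projective resolution of
  \<open>x\<close> need not give a resolution of \<open>T x\<close>, and the Ext groups of the two
  categories cannot be identified degree by degree. Hence only vanishing in degree one is compared,
  as a lifting property against short exact sequences. The comparison is asymmetric. Since
  \<open>U\<close> is exact, a lifting problem in the trivial extension passes down to the base at
  no cost. The way back has to extend maps into the object underlying an injective, and such an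
  object is only shown to be injective relative to monomorphisms that \<open>F\<close> keeps monic.
  Heredity of the given pair enters through the vanishing of its second Ext, which makes
  \<open>Y\<close> closed under cokernels of monomorphisms. Diagram chases use maps out of
  projectives as generalized elements, and subtraction is replaced by writing one map as another
  plus a correction.\<close>

context category
begin

text \<open>Hom-sets may overlap, so source and target have to be written out. Bundling them with
  the object premises of the locale axioms lets facts about arrows be chained directly.\<close>

definition arr :: "'m \<Rightarrow> 'o \<Rightarrow> 'o \<Rightarrow> bool"  ("_ \<Colon> _ \<leadsto> _" [51, 51, 51] 50) where
  "f \<Colon> a \<leadsto> b \<longleftrightarrow> a \<in> Ob C \<and> b \<in> Ob C \<and> f \<in> Hom C a b"

lemma arr_Ob: "f \<Colon> a \<leadsto> b \<Longrightarrow> a \<in> Ob C" "f \<Colon> a \<leadsto> b \<Longrightarrow> b \<in> Ob C"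
  and arr_Hom: "f \<Colon> a \<leadsto> b \<Longrightarrow> f \<in> Hom C a b"
  by (simp_all add: arr_def)

lemma ident_arr [intro]: "a \<in> Ob C \<Longrightarrow> Ident C a \<Colon> a \<leadsto> a"
  by (simp add: arr_def ident_in_hom)

lemma comp_arr [intro]: "g \<Colon> b \<leadsto> c \<Longrightarrow> f \<Colon> a \<leadsto> b \<Longrightarrow> g \<cdot> f \<Colon> a \<leadsto> c"
  by (auto simp: arr_def intro: comp_in_hom)

lemma assoc: "h \<Colon> c \<leadsto> e \<Longrightarrow> g \<Colon> b \<leadsto> c \<Longrightarrow> f \<Colon> a \<leadsto> b \<Longrightarrow> (h \<cdot> g) \<cdot> f = h \<cdot> (g \<cdot> f)"
  by (auto simp: arr_def intro: comp_assoc)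

lemma ident_right: "f \<Colon> a \<leadsto> b \<Longrightarrow> f \<cdot> Ident C a = f"
  and ident_left: "f \<Colon> a \<leadsto> b \<Longrightarrow> Ident C b \<cdot> f = f"
  by (auto simp: arr_def intro: comp_ident ident_comp)

lemma monic_arr: "monic C a b f \<Longrightarrow> a \<in> Ob C \<Longrightarrow> b \<in> Ob C \<Longrightarrow> f \<Colon> a \<leadsto> b"
  by (simp add: monic_def arr_def)

lemma epic_arr: "epic C a b f \<Longrightarrow> a \<in> Ob C \<Longrightarrow> b \<in> Ob C \<Longrightarrow> f \<Colon> a \<leadsto> b"
  by (simp add: epic_def arr_def)

lemma monic_cancel: "monic C a b f \<Longrightarrow> g \<Colon> x \<leadsto> a \<Longrightarrow> h \<Colon> x \<leadsto> a \<Longrightarrow> f \<cdot> g = f \<cdot> h \<Longrightarrow> g = h"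
  by (auto simp: monic_def arr_def)

lemma epic_cancel: "epic C a b f \<Longrightarrow> g \<Colon> b \<leadsto> x \<Longrightarrow> h \<Colon> b \<leadsto> x \<Longrightarrow> g \<cdot> f = h \<cdot> f \<Longrightarrow> g = h"
  by (auto simp: epic_def arr_def)

lemma monic_right_factor:
  assumes "monic C a c (g \<cdot> f)" "g \<Colon> b \<leadsto> c" "f \<Colon> a \<leadsto> b"
  shows "monic C a b f"
proof -
  have "u = v" if "u \<Colon> x \<leadsto> a" "v \<Colon> x \<leadsto> a" "f \<cdot> u = f \<cdot> v" for x u v
    using monic_cancel[OF assms(1) that(1,2)] assoc[OF assms(2,3) that(1)]
      assoc[OF assms(2,3) that(2)] that(3) by simp
  then show ?thesis unfolding monic_def using assms(3) by (auto simp: arr_def)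
qed

lemma epic_left_factor:
  assumes "epic C a c (g \<cdot> f)" "g \<Colon> b \<leadsto> c" "f \<Colon> a \<leadsto> b"
  shows "epic C b c g"
proof -
  have "u = v" if "u \<Colon> c \<leadsto> x" "v \<Colon> c \<leadsto> x" "u \<cdot> g = v \<cdot> g" for x u v
    using epic_cancel[OF assms(1) that(1,2)] assoc[OF that(1) assms(2,3)]
      assoc[OF that(2) assms(2,3)] that(3) by simp
  then show ?thesis unfolding epic_def using assms(2) by (auto simp: arr_def)
qed

lemma projective_lift:
  assumes "projective C p" "epic C a b e" "a \<in> Ob C" "f \<Colon> p \<leadsto> b"
  obtains g where "g \<Colon> p \<leadsto> a" "e \<cdot> g = f"
  using assms unfolding projective_def arr_def by blast

lemma injective_extend:
  assumes "injective C j" "monic C a b m" "b \<in> Ob C" "f \<Colon> a \<leadsto> j"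
  obtains g where "g \<Colon> b \<leadsto> j" "g \<cdot> m = f"
  using assms unfolding injective_def arr_def by blast

end

context preadditive_category
begin

section \<open>Arithmetic of the hom-groups\<close>

abbreviation add (infixl "\<boxplus>" 65) where "f \<boxplus> g \<equiv> Add C f g"

lemma zero_arr [intro]: "a \<in> Ob C \<Longrightarrow> b \<in> Ob C \<Longrightarrow> Zero C a b \<Colon> a \<leadsto> b"
  using comm_group.axioms(2)[OF hom_comm_group] group.is_monoid[THEN monoid.one_closed]
  by (fastforce simp: arr_def hom_group_def)

lemma add_arr [intro]: "f \<Colon> a \<leadsto> b \<Longrightarrow> g \<Colon> a \<leadsto> b \<Longrightarrow> f \<boxplus> g \<Colon> a \<leadsto> b"
  using comm_group.axioms(2)[OF hom_comm_group] group.is_monoid[THEN monoid.m_closed]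
  by (fastforce simp: arr_def hom_group_def)

lemma hom_group: "a \<in> Ob C \<Longrightarrow> b \<in> Ob C \<Longrightarrow> group (hom_group C a b)"
  by (simp add: comm_group.axioms(2) hom_comm_group)

lemma add_zero_left: "f \<Colon> a \<leadsto> b \<Longrightarrow> Zero C a b \<boxplus> f = f"
  using monoid.l_one[OF group.is_monoid[OF hom_group[of a b]], of f]
  by (simp add: arr_def hom_group_def)

lemma add_zero_right: "f \<Colon> a \<leadsto> b \<Longrightarrow> f \<boxplus> Zero C a b = f"
  using monoid.r_one[OF group.is_monoid[OF hom_group[of a b]], of f]
  by (simp add: arr_def hom_group_def)

lemma add_commute: "f \<Colon> a \<leadsto> b \<Longrightarrow> g \<Colon> a \<leadsto> b \<Longrightarrow> f \<boxplus> g = g \<boxplus> f"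
  using comm_monoid.m_comm[OF comm_group.axioms(1)[OF hom_comm_group[of a b]], of f g]
  by (simp add: arr_def hom_group_def)

lemma add_cancel:
  assumes "f \<boxplus> g = f \<boxplus> h" "f \<Colon> a \<leadsto> b" "g \<Colon> a \<leadsto> b" "h \<Colon> a \<leadsto> b"
  shows "g = h"
  using Group.group.right_cancel[OF hom_group[of a b], of f g h] assms
    add_commute[OF assms(2,3)] add_commute[OF assms(2,4)]
  by (simp add: arr_def hom_group_def)

lemma add_assoc:
  "f \<Colon> a \<leadsto> b \<Longrightarrow> g \<Colon> a \<leadsto> b \<Longrightarrow> h \<Colon> a \<leadsto> b \<Longrightarrow> (f \<boxplus> g) \<boxplus> h = f \<boxplus> (g \<boxplus> h)"
  using monoid.m_assoc[OF group.is_monoid[OF hom_group[of a b]], of f g h]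
  by (simp add: arr_def hom_group_def)

text \<open>The category record has no negation, so a difference is expressed by writing one map as
  the other plus a remainder \<open>h\<close>. Later subtractions, including the one in the pullback
  construction, take this form.\<close>

lemma add_diff:
  assumes "f \<Colon> a \<leadsto> b" "g \<Colon> a \<leadsto> b"
  obtains h where "h \<Colon> a \<leadsto> b" "f = g \<boxplus> h"
proof -
  interpret G: group "hom_group C a b" using assms by (auto simp: arr_def intro: hom_group)
  let ?h = "inv\<^bsub>hom_group C a b\<^esub> g \<otimes>\<^bsub>hom_group C a b\<^esub> f"
  have c: "f \<in> carrier (hom_group C a b)" "g \<in> carrier (hom_group C a b)"
    using assms by (auto simp: arr_def hom_group_def)
  then have "?h \<in> carrier (hom_group C a b)" "g \<otimes>\<^bsub>hom_group C a b\<^esub> ?h = f"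
    by (auto simp: G.m_assoc[symmetric])
  then show ?thesis using that[of ?h] assms by (auto simp: arr_def hom_group_def)
qed

lemma add_eq_self: "f \<boxplus> g = f \<Longrightarrow> f \<Colon> a \<leadsto> b \<Longrightarrow> g \<Colon> a \<leadsto> b \<Longrightarrow> g = Zero C a b"
  by (metis add_cancel add_zero_right arr_Ob zero_arr)

lemma comp_add_right: "g \<Colon> b \<leadsto> c \<Longrightarrow> f \<Colon> a \<leadsto> b \<Longrightarrow> f' \<Colon> a \<leadsto> b \<Longrightarrow> g \<cdot> (f \<boxplus> f') = g \<cdot> f \<boxplus> g \<cdot> f'"
  by (auto simp: arr_def intro: comp_add)

lemma comp_add_left: "g \<Colon> b \<leadsto> c \<Longrightarrow> g' \<Colon> b \<leadsto> c \<Longrightarrow> f \<Colon> a \<leadsto> b \<Longrightarrow> (g \<boxplus> g') \<cdot> f = g \<cdot> f \<boxplus> g' \<cdot> f"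
  by (auto simp: arr_def intro: add_comp)

lemma comp_zero: "g \<Colon> b \<leadsto> c \<Longrightarrow> a \<in> Ob C \<Longrightarrow> g \<cdot> Zero C a b = Zero C a c"
proof -
  assume g: "g \<Colon> b \<leadsto> c" and a: "a \<in> Ob C"
  have z: "Zero C a b \<Colon> a \<leadsto> b" using a arr_Ob[OF g] by auto
  have "g \<cdot> Zero C a b \<boxplus> g \<cdot> Zero C a b = g \<cdot> Zero C a b"
    using comp_add_right[OF g z z] add_zero_right[OF z] by simp
  then show ?thesis using add_eq_self comp_arr[OF g z] by blast
qed

lemma zero_comp: "f \<Colon> a \<leadsto> b \<Longrightarrow> c \<in> Ob C \<Longrightarrow> Zero C b c \<cdot> f = Zero C a c"
proof -
  assume f: "f \<Colon> a \<leadsto> b" and c: "c \<in> Ob C"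
  have z: "Zero C b c \<Colon> b \<leadsto> c" using c arr_Ob[OF f] by auto
  have "Zero C b c \<cdot> f \<boxplus> Zero C b c \<cdot> f = Zero C b c \<cdot> f"
    using comp_add_left[OF z z f] add_zero_right[OF z] by simp
  then show ?thesis using add_eq_self comp_arr[OF z f] by blast
qed

lemma comp_eq_zero_comp:
  "g \<cdot> f = Zero C a c \<Longrightarrow> g \<Colon> b \<leadsto> c \<Longrightarrow> f \<Colon> a \<leadsto> b \<Longrightarrow> h \<Colon> x \<leadsto> a \<Longrightarrow> g \<cdot> (f \<cdot> h) = Zero C x c"
  using assoc[of g b c f a h x] zero_comp[of h x a c] arr_Ob(2)[of g b c] by simp

lemma comp_comp_eq_zero:
  "g \<cdot> f = Zero C a c \<Longrightarrow> h \<Colon> c \<leadsto> x \<Longrightarrow> g \<Colon> b \<leadsto> c \<Longrightarrow> f \<Colon> a \<leadsto> b \<Longrightarrow> (h \<cdot> g) \<cdot> f = Zero C a x"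
  using assoc[of h c x g b f a] comp_zero[of h c x a] arr_Ob(1)[of f a b] by simp

lemma comp_add_eqD:
  assumes "f \<cdot> (v \<boxplus> w) = f \<cdot> v" "f \<Colon> b \<leadsto> c" "v \<Colon> a \<leadsto> b" "w \<Colon> a \<leadsto> b"
  shows "f \<cdot> w = Zero C a c"
  using add_eq_self[OF _ comp_arr[OF assms(2,3)] comp_arr[OF assms(2,4)]]
    comp_add_right[OF assms(2,3,4)] assms(1) by simp

lemma add_comp_eqD:
  assumes "(v \<boxplus> w) \<cdot> f = v \<cdot> f" "f \<Colon> a \<leadsto> b" "v \<Colon> b \<leadsto> c" "w \<Colon> b \<leadsto> c"
  shows "w \<cdot> f = Zero C a c"
  using add_eq_self[OF _ comp_arr[OF assms(3,2)] comp_arr[OF assms(4,2)]]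
    comp_add_left[OF assms(3,4,2)] assms(1) by simp

section \<open>Monomorphisms and epimorphisms tested against zero\<close>

lemma monicI:
  assumes f: "f \<Colon> a \<leadsto> b"
    and *: "\<And>x g. g \<Colon> x \<leadsto> a \<Longrightarrow> f \<cdot> g = Zero C x b \<Longrightarrow> g = Zero C x a"
  shows "monic C a b f"
proof -
  have "u = v" if u: "u \<Colon> x \<leadsto> a" and v: "v \<Colon> x \<leadsto> a" and eq: "f \<cdot> u = f \<cdot> v" for x u v
  proof -
    obtain w where w: "w \<Colon> x \<leadsto> a" "u = v \<boxplus> w" using add_diff[OF u v] .
    have "f \<cdot> w = Zero C x b"
      using comp_add_eqD[OF _ f v w(1)] eq w(2) by simp
    then show ?thesis using *[OF w(1)] w(2) v by (simp add: add_zero_right)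
  qed
  then show ?thesis unfolding monic_def using f by (auto simp: arr_def)
qed

lemma epicI:
  assumes f: "f \<Colon> a \<leadsto> b"
    and *: "\<And>x g. g \<Colon> b \<leadsto> x \<Longrightarrow> g \<cdot> f = Zero C a x \<Longrightarrow> g = Zero C b x"
  shows "epic C a b f"
proof -
  have "u = v" if u: "u \<Colon> b \<leadsto> x" and v: "v \<Colon> b \<leadsto> x" and eq: "u \<cdot> f = v \<cdot> f" for x u v
  proof -
    obtain w where w: "w \<Colon> b \<leadsto> x" "u = v \<boxplus> w" using add_diff[OF u v] .
    have "w \<cdot> f = Zero C a x"
      using add_comp_eqD[OF _ f v w(1)] eq w(2) by simp
    then show ?thesis using *[OF w(1)] w(2) v by (simp add: add_zero_right)
  qed
  then show ?thesis unfolding epic_def using f by (auto simp: arr_def)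
qed

lemma monic_zero: "monic C a b f \<Longrightarrow> g \<Colon> x \<leadsto> a \<Longrightarrow> b \<in> Ob C \<Longrightarrow> f \<cdot> g = Zero C x b \<Longrightarrow> g = Zero C x a"
proof -
  assume f: "monic C a b f" and g: "g \<Colon> x \<leadsto> a" and b: "b \<in> Ob C" and z: "f \<cdot> g = Zero C x b"
  have "f \<cdot> Zero C x a = Zero C x b"
    using comp_zero[OF monic_arr[OF f] arr_Ob(1)[OF g]] arr_Ob[OF g] b by simp
  then show ?thesis using monic_cancel[OF f g zero_arr] z arr_Ob[OF g] by simp
qed

lemma epic_zero: "epic C a b f \<Longrightarrow> g \<Colon> b \<leadsto> x \<Longrightarrow> a \<in> Ob C \<Longrightarrow> g \<cdot> f = Zero C a x \<Longrightarrow> g = Zero C b x"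
proof -
  assume f: "epic C a b f" and g: "g \<Colon> b \<leadsto> x" and a: "a \<in> Ob C" and z: "g \<cdot> f = Zero C a x"
  have "Zero C b x \<cdot> f = Zero C a x"
    using zero_comp[OF epic_arr[OF f] arr_Ob(2)[OF g]] arr_Ob[OF g] a by simp
  then show ?thesis using epic_cancel[OF f g zero_arr] z arr_Ob[OF g] by simp
qed

section \<open>Universal properties of kernels and cokernels\<close>

lemma kernel_arr: "is_kernel C k i a f b \<Longrightarrow> a \<in> Ob C \<Longrightarrow> i \<Colon> k \<leadsto> a"
  by (simp add: is_kernel_def arr_def)

lemma kernel_comp: "is_kernel C k i a f b \<Longrightarrow> f \<cdot> i = Zero C k b"
  by (simp add: is_kernel_def)

lemma kernel_lift:
  assumes "is_kernel C k i a f b" "g \<Colon> x \<leadsto> a" "f \<cdot> g = Zero C x b"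
  obtains u where "u \<Colon> x \<leadsto> k" "i \<cdot> u = g"
proof -
  have "k \<in> Ob C" "\<exists>!u. u \<in> Hom C x k \<and> i \<cdot> u = g"
    using assms unfolding is_kernel_def arr_def by auto
  then show ?thesis using that assms(2) unfolding arr_def by blast
qed

text \<open>If \<open>i \<cdot> g\<close> is zero, then \<open>g\<close> and the zero map both
  factor the zero map through \<open>i\<close>, and such a factorization is unique.\<close>

lemma kernel_monic:
  assumes "is_kernel C k i a f b" "a \<in> Ob C" "b \<in> Ob C"
  shows "monic C k a i"
proof -
  have i: "i \<Colon> k \<leadsto> a" and f: "f \<Colon> a \<leadsto> b"
    using assms by (auto simp: is_kernel_def arr_def)
  show ?thesis
  proof (rule monicI[OF i])
    fix x g assume g: "g \<Colon> x \<leadsto> k" "i \<cdot> g = Zero C x a"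
    have x: "x \<in> Ob C" "k \<in> Ob C" using g by (auto simp: arr_def)
    have z: "Zero C x a \<Colon> x \<leadsto> a" using x assms by auto
    have "f \<cdot> Zero C x a = Zero C x b" using comp_zero[OF f x(1)] .
    then have "\<exists>!u. u \<in> Hom C x k \<and> i \<cdot> u = Zero C x a"
      using assms(1) x z unfolding is_kernel_def arr_def by auto
    moreover have "i \<cdot> Zero C x k = Zero C x a" using comp_zero[OF i x(1)] .
    ultimately show "g = Zero C x k"
      using g zero_arr[OF x] unfolding arr_def by blast
  qed
qed

lemma is_kernelI:
  assumes i: "monic C k a i" and "k \<in> Ob C" and f: "f \<Colon> a \<leadsto> b" and z: "f \<cdot> i = Zero C k b"
    and *: "\<And>x g. g \<Colon> x \<leadsto> a \<Longrightarrow> f \<cdot> g = Zero C x b \<Longrightarrow> \<exists>u. u \<Colon> x \<leadsto> k \<and> i \<cdot> u = g"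
  shows "is_kernel C k i a f b"
  unfolding is_kernel_def
proof (intro conjI ballI impI)
  fix x g assume x: "x \<in> Ob C" "g \<in> Hom C x a" "f \<cdot> g = Zero C x b"
  then have "g \<Colon> x \<leadsto> a" using f by (simp add: arr_def)
  then obtain u where u: "u \<Colon> x \<leadsto> k" "i \<cdot> u = g" using * x by blast
  show "\<exists>!u. u \<in> Hom C x k \<and> i \<cdot> u = g"
  proof (rule ex1I[of _ u])
    fix v assume v: "v \<in> Hom C x k \<and> i \<cdot> v = g"
    then have "v \<Colon> x \<leadsto> k" using u x by (simp add: arr_def)
    then show "v = u" using monic_cancel[OF i _ u(1)] u v by simp
  qed (use u in \<open>simp add: arr_def\<close>)
qed (use assms in \<open>auto simp: monic_def arr_def\<close>)

lemma cokernel_arr: "is_cokernel C a f b p q \<Longrightarrow> b \<in> Ob C \<Longrightarrow> p \<Colon> b \<leadsto> q"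
  by (simp add: is_cokernel_def arr_def)

lemma cokernel_comp: "is_cokernel C a f b p q \<Longrightarrow> p \<cdot> f = Zero C a q"
  by (simp add: is_cokernel_def)

lemma cokernel_factor:
  assumes "is_cokernel C a f b p q" "g \<Colon> b \<leadsto> x" "g \<cdot> f = Zero C a x"
  obtains u where "u \<Colon> q \<leadsto> x" "u \<cdot> p = g"
proof -
  have "q \<in> Ob C" "\<exists>!u. u \<in> Hom C q x \<and> u \<cdot> p = g"
    using assms unfolding is_cokernel_def arr_def by auto
  then show ?thesis using that assms(2) unfolding arr_def by blast
qed

lemma cokernel_epic:
  assumes "is_cokernel C a f b p q" "a \<in> Ob C" "b \<in> Ob C"
  shows "epic C b q p"
proof -
  have p: "p \<Colon> b \<leadsto> q" and f: "f \<Colon> a \<leadsto> b"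
    using assms by (auto simp: is_cokernel_def arr_def)
  show ?thesis
  proof (rule epicI[OF p])
    fix x g assume g: "g \<Colon> q \<leadsto> x" "g \<cdot> p = Zero C b x"
    have x: "q \<in> Ob C" "x \<in> Ob C" using g by (auto simp: arr_def)
    have z: "Zero C b x \<Colon> b \<leadsto> x" using x assms by auto
    have "Zero C b x \<cdot> f = Zero C a x" using zero_comp[OF f x(2)] .
    then have "\<exists>!u. u \<in> Hom C q x \<and> u \<cdot> p = Zero C b x"
      using assms(1) x z unfolding is_cokernel_def arr_def by auto
    moreover have "Zero C q x \<cdot> p = Zero C b x" using zero_comp[OF p x(2)] .
    ultimately show "g = Zero C q x"
      using g zero_arr[OF x] unfolding arr_def by blast
  qed
qed

lemma is_cokernelI:
  assumes p: "epic C b q p" and "q \<in> Ob C" and f: "f \<Colon> a \<leadsto> b" and z: "p \<cdot> f = Zero C a q"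
    and *: "\<And>x g. g \<Colon> b \<leadsto> x \<Longrightarrow> g \<cdot> f = Zero C a x \<Longrightarrow> \<exists>u. u \<Colon> q \<leadsto> x \<and> u \<cdot> p = g"
  shows "is_cokernel C a f b p q"
  unfolding is_cokernel_def
proof (intro conjI ballI impI)
  fix x g assume x: "x \<in> Ob C" "g \<in> Hom C b x" "g \<cdot> f = Zero C a x"
  then have "g \<Colon> b \<leadsto> x" using f by (simp add: arr_def)
  then obtain u where u: "u \<Colon> q \<leadsto> x" "u \<cdot> p = g" using * x by blast
  show "\<exists>!u. u \<in> Hom C q x \<and> u \<cdot> p = g"
  proof (rule ex1I[of _ u])
    fix v assume v: "v \<in> Hom C q x \<and> v \<cdot> p = g"
    then have "v \<Colon> q \<leadsto> x" using u x by (simp add: arr_def)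
    then show "v = u" using epic_cancel[OF p _ u(1)] u v by simp
  qed (use u in \<open>simp add: arr_def\<close>)
qed (use assms in \<open>auto simp: epic_def arr_def\<close>)

text \<open>The correction step of diagram chases: a map that is right only after composition with
  \<open>f\<close> is repaired by a map into the kernel.\<close>

lemma kernel_diff:
  assumes k: "is_kernel C k i b f c" "c \<in> Ob C" and g: "g \<Colon> x \<leadsto> b" and h: "h \<Colon> x \<leadsto> b"
    and eq: "f \<cdot> g = f \<cdot> h"
  obtains u where "u \<Colon> x \<leadsto> k" "g = h \<boxplus> i \<cdot> u"
proof -
  have f: "f \<Colon> b \<leadsto> c" using assms by (auto simp: is_kernel_def arr_def)
  obtain w where w: "w \<Colon> x \<leadsto> b" "g = h \<boxplus> w" using add_diff[OF g h] .
  have "f \<cdot> w = Zero C x c" using comp_add_eqD[OF _ f h w(1)] eq w(2) by simp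
  then show ?thesis using kernel_lift[OF k(1) w(1)] w that by metis
qed

lemma cokernel_diff:
  assumes k: "is_cokernel C a f b p q" "a \<in> Ob C" and g: "g \<Colon> b \<leadsto> x" and h: "h \<Colon> b \<leadsto> x"
    and eq: "g \<cdot> f = h \<cdot> f"
  obtains u where "u \<Colon> q \<leadsto> x" "g = h \<boxplus> u \<cdot> p"
proof -
  have f: "f \<Colon> a \<leadsto> b" using assms by (auto simp: is_cokernel_def arr_def)
  obtain w where w: "w \<Colon> b \<leadsto> x" "g = h \<boxplus> w" using add_diff[OF g h] .
  have "w \<cdot> f = Zero C a x" using add_comp_eqD[OF _ f h w(1)] eq w(2) by simp
  then show ?thesis using cokernel_factor[OF k(1) w(1)] w that by metis
qed

end

section \<open>Abelian categories\<close>

context abelian_category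
begin

text \<open>Normality only says that \<open>g\<close> is the cokernel of some \<open>h\<close>. That
  \<open>h\<close> factors through every kernel \<open>i\<close> of \<open>g\<close>, so a map
  killing \<open>i\<close> kills \<open>h\<close> and descends along \<open>g\<close>.\<close>

lemma epic_kernel_cokernel:
  assumes g: "epic C b c g" and k: "is_kernel C k i b g c" and Ob: "b \<in> Ob C" "c \<in> Ob C"
  shows "is_cokernel C k i b g c"
proof -
  have ga: "g \<Colon> b \<leadsto> c" and i: "i \<Colon> k \<leadsto> b"
    using g k Ob by (auto intro: epic_arr kernel_arr)
  obtain e h where e: "e \<in> Ob C" "is_cokernel C e h b g c"
    using epic_normal[OF Ob g] by auto
  then have h: "h \<Colon> e \<leadsto> b" using Ob by (auto simp: is_cokernel_def arr_def)
  obtain w where w: "w \<Colon> e \<leadsto> k" "i \<cdot> w = h"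
    using kernel_lift[OF k h cokernel_comp[OF e(2)]] .
  show ?thesis
  proof (rule is_cokernelI[OF g Ob(2) i kernel_comp[OF k]])
    fix x u assume u: "u \<Colon> b \<leadsto> x" "u \<cdot> i = Zero C k x"
    have "u \<cdot> h = Zero C e x"
      using assoc[OF u(1) i w(1)] zero_comp[OF w(1) arr_Ob(2)[OF u(1)]] u(2) w(2) by simp
    then show "\<exists>v. v \<Colon> c \<leadsto> x \<and> v \<cdot> g = u" using cokernel_factor[OF e(2) u(1)] by metis
  qed
qed

lemma monic_cokernel_kernel:
  assumes f: "monic C a b f" and k: "is_cokernel C a f b p q" and Ob: "a \<in> Ob C" "b \<in> Ob C"
  shows "is_kernel C a f b p q"
proof -
  have fa: "f \<Colon> a \<leadsto> b" and p: "p \<Colon> b \<leadsto> q"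
    using f k Ob by (auto intro: monic_arr cokernel_arr)
  obtain e h where e: "e \<in> Ob C" "is_kernel C a f b h e"
    using monic_normal[OF Ob f] by auto
  then have h: "h \<Colon> b \<leadsto> e" using Ob by (auto simp: is_kernel_def arr_def)
  obtain w where w: "w \<Colon> q \<leadsto> e" "w \<cdot> p = h"
    using cokernel_factor[OF k h kernel_comp[OF e(2)]] .
  show ?thesis
  proof (rule is_kernelI[OF f Ob(1) p cokernel_comp[OF k]])
    fix x u assume u: "u \<Colon> x \<leadsto> b" "p \<cdot> u = Zero C x q"
    have "h \<cdot> u = Zero C x e"
      using assoc[OF w(1) p u(1)] comp_zero[OF w(1) arr_Ob(1)[OF u(1)]] u(2) w(2) by simp
    then show "\<exists>v. v \<Colon> x \<leadsto> a \<and> f \<cdot> v = u" using kernel_lift[OF e(2) u(1)] by metis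
  qed
qed

lemma exact_at_comp_zero:
  assumes "exact_at C a f b g c" "a \<in> Ob C" "b \<in> Ob C" "c \<in> Ob C"
  shows "g \<cdot> f = Zero C a c"
proof -
  have f: "f \<Colon> a \<leadsto> b" and g: "g \<Colon> b \<leadsto> c" using assms by (auto simp: exact_at_def arr_def)
  obtain k i p q where k: "is_cokernel C a f b p q" "is_kernel C k i b p q" "is_kernel C k i b g c"
    using assms(1) by (auto simp: exact_at_def is_image_def)
  then have i: "i \<Colon> k \<leadsto> b" using assms by (auto intro: kernel_arr)
  obtain v where v: "v \<Colon> a \<leadsto> k" "i \<cdot> v = f"
    using kernel_lift[OF k(2) f cokernel_comp[OF k(1)]] .
  show ?thesis using comp_eq_zero_comp[OF kernel_comp[OF k(3)] g i v(1)] v by simp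
qed

text \<open>Exactness at \<open>b\<close> gives one \<open>i\<close> that is a kernel both of
  \<open>g\<close> and of the cokernel \<open>p\<close> of \<open>f\<close>, while the monomorphism
  \<open>f\<close> is itself a kernel of \<open>p\<close>. Maps killed by \<open>g\<close> therefore
  factor through \<open>f\<close>.\<close>

lemma short_exact_kernel:
  assumes "short_exact C a f b g c"
  shows "is_kernel C a f b g c"
proof -
  have Ob: "a \<in> Ob C" "b \<in> Ob C" "c \<in> Ob C" and m: "monic C a b f" and e: "exact_at C a f b g c"
    using assms by (auto simp: short_exact_def)
  have f: "f \<Colon> a \<leadsto> b" and g: "g \<Colon> b \<leadsto> c" using e Ob by (auto simp: exact_at_def arr_def)
  obtain k i p q where k: "is_cokernel C a f b p q" "is_kernel C k i b p q" "is_kernel C k i b g c"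
    using e by (auto simp: exact_at_def is_image_def)
  have i: "i \<Colon> k \<leadsto> b" and p: "p \<Colon> b \<leadsto> q" using k Ob by (auto intro: kernel_arr cokernel_arr)
  note fk = monic_cokernel_kernel[OF m k(1) Ob(1,2)]
  show ?thesis
  proof (rule is_kernelI[OF m Ob(1) g exact_at_comp_zero[OF e Ob]])
    fix x u assume u: "u \<Colon> x \<leadsto> b" "g \<cdot> u = Zero C x c"
    obtain w where w: "w \<Colon> x \<leadsto> k" "i \<cdot> w = u" using kernel_lift[OF k(3) u] .
    have "p \<cdot> u = Zero C x q" using comp_eq_zero_comp[OF kernel_comp[OF k(2)] p i w(1)] w by simp
    then show "\<exists>v. v \<Colon> x \<leadsto> a \<and> f \<cdot> v = u" using kernel_lift[OF fk u(1)] by metis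
  qed
qed

text \<open>An epimorphism is the cokernel of its kernel, so \<open>f\<close> serves as its own
  image and exactness in the middle comes for free.\<close>

lemma short_exactI:
  assumes "is_kernel C a f b g c" "epic C b c g" and Ob: "b \<in> Ob C" "c \<in> Ob C"
  shows "short_exact C a f b g c"
proof -
  have "is_cokernel C a f b g c" using epic_kernel_cokernel[OF assms(2,1) Ob] .
  then have "is_image C a f a f b" using assms(1) unfolding is_image_def by blast
  moreover have "a \<in> Ob C" "f \<Colon> a \<leadsto> b" "g \<Colon> b \<leadsto> c"
    using assms by (auto simp: is_kernel_def arr_def)
  ultimately show ?thesis using assms kernel_monic[OF assms(1) Ob]
    unfolding short_exact_def exact_at_def by (auto simp: arr_def)
qed

text \<open>Later proofs quote these facts by position: 1 to 3 are the objects, 4 and 5 the arrows,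
  6 and 7 monic and epic, 8 the kernel, 9 the cokernel, 10 the zero composite.\<close>

lemma short_exactD:
  assumes "short_exact C a f b g c"
  shows "a \<in> Ob C" "b \<in> Ob C" "c \<in> Ob C" "f \<Colon> a \<leadsto> b" "g \<Colon> b \<leadsto> c" "monic C a b f" "epic C b c g"
    "is_kernel C a f b g c" "is_cokernel C a f b g c" "g \<cdot> f = Zero C a c"
  using assms short_exact_kernel[OF assms] kernel_comp[OF short_exact_kernel[OF assms]]
  by (auto simp: short_exact_def intro: monic_arr epic_arr epic_kernel_cokernel)

text \<open>Precomposition with the epimorphism \<open>e\<close> leaves the cokernel of
  \<open>i\<close> unchanged, so the image of \<open>i \<cdot> e\<close> is \<open>i\<close>. The
  differentials of a resolution are spliced in this shape.\<close>

lemma exact_atI: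
  assumes k: "is_kernel C k i b g c" and e: "epic C a k e" and Ob: "a \<in> Ob C" "b \<in> Ob C" "c \<in> Ob C"
  shows "exact_at C a (i \<cdot> e) b g c"
proof -
  have kOb: "k \<in> Ob C" and i: "i \<Colon> k \<leadsto> b" and g: "g \<Colon> b \<leadsto> c" and m: "monic C k b i"
    using k Ob by (auto simp: is_kernel_def arr_def intro: kernel_monic)
  have ea: "e \<Colon> a \<leadsto> k" using e Ob kOb by (auto intro: epic_arr)
  obtain p q where p: "is_cokernel C k i b p q" using cokernels[OF arr_Ob[OF i] arr_Hom[OF i]]
    by blast
  have pa: "p \<Colon> b \<leadsto> q" using p Ob by (auto intro: cokernel_arr)
  have pe: "epic C b q p" using cokernel_epic[OF p kOb Ob(2)] .
  have "is_cokernel C a (i \<cdot> e) b p q"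
  proof
    (rule is_cokernelI[OF pe arr_Ob(2)[OF pa] comp_arr[OF i ea] comp_eq_zero_comp[OF cokernel_comp[OF p] pa i ea]])
    fix x u assume u: "u \<Colon> b \<leadsto> x" "u \<cdot> (i \<cdot> e) = Zero C a x"
    have "u \<cdot> i = Zero C k x"
      using epic_zero[OF e comp_arr[OF u(1) i] Ob(1)] assoc[OF u(1) i ea] u(2) by simp
    then show "\<exists>v. v \<Colon> q \<leadsto> x \<and> v \<cdot> p = u" using cokernel_factor[OF p u(1)] by metis
  qed
  then have "is_image C k i a (i \<cdot> e) b"
    using monic_cokernel_kernel[OF m p kOb Ob(2)] unfolding is_image_def by blast
  then show ?thesis using k comp_arr[OF i ea] g unfolding exact_at_def by (auto simp: arr_def)
qed

section \<open>Biproducts\<close>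

context
  fixes a b s i j p q
  assumes bp: "is_biproduct C a b s i j p q" and Ob: "a \<in> Ob C" "b \<in> Ob C"
begin

lemma biproduct_arr:
  shows biproduct_inl_arr: "i \<Colon> a \<leadsto> s" and biproduct_inr_arr: "j \<Colon> b \<leadsto> s"
    and biproduct_fst_arr: "p \<Colon> s \<leadsto> a" and biproduct_snd_arr: "q \<Colon> s \<leadsto> b"
  using bp Ob by (auto simp: is_biproduct_def arr_def)

lemma biproduct_eqs:
  shows biproduct_fst_inl: "p \<cdot> i = Ident C a" and biproduct_snd_inr: "q \<cdot> j = Ident C b"
    and biproduct_fst_inr: "p \<cdot> j = Zero C b a" and biproduct_snd_inl: "q \<cdot> i = Zero C a b"
    and biproduct_sum: "i \<cdot> p \<boxplus> j \<cdot> q = Ident C s"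
  using bp by (auto simp: is_biproduct_def)

lemma biproduct_pair:
  assumes u: "u \<Colon> x \<leadsto> a" and v: "v \<Colon> x \<leadsto> b"
  shows "p \<cdot> (i \<cdot> u \<boxplus> j \<cdot> v) = u" "q \<cdot> (i \<cdot> u \<boxplus> j \<cdot> v) = v"
proof -
  note i = biproduct_inl_arr and j = biproduct_inr_arr and p = biproduct_fst_arr
    and q = biproduct_snd_arr
  have iu: "i \<cdot> u \<Colon> x \<leadsto> s" and jv: "j \<cdot> v \<Colon> x \<leadsto> s" using i u j v by auto
  have "p \<cdot> (i \<cdot> u) = u" using assoc[OF p i u] ident_left[OF u] biproduct_fst_inl by simp
  moreover have "p \<cdot> (j \<cdot> v) = Zero C x a" using comp_eq_zero_comp[OF biproduct_fst_inr p j v] .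
  ultimately show "p \<cdot> (i \<cdot> u \<boxplus> j \<cdot> v) = u" using comp_add_right[OF p iu jv] add_zero_right[OF u]
    by simp
  have "q \<cdot> (j \<cdot> v) = v" using assoc[OF q j v] ident_left[OF v] biproduct_snd_inr by simp
  moreover have "q \<cdot> (i \<cdot> u) = Zero C x b" using comp_eq_zero_comp[OF biproduct_snd_inl q i u] .
  ultimately show "q \<cdot> (i \<cdot> u \<boxplus> j \<cdot> v) = v" using comp_add_right[OF q iu jv] add_zero_left[OF v]
    by simp
qed

lemma biproduct_copair:
  assumes u: "u \<Colon> a \<leadsto> x" and v: "v \<Colon> b \<leadsto> x"
  shows "(u \<cdot> p \<boxplus> v \<cdot> q) \<cdot> i = u" "(u \<cdot> p \<boxplus> v \<cdot> q) \<cdot> j = v"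
proof -
  note i = biproduct_inl_arr and j = biproduct_inr_arr and p = biproduct_fst_arr
    and q = biproduct_snd_arr
  have up: "u \<cdot> p \<Colon> s \<leadsto> x" and vq: "v \<cdot> q \<Colon> s \<leadsto> x" using p u q v by auto
  have "(u \<cdot> p) \<cdot> i = u" using assoc[OF u p i] ident_right[OF u] biproduct_fst_inl by simp
  moreover have "(v \<cdot> q) \<cdot> i = Zero C a x" using comp_comp_eq_zero[OF biproduct_snd_inl v q i] .
  ultimately show "(u \<cdot> p \<boxplus> v \<cdot> q) \<cdot> i = u" using comp_add_left[OF up vq i] add_zero_right[OF u]
    by simp
  have "(v \<cdot> q) \<cdot> j = v" using assoc[OF v q j] ident_right[OF v] biproduct_snd_inr by simp
  moreover have "(u \<cdot> p) \<cdot> j = Zero C b x" using comp_comp_eq_zero[OF biproduct_fst_inr u p j] .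
  ultimately show "(u \<cdot> p \<boxplus> v \<cdot> q) \<cdot> j = v" using comp_add_left[OF up vq j] add_zero_left[OF v]
    by simp
qed

lemma biproduct_jointly_monic:
  assumes w: "w \<Colon> x \<leadsto> s" "w' \<Colon> x \<leadsto> s" and eq: "p \<cdot> w = p \<cdot> w'" "q \<cdot> w = q \<cdot> w'"
  shows "w = w'"
proof -
  note i = biproduct_inl_arr and j = biproduct_inr_arr and p = biproduct_fst_arr
    and q = biproduct_snd_arr
  have split: "z = i \<cdot> (p \<cdot> z) \<boxplus> j \<cdot> (q \<cdot> z)" if z: "z \<Colon> x \<leadsto> s" for z
    using comp_add_left[OF comp_arr[OF i p] comp_arr[OF j q] z] assoc[OF i p z] assoc[OF j q z]
      ident_left[OF z] biproduct_sum by simp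
  show ?thesis using split[OF w(1)] split[OF w(2)] eq by simp
qed

lemma biproduct_jointly_epic:
  assumes w: "w \<Colon> s \<leadsto> x" "w' \<Colon> s \<leadsto> x" and eq: "w \<cdot> i = w' \<cdot> i" "w \<cdot> j = w' \<cdot> j"
  shows "w = w'"
proof -
  note i = biproduct_inl_arr and j = biproduct_inr_arr and p = biproduct_fst_arr
    and q = biproduct_snd_arr
  have split: "z = (z \<cdot> i) \<cdot> p \<boxplus> (z \<cdot> j) \<cdot> q" if z: "z \<Colon> s \<leadsto> x" for z
    using comp_add_right[OF z comp_arr[OF i p] comp_arr[OF j q]] assoc[OF z i p] assoc[OF z j q]
      ident_right[OF z] biproduct_sum by simp
  show ?thesis using split[OF w(1)] split[OF w(2)] eq by simp
qed

end

text \<open>Realized as the kernel of the difference \<open>h\<close> of \<open>c \<cdot> p\<close>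
  and \<open>d \<cdot> q\<close> on the biproduct. The universal property is handed out as two bare
  rules, existence and joint monicity, so that the legs can be swapped when the square is read in
  the other direction.\<close>

lemma pullback:
  assumes c: "c \<Colon> a \<leadsto> e" and d: "d \<Colon> b \<leadsto> e"
  obtains P p q where "p \<Colon> P \<leadsto> a" "q \<Colon> P \<leadsto> b" "c \<cdot> p = d \<cdot> q"
    "\<And>x u v. u \<Colon> x \<leadsto> a \<Longrightarrow> v \<Colon> x \<leadsto> b \<Longrightarrow> c \<cdot> u = d \<cdot> v \<Longrightarrow> \<exists>w. w \<Colon> x \<leadsto> P \<and> p \<cdot> w = u \<and> q \<cdot> w = v"
    "\<And>x w w'. w \<Colon> x \<leadsto> P \<Longrightarrow> w' \<Colon> x \<leadsto> P \<Longrightarrow> p \<cdot> w = p \<cdot> w' \<Longrightarrow> q \<cdot> w = q \<cdot> w' \<Longrightarrow> w = w'"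
proof -
  have Ob: "a \<in> Ob C" "b \<in> Ob C" "e \<in> Ob C" using c d by (auto dest: arr_Ob)
  obtain s i j p q where bp: "is_biproduct C a b s i j p q" using biproducts[OF Ob(1,2)] by blast
  note ar = biproduct_arr[OF bp Ob(1,2)]
  note i = ar(1) and j = ar(2) and p = ar(3) and q = ar(4) and s = arr_Ob(2)[OF ar(1)]
  obtain h where h: "h \<Colon> s \<leadsto> e" "c \<cdot> p = d \<cdot> q \<boxplus> h"
    using add_diff[OF comp_arr[OF c p] comp_arr[OF d q]] .
  obtain P k where k: "is_kernel C P k s h e" using kernels[OF s Ob(3) arr_Hom[OF h(1)]] by blast
  have ka: "k \<Colon> P \<leadsto> s" using k s by (rule kernel_arr)
  have km: "monic C P s k" using kernel_monic[OF k s Ob(3)] .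
  have dist: "c \<cdot> (p \<cdot> z) = d \<cdot> (q \<cdot> z) \<boxplus> h \<cdot> z" if z: "z \<Colon> x \<leadsto> s" for x z
    using assoc[OF c p z] assoc[OF d q z] comp_add_left[OF comp_arr[OF d q] h(1) z] h(2) by simp
  show ?thesis
  proof (rule that[of "p \<cdot> k" P "q \<cdot> k"])
    show "p \<cdot> k \<Colon> P \<leadsto> a" "q \<cdot> k \<Colon> P \<leadsto> b" using p q ka by auto
    show "c \<cdot> (p \<cdot> k) = d \<cdot> (q \<cdot> k)"
      using dist[OF ka] add_zero_right[OF comp_arr[OF d comp_arr[OF q ka]]] kernel_comp[OF k]
        by simp
  next
    fix x u v assume u: "u \<Colon> x \<leadsto> a" and v: "v \<Colon> x \<leadsto> b" and eq: "c \<cdot> u = d \<cdot> v"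
    let ?z = "i \<cdot> u \<boxplus> j \<cdot> v"
    have z: "?z \<Colon> x \<leadsto> s" using i u j v by auto
    note pq = biproduct_pair[OF bp Ob(1,2) u v]
    have "h \<cdot> ?z = Zero C x e"
      using add_eq_self[OF _ comp_arr[OF d v] comp_arr[OF h(1) z]] dist[OF z] pq eq by simp
    then obtain w where w: "w \<Colon> x \<leadsto> P" "k \<cdot> w = ?z" using kernel_lift[OF k z] by metis
    then show "\<exists>w. w \<Colon> x \<leadsto> P \<and> p \<cdot> k \<cdot> w = u \<and> q \<cdot> k \<cdot> w = v"
      using assoc[OF p ka w(1)] assoc[OF q ka w(1)] pq by metis
  next
    fix x w w' assume w: "w \<Colon> x \<leadsto> P" "w' \<Colon> x \<leadsto> P" "p \<cdot> k \<cdot> w = p \<cdot> k \<cdot> w'" "q \<cdot> k \<cdot> w = q \<cdot> k \<cdot> w'"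
    have "k \<cdot> w = k \<cdot> w'"
      using biproduct_jointly_monic[OF bp Ob(1,2) comp_arr[OF ka w(1)] comp_arr[OF ka w(2)]]
        assoc[OF p ka w(1)] assoc[OF q ka w(1)] assoc[OF p ka w(2)] assoc[OF q ka w(2)] w(3,4)
          by simp
    then show "w = w'" using monic_cancel[OF km w(1,2)] by simp
  qed
qed

end

section \<open>Enough projectives and injectives\<close>

text \<open>Turns vanishing of a cohomology group into equality of cocycles and coboundaries: a
  coset of \<open>H\<close> is \<open>H\<close> itself just when its representative lies in
  \<open>H\<close>.\<close>

lemma trivial_Mod_iff:
  assumes "comm_group G" "subgroup H G"
  shows "trivial_group (G Mod H) \<longleftrightarrow> H = carrier G"
proof -
  interpret comm_group G by fact
  have "H \<lhd> G" using assms(2) by (rule subgroup_imp_normal)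
  then have grp: "group (G Mod H)" by (rule normal.factorgroup_is_group)
  have "carrier (G Mod H) = {one (G Mod H)} \<longleftrightarrow> (\<forall>a\<in>carrier G. r_coset G H a = H)"
    using one_closed unfolding FactGroup_def RCOSETS_def by auto
  also have "\<dots> \<longleftrightarrow> H = carrier G"
    using coset_join1[OF _ _ assms(2)] coset_join2[OF _ assms(2)] subgroup.subset[OF assms(2)]
      by blast
  finally show ?thesis using grp by (simp add: trivial_group_def)
qed

context preadditive_category
begin

text \<open>Makes the cocycles a kernel and the coboundaries an image of group homomorphisms, hence
  subgroups.\<close>

lemma precomp_group_hom:
  assumes "d \<Colon> a \<leadsto> b" "x \<in> Ob C"
  shows "group_hom (hom_group C b x) (hom_group C a x) (\<lambda>f. f \<cdot> d)"
proof -
  have Ob: "a \<in> Ob C" "b \<in> Ob C" using assms by (auto dest: arr_Ob)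
  have "(\<lambda>f. f \<cdot> d) \<in> hom (hom_group C b x) (hom_group C a x)"
    using assms Ob comp_in_hom add_comp by (auto simp: hom_def hom_group_def arr_def)
  then show ?thesis
    using hom_group Ob assms by (auto simp: group_hom_def group_hom_axioms_def)
qed

end

locale abelian_category_enough = abelian_category +
  assumes projectives: "enough_projectives C" and injectives: "enough_injectives C"
begin

lemma projective_cover:
  assumes "a \<in> Ob C"
  obtains p e where "projective C p" "epic C p a e" "e \<Colon> p \<leadsto> a"
proof -
  obtain p e where "projective C p" "epic C p a e"
    using assms projectives by (auto simp: enough_projectives_def)
  then show ?thesis using that[of p e] epic_arr[of p a e] assms by (auto simp: projective_def)
qed

lemma injective_hull:
  assumes "a \<in> Ob C"
  obtains j m where "injective C j" "monic C a j m" "m \<Colon> a \<leadsto> j"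
proof -
  obtain j m where "injective C j" "monic C a j m"
    using assms injectives by (auto simp: enough_injectives_def)
  then show ?thesis using that[of j m] monic_arr[of a j m] assms by (auto simp: injective_def)
qed

lemma short_exact_injective:
  assumes "a \<in> Ob C"
  obtains j c m q where "injective C j" "short_exact C a m j q c"
proof -
  obtain j m where j: "injective C j" "monic C a j m" "m \<Colon> a \<leadsto> j" using injective_hull[OF assms] .
  obtain q c where q: "is_cokernel C a m j q c"
    using cokernels[OF arr_Ob[OF j(3)] arr_Hom[OF j(3)]] by blast
  have "is_kernel C a m j q c" using monic_cokernel_kernel[OF j(2) q arr_Ob[OF j(3)]] .
  moreover have "epic C j c q" using cokernel_epic[OF q arr_Ob[OF j(3)]] .
  ultimately have "short_exact C a m j q c"
    using arr_Ob[OF j(3)] q by (auto simp: is_cokernel_def intro: short_exactI)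
  then show ?thesis using that j by blast
qed

text \<open>Maps out of projectives act as generalized elements. Lifting a projective cover of
  \<open>b\<close> already exhibits \<open>f\<close> as the last factor of an epimorphism.\<close>

lemma epic_projI:
  assumes f: "f \<Colon> a \<leadsto> b"
    and lift: "\<And>p h. projective C p \<Longrightarrow> h \<Colon> p \<leadsto> b \<Longrightarrow> \<exists>k. k \<Colon> p \<leadsto> a \<and> f \<cdot> k = h"
  shows "epic C a b f"
proof -
  obtain p e where p: "projective C p" "epic C p b e" "e \<Colon> p \<leadsto> b"
    using projective_cover[OF arr_Ob(2)[OF f]] .
  obtain k where k: "k \<Colon> p \<leadsto> a" "f \<cdot> k = e" using lift[OF p(1,3)] by blast
  then show ?thesis using epic_left_factor[OF _ f k(1)] p(2) by simp
qed

text \<open>An arbitrary test map \<open>g\<close> becomes a generalized element after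
  precomposition with a projective cover of its source, and the cover can be cancelled
  again.\<close>

lemma monic_projI:
  assumes f: "f \<Colon> a \<leadsto> b"
    and inj: "\<And>p h. projective C p \<Longrightarrow> h \<Colon> p \<leadsto> a \<Longrightarrow> f \<cdot> h = Zero C p b \<Longrightarrow> h = Zero C p a"
  shows "monic C a b f"
proof (rule monicI[OF f])
  fix x g assume g: "g \<Colon> x \<leadsto> a" "f \<cdot> g = Zero C x b"
  obtain p e where p: "projective C p" "epic C p x e" "e \<Colon> p \<leadsto> x"
    using projective_cover[OF arr_Ob(1)[OF g(1)]] .
  have "g \<cdot> e = Zero C p a"
    using inj[OF p(1) comp_arr[OF g(1) p(3)] comp_eq_zero_comp[OF g(2) f g(1) p(3)]] .
  then show "g = Zero C x a" using epic_zero[OF p(2) g(1) arr_Ob(1)[OF p(3)]] by simp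
qed

text \<open>Monicity of \<open>\<mu>\<close> is checked on generalized elements: an element of
  \<open>q\<close> lifts to \<open>b\<close>, and if \<open>\<mu>\<close> kills it, the lift lies in
  the common kernel of \<open>g\<close> and \<open>p\<close>.\<close>

lemma exact_at_cokernel_factor:
  assumes ex: "exact_at C a f b g c" and Ob: "a \<in> Ob C" "b \<in> Ob C" "c \<in> Ob C"
  obtains p q \<mu> where "is_cokernel C a f b p q" "monic C q c \<mu>" "\<mu> \<cdot> p = g"
proof -
  have g: "g \<Colon> b \<leadsto> c" using ex Ob by (auto simp: exact_at_def arr_def)
  obtain k i p q where k: "is_cokernel C a f b p q" "is_kernel C k i b p q" "is_kernel C k i b g c"
    using ex by (auto simp: exact_at_def is_image_def)
  have i: "i \<Colon> k \<leadsto> b" and p: "p \<Colon> b \<leadsto> q" using k Ob by (auto intro: kernel_arr cokernel_arr)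
  have pe: "epic C b q p" using cokernel_epic[OF k(1) Ob(1,2)] .
  obtain \<mu> where m: "\<mu> \<Colon> q \<leadsto> c" "\<mu> \<cdot> p = g"
    using cokernel_factor[OF k(1) g exact_at_comp_zero[OF ex Ob]] .
  have "monic C q c \<mu>"
  proof (rule monic_projI[OF m(1)])
    fix r z assume r: "projective C r" "z \<Colon> r \<leadsto> q" "\<mu> \<cdot> z = Zero C r c"
    obtain w where w: "w \<Colon> r \<leadsto> b" "p \<cdot> w = z" using projective_lift[OF r(1) pe Ob(2) r(2)] .
    have "g \<cdot> w = Zero C r c" using assoc[OF m(1) p w(1)] m(2) w(2) r(3) by simp
    then obtain v where v: "v \<Colon> r \<leadsto> k" "i \<cdot> v = w" using kernel_lift[OF k(3) w(1)] by metis
    show "z = Zero C r q" using comp_eq_zero_comp[OF kernel_comp[OF k(2)] p i v(1)] v w by simp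
  qed
  then show ?thesis using that k(1) m(2) by blast
qed

text \<open>Exactness of \<open>Hom(-, j)\<close> at the middle term: descend to the cokernel of
  \<open>f\<close>, then extend along its embedding into \<open>c\<close>. It makes the higher Ext
  groups into injectives vanish.\<close>

lemma exact_at_injective_extend:
  assumes ex: "exact_at C a f b g c" and Ob: "a \<in> Ob C" "b \<in> Ob C" "c \<in> Ob C"
    and j: "injective C j" and h: "h \<Colon> b \<leadsto> j" "h \<cdot> f = Zero C a j"
  obtains h' where "h' \<Colon> c \<leadsto> j" "h' \<cdot> g = h"
proof -
  obtain p q \<mu> where pq: "is_cokernel C a f b p q" "monic C q c \<mu>" "\<mu> \<cdot> p = g"
    using exact_at_cokernel_factor[OF ex Ob] .
  have p: "p \<Colon> b \<leadsto> q" using pq(1) Ob(2) by (rule cokernel_arr)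
  obtain h1 where h1: "h1 \<Colon> q \<leadsto> j" "h1 \<cdot> p = h" using cokernel_factor[OF pq(1) h] .
  obtain h' where h': "h' \<Colon> c \<leadsto> j" "h' \<cdot> \<mu> = h1" using injective_extend[OF j pq(2) Ob(3) h1(1)] .
  have "h' \<cdot> g = h"
    using assoc[OF h'(1) monic_arr[OF pq(2) arr_Ob(2)[OF p] Ob(3)] p] pq(3) h'(2) h1(2) by simp
  then show ?thesis using that h' by blast
qed

text \<open>A map killing \<open>f\<close> factors through the cokernel \<open>p\<close> of
  \<open>f\<close>, so it kills the common kernel \<open>i\<close> of \<open>p\<close> and
  \<open>g\<close>, and \<open>g\<close> is the cokernel of \<open>i\<close>.\<close>

lemma exact_at_epic_cokernel:
  assumes ex: "exact_at C a f b g c" and g: "epic C b c g" and Ob: "a \<in> Ob C" "b \<in> Ob C" "c \<in> Ob C"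
  shows "is_cokernel C a f b g c"
proof -
  have f: "f \<Colon> a \<leadsto> b" using ex Ob by (auto simp: exact_at_def arr_def)
  obtain k i p q where k: "is_cokernel C a f b p q" "is_kernel C k i b p q" "is_kernel C k i b g c"
    using ex by (auto simp: exact_at_def is_image_def)
  have i: "i \<Colon> k \<leadsto> b" and p: "p \<Colon> b \<leadsto> q" using k Ob by (auto intro: kernel_arr cokernel_arr)
  note gk = epic_kernel_cokernel[OF g k(3) Ob(2,3)]
  show ?thesis
  proof (rule is_cokernelI[OF g Ob(3) f exact_at_comp_zero[OF ex Ob]])
    fix x h assume h: "h \<Colon> b \<leadsto> x" "h \<cdot> f = Zero C a x"
    obtain h1 where h1: "h1 \<Colon> q \<leadsto> x" "h1 \<cdot> p = h" using cokernel_factor[OF k(1) h] .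
    have "h \<cdot> i = Zero C k x" using comp_comp_eq_zero[OF kernel_comp[OF k(2)] h1(1) p i] h1 by simp
    then show "\<exists>u. u \<Colon> c \<leadsto> x \<and> u \<cdot> g = h" using cokernel_factor[OF gk h(1)] by metis
  qed
qed

text \<open>Ensures that the \<open>SOME\<close> in \<open>proj_res\<close> picks an actual
  resolution. Projective covers of successive kernels are spliced together.\<close>

lemma projective_resolution_exists:
  assumes m: "m \<in> Ob C"
  shows "\<exists>R. is_projective_resolution C m R"
proof -
  have "\<forall>a\<in>Ob C. \<exists>pe. projective C (fst pe) \<and> epic C (fst pe) a (snd pe)"
    using projectives by (auto simp: enough_projectives_def)
  then obtain ce where ce: "\<forall>a\<in>Ob C. projective C (fst (ce a)) \<and> epic C (fst (ce a)) a (snd (ce a))"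
    by metis
  define cov where "cov a = fst (ce a)" for a
  define eps where "eps a = snd (ce a)" for a
  have proj: "projective C (cov a)" and epi: "epic C (cov a) a (eps a)" if "a \<in> Ob C" for a
    using ce that by (auto simp: cov_def eps_def)
  have covOb: "cov a \<in> Ob C" if "a \<in> Ob C" for a using proj[OF that] by (simp add: projective_def)
  have eps: "eps a \<Colon> cov a \<leadsto> a" if "a \<in> Ob C" for a using epic_arr[OF epi covOb] that by auto
  have "\<forall>a\<in>Ob C. \<exists>ki. is_kernel C (fst ki) (snd ki) (cov a) (eps a) a"
    using kernels[OF covOb _ arr_Hom[OF eps]] by auto
  then obtain ki where ki: "\<forall>a\<in>Ob C. is_kernel C (fst (ki a)) (snd (ki a)) (cov a) (eps a) a"
    by metis
  define ker where "ker a = fst (ki a)" for a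
  define inc where "inc a = snd (ki a)" for a
  have ker: "is_kernel C (ker a) (inc a) (cov a) (eps a) a" if "a \<in> Ob C" for a
    using ki that by (auto simp: ker_def inc_def)
  have kerOb: "ker a \<in> Ob C" if "a \<in> Ob C" for a using ker[OF that] by (simp add: is_kernel_def)
  have inc: "inc a \<Colon> ker a \<leadsto> cov a" if "a \<in> Ob C" for a using kernel_arr[OF ker covOb] that by blast
  have incm: "monic C (ker a) (cov a) (inc a)" if "a \<in> Ob C" for a
    using kernel_monic[OF ker covOb] that by blast
  \<comment> \<open>\<open>K n\<close> is the \<open>n\<close>-th syzygy of \<open>m\<close> for the
    chosen covers. Since \<open>K 0\<close> is \<open>m\<close> itself, \<open>d n\<close> passes
    through \<open>K (Suc n)\<close>.\<close>
  define K where "K n = (ker ^^ n) m" for n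
  have KS: "K (Suc n) = ker (K n)" and K0: "K 0 = m" for n by (simp_all add: K_def)
  have K: "K n \<in> Ob C" for n by (induction n) (auto simp: K0 KS m kerOb)
  define d where "d n = inc (K n) \<cdot> eps (K (Suc n))" for n
  \<comment> \<open>\<open>inc (K n)\<close> is monic, so \<open>d n\<close> has the same kernel as
    the cover \<open>eps (K (Suc n))\<close>.\<close>
  have kd: "is_kernel C (ker (K (Suc n))) (inc (K (Suc n))) (cov (K (Suc n))) (d n) (cov (K n))"
    for n
  proof -
    have e: "eps (K (Suc n)) \<Colon> cov (K (Suc n)) \<leadsto> ker (K n)" using eps[OF K[of "Suc n"]]
      by (simp add: KS)
    note i = inc[OF K[of n]] and i' = inc[OF K[of "Suc n"]]
    have d: "d n \<Colon> cov (K (Suc n)) \<leadsto> cov (K n)" using comp_arr[OF i e] by (simp add: d_def)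
    note k = ker[OF K[of "Suc n"], unfolded KS[of n], folded KS[of "n"]]
    have z: "d n \<cdot> inc (K (Suc n)) = Zero C (ker (K (Suc n))) (cov (K n))"
      using comp_comp_eq_zero[OF _ i e i'] kernel_comp[OF ker[OF K[of "Suc n"]]]
        by (simp add: d_def KS)
    show ?thesis
    proof (rule is_kernelI[OF incm[OF K] kerOb[OF K] d z])
      fix x g assume g: "g \<Colon> x \<leadsto> cov (K (Suc n))" "d n \<cdot> g = Zero C x (cov (K n))"
      have "eps (K (Suc n)) \<cdot> g = Zero C x (ker (K n))"
        using monic_zero[OF incm[OF K] comp_arr[OF e g(1)] arr_Ob(2)[OF i]] assoc[OF i e g(1)] g(2)
        by (simp add: d_def)
      then show "\<exists>u. u \<Colon> x \<leadsto> ker (K (Suc n)) \<and> inc (K (Suc n)) \<cdot> u = g"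
        using kernel_lift[OF ker[OF K] g(1)] by (metis KS)
    qed
  qed
  have "exact_at C (cov (K (Suc (Suc n)))) (d (Suc n)) (cov (K (Suc n))) (d n) (cov (K n))" for n
    using exact_atI[OF kd[of n], of "cov (K (Suc (Suc n)))" "eps (K (Suc (Suc n)))"]
      epi[OF K[of "Suc (Suc n)"]]
      covOb[OF K[of "Suc (Suc n)"]] covOb[OF K[of "Suc n"]] covOb[OF K[of n]]
    by (simp add: d_def KS[of "Suc n"])
  moreover have "exact_at C (cov (K (Suc 0))) (d 0) (cov (K 0)) (eps m) m"
    using exact_atI[OF ker[OF m], of "cov (K (Suc 0))" "eps (K (Suc 0))"] epi[OF K[of "Suc 0"]]
      covOb[OF K[of "Suc 0"]] covOb[OF m] m
    by (simp add: d_def KS K0)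
  moreover have "epic C (cov (K 0)) m (eps m)" using epi[OF m] by (simp add: K0)
  ultimately have "is_projective_resolution C m (\<lambda>n. cov (K n), d, eps m)"
    using proj[OF K] by (simp add: is_projective_resolution_def)
  then show ?thesis by blast
qed

text \<open>Ext and the derived functors read only the objects and differentials of the resolution;
  the augmentation ties these back to \<open>m\<close>.\<close>

definition res_aug :: "'a \<Rightarrow> 'b" where
  "res_aug m = snd (snd (proj_res C m))"

section \<open>Ext groups of a fixed object\<close>

context
  fixes m assumes m: "m \<in> Ob C"
begin

lemma proj_res: "is_projective_resolution C m (res_ob C m, res_diff C m, res_aug m)"
  using someI_ex[OF projective_resolution_exists[OF m]]
  by (simp add: proj_res_def res_ob_def res_diff_def res_aug_def)

lemma res_projective: "projective C (res_ob C m n)"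
  and res_exact: "exact_at C (res_ob C m (Suc (Suc n))) (res_diff C m (Suc n)) (res_ob C m (Suc n))
    (res_diff C m n) (res_ob C m n)"
  and res_exact_aug: "exact_at C (res_ob C m (Suc 0)) (res_diff C m 0) (res_ob C m 0) (res_aug m) m"
  and res_aug_epic: "epic C (res_ob C m 0) m (res_aug m)"
  using proj_res by (simp_all add: is_projective_resolution_def)

lemma res_ob_Ob: "res_ob C m n \<in> Ob C"
  using res_projective by (simp add: projective_def)

lemma res_diff_arr: "res_diff C m n \<Colon> res_ob C m (Suc n) \<leadsto> res_ob C m n"
  using res_exact[of n] res_ob_Ob by (simp add: arr_def exact_at_def)

lemma res_aug_arr: "res_aug m \<Colon> res_ob C m 0 \<leadsto> m"
  using res_exact_aug res_ob_Ob m by (simp add: arr_def exact_at_def)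

lemma res_aug_cokernel:
  "is_cokernel C (res_ob C m (Suc 0)) (res_diff C m 0) (res_ob C m 0) (res_aug m) m"
  using exact_at_epic_cokernel[OF res_exact_aug res_aug_epic res_ob_Ob res_ob_Ob m] .

lemma res_diff_comp:
  "res_diff C m n \<cdot> res_diff C m (Suc n) = Zero C (res_ob C m (Suc (Suc n))) (res_ob C m n)"
  using exact_at_comp_zero[OF res_exact res_ob_Ob res_ob_Ob res_ob_Ob] .

text \<open>From here on Ext is handled through cocycles and coboundaries, without opening the
  quotient group. Degree zero is separate because its coboundaries consist of the zero map alone
  rather than the image of a differential.\<close>

lemma trivial_Ext_iff:
  assumes x: "x \<in> Ob C"
  shows "trivial_group (Ext C (Suc n) m x) \<longleftrightarrow>
    (\<forall>f. f \<Colon> res_ob C m (Suc n) \<leadsto> x \<longrightarrow> f \<cdot> res_diff C m (Suc n) = Zero C (res_ob C m (Suc (Suc n))) x \<longrightarrow>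
      (\<exists>g. g \<Colon> res_ob C m n \<leadsto> x \<and> g \<cdot> res_diff C m n = f))"
proof -
  let ?G = "hom_group C (res_ob C m (Suc n)) x"
  let ?Z = "ext_cocycles C (Suc n) m x" and ?B = "ext_coboundaries C (Suc n) m x"
  have comm: "comm_group ?G" using hom_comm_group res_ob_Ob x by blast
  interpret G: comm_group ?G by fact
  interpret h1: group_hom ?G "hom_group C (res_ob C m (Suc (Suc n))) x"
    "\<lambda>f. f \<cdot> res_diff C m (Suc n)"
    using precomp_group_hom[OF res_diff_arr x] .
  interpret h0: group_hom "hom_group C (res_ob C m n) x" ?G "\<lambda>f. f \<cdot> res_diff C m n"
    using precomp_group_hom[OF res_diff_arr x] .
  have "?Z = kernel ?G (hom_group C (res_ob C m (Suc (Suc n))) x) (\<lambda>f. f \<cdot> res_diff C m (Suc n))"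
    by (auto simp: ext_cocycles_def kernel_def hom_group_def)
  then have Z: "subgroup ?Z ?G" using h1.subgroup_kernel by simp
  have "?B = (\<lambda>f. f \<cdot> res_diff C m n) ` carrier (hom_group C (res_ob C m n) x)"
    by (simp add: hom_group_def)
  then have B: "subgroup ?B ?G" using h0.img_is_subgroup by simp
  have BZ: "?B \<subseteq> ?Z"
  proof
    fix f assume "f \<in> ?B"
    then obtain g where g: "g \<Colon> res_ob C m n \<leadsto> x" "f = g \<cdot> res_diff C m n"
      using res_ob_Ob x by (auto simp: arr_def)
    show "f \<in> ?Z"
      using comp_comp_eq_zero[OF res_diff_comp g(1) res_diff_arr res_diff_arr]
        comp_arr[OF g(1) res_diff_arr] g(2)
      by (auto simp: ext_cocycles_def arr_def)
  qed
  have "comm_group (?G\<lparr>carrier := ?Z\<rparr>)"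
    using group.group_comm_groupI[OF G.subgroup_imp_group[OF Z]] G.m_comm subgroup.subset[OF Z]
      by auto
  then have "trivial_group (Ext C (Suc n) m x) \<longleftrightarrow> ?B = ?Z"
    using trivial_Mod_iff[OF _ G.subgroup_incl[OF B Z BZ]]
    by (simp add: Ext_def)
  also have "\<dots> \<longleftrightarrow> ?Z \<subseteq> ?B" using BZ by auto
  also
    have "\<dots> \<longleftrightarrow> (\<forall>f. f \<Colon> res_ob C m (Suc n) \<leadsto> x \<longrightarrow>
    f \<cdot> res_diff C m (Suc n) = Zero C (res_ob C m (Suc (Suc n))) x \<longrightarrow>
      (\<exists>g. g \<Colon> res_ob C m n \<leadsto> x \<and> g \<cdot> res_diff C m n = f))"
    using res_ob_Ob x by (fastforce simp: ext_cocycles_def arr_def image_iff)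
  finally show ?thesis .
qed

lemma Ext_cocycle_lift:
  assumes "trivial_group (Ext C (Suc n) m x)" "f \<Colon> res_ob C m (Suc n) \<leadsto> x"
    "f \<cdot> res_diff C m (Suc n) = Zero C (res_ob C m (Suc (Suc n))) x"
  obtains g where "g \<Colon> res_ob C m n \<leadsto> x" "g \<cdot> res_diff C m n = f"
  using assms trivial_Ext_iff[OF arr_Ob(2)[OF assms(2)]] by blast

lemma trivial_Ext_injective:
  assumes "injective C j"
  shows "trivial_group (Ext C (Suc n) m j)"
proof -
  have "j \<in> Ob C" using assms by (simp add: injective_def)
  then show ?thesis
    unfolding trivial_Ext_iff[OF \<open>j \<in> Ob C\<close>]
    using exact_at_injective_extend[OF res_exact res_ob_Ob res_ob_Ob res_ob_Ob assms] by metis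
qed

text \<open>Presenting the syzygy \<open>k\<close> as the cokernel of the second differential makes
  maps out of \<open>k\<close> the same as degree-one cocycles, while \<open>\<iota>\<close> embeds
  \<open>k\<close> as the kernel of the augmentation.\<close>

lemma syzygy:
  obtains k \<iota> \<pi> where "short_exact C k \<iota> (res_ob C m 0) (res_aug m) m"
    "is_cokernel C (res_ob C m (Suc (Suc 0))) (res_diff C m (Suc 0)) (res_ob C m (Suc 0)) \<pi> k"
    "\<iota> \<cdot> \<pi> = res_diff C m 0"
proof -
  let ?P = "res_ob C m" and ?d = "res_diff C m" and ?e = "res_aug m"
  note Ob = res_ob_Ob and e = res_aug_arr
  obtain \<pi> k \<iota> where *: "is_cokernel C (?P (Suc (Suc 0))) (?d (Suc 0)) (?P (Suc 0)) \<pi> k"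
      "monic C k (?P 0) \<iota>" "\<iota> \<cdot> \<pi> = ?d 0"
    using exact_at_cokernel_factor[OF res_exact Ob Ob Ob] .
  have p: "\<pi> \<Colon> ?P (Suc 0) \<leadsto> k" using *(1) Ob by (rule cokernel_arr)
  have pe: "epic C (?P (Suc 0)) k \<pi>" using cokernel_epic[OF *(1) Ob Ob] .
  have i: "\<iota> \<Colon> k \<leadsto> ?P 0" using monic_arr[OF *(2) arr_Ob(2)[OF p] Ob] .
  have "is_cokernel C k \<iota> (?P 0) ?e m"
  proof (rule is_cokernelI[OF res_aug_epic m i])
    have "(?e \<cdot> \<iota>) \<cdot> \<pi> = Zero C (?P (Suc 0)) m"
      using assoc[OF e i p] *(3) cokernel_comp[OF res_aug_cokernel] by simp
    then show "?e \<cdot> \<iota> = Zero C k m" using epic_zero[OF pe comp_arr[OF e i] Ob] by simp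
  next
    fix x u assume u: "u \<Colon> ?P 0 \<leadsto> x" "u \<cdot> \<iota> = Zero C k x"
    have "u \<cdot> ?d 0 = Zero C (?P (Suc 0)) x"
      using assoc[OF u(1) i p] *(3) u(2) zero_comp[OF p arr_Ob(2)[OF u(1)]] by simp
    then show "\<exists>v. v \<Colon> m \<leadsto> x \<and> v \<cdot> ?e = u" using cokernel_factor[OF res_aug_cokernel u(1)] by metis
  qed
  then have "is_kernel C k \<iota> (?P 0) ?e m"
    using monic_cokernel_kernel[OF *(2) _ arr_Ob[OF i]] by blast
  then have "short_exact C k \<iota> (?P 0) ?e m" using res_aug_epic Ob m by (rule short_exactI)
  then show ?thesis using that * by blast
qed

text \<open>When degree-one cocycles are read as maps out of the syzygy, the coboundaries are the
  maps that extend along \<open>\<iota>\<close>.\<close>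

lemma trivial_Ext_of_syzygy_extend:
  assumes se: "short_exact C k \<iota> (res_ob C m 0) (res_aug m) m"
    and pi:
      "is_cokernel C (res_ob C m (Suc (Suc 0))) (res_diff C m (Suc 0)) (res_ob C m (Suc 0)) \<pi> k"
      "\<iota> \<cdot> \<pi> = res_diff C m 0"
    and x: "x \<in> Ob C" and ext: "\<And>f. f \<Colon> k \<leadsto> x \<Longrightarrow> \<exists>g. g \<Colon> res_ob C m 0 \<leadsto> x \<and> g \<cdot> \<iota> = f"
  shows "trivial_group (Ext C 1 m x)"
  unfolding One_nat_def trivial_Ext_iff[OF x]
proof (intro allI impI)
  fix f assume f: "f \<Colon> res_ob C m (Suc 0) \<leadsto> x"
    "f \<cdot> res_diff C m (Suc 0) = Zero C (res_ob C m (Suc (Suc 0))) x"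
  obtain h where h: "h \<Colon> k \<leadsto> x" "h \<cdot> \<pi> = f" using cokernel_factor[OF pi(1) f] .
  obtain g where g: "g \<Colon> res_ob C m 0 \<leadsto> x" "g \<cdot> \<iota> = h" using ext[OF h(1)] by blast
  have "g \<cdot> res_diff C m 0 = f"
    using assoc[OF g(1) short_exactD(4)[OF se] cokernel_arr[OF pi(1) res_ob_Ob]] g(2) h(2) pi(2)
      by simp
  then show "\<exists>g. g \<Colon> res_ob C m 0 \<leadsto> x \<and> g \<cdot> res_diff C m 0 = f" using g(1) by blast
qed

end

end

section \<open>Vanishing of Ext groups\<close>

context abelian_category_enough
begin

text \<open>A form of \<open>Ext\<^sup>1(m, x) = 0\<close> that does not mention resolutions; it transfers along the adjunction
  below, which need not preserve resolutions.\<close>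

definition lifts_modulo :: "'a \<Rightarrow> 'a \<Rightarrow> bool" where
  "lifts_modulo m x \<longleftrightarrow> (\<forall>i b g c \<phi>. short_exact C x i b g c \<longrightarrow> \<phi> \<Colon> m \<leadsto> c \<longrightarrow>
     (\<exists>l. l \<Colon> m \<leadsto> b \<and> g \<cdot> l = \<phi>))"

lemma lifts_moduloD:
  assumes "lifts_modulo m x" "short_exact C x i b g c" "\<phi> \<Colon> m \<leadsto> c"
  obtains l where "l \<Colon> m \<leadsto> b" "g \<cdot> l = \<phi>"
  using assms unfolding lifts_modulo_def by blast

text \<open>Lift \<open>\<phi> \<cdot> res_aug m\<close> over the projective
  \<open>res_ob C m 0\<close>. The obstruction to descending the lift to \<open>m\<close> is a
  degree-one cocycle \<open>s\<close> with values in \<open>x\<close>; it is a coboundary, and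
  subtracting the cochain \<open>t\<close> that bounds it removes the obstruction.\<close>

lemma lifts_modulo_of_trivial_Ext:
  assumes m: "m \<in> Ob C" and tr: "trivial_group (Ext C 1 m x)"
  shows "lifts_modulo m x"
  unfolding lifts_modulo_def
proof (intro allI impI)
  fix i b g c \<phi> assume se: "short_exact C x i b g c" and \<phi>: "\<phi> \<Colon> m \<leadsto> c"
  let ?P = "res_ob C m" and ?d = "res_diff C m" and ?e = "res_aug m"
  note se = short_exactD[OF se] and d = res_diff_arr[OF m] and e = res_aug_arr[OF m]
  obtain l where l: "l \<Colon> ?P 0 \<leadsto> b" "g \<cdot> l = \<phi> \<cdot> ?e"
    using projective_lift[OF res_projective[OF m] se(7,2) comp_arr[OF \<phi> e]] .
  have "g \<cdot> (l \<cdot> ?d 0) = Zero C (?P (Suc 0)) c"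
    using assoc[OF se(5) l(1) d[of 0]] l(2)
      comp_comp_eq_zero[OF cokernel_comp[OF res_aug_cokernel[OF m]] \<phi> e d[of 0]] by simp
  then obtain s where s: "s \<Colon> ?P (Suc 0) \<leadsto> x" "i \<cdot> s = l \<cdot> ?d 0"
    using kernel_lift[OF se(8) comp_arr[OF l(1) d[of 0]]] by metis
  have "i \<cdot> (s \<cdot> ?d 1) = l \<cdot> (?d 0 \<cdot> ?d 1)"
    using assoc[OF se(4) s(1) d[of 1, simplified]] assoc[OF l(1) d[of 0] d[of 1, simplified]] s(2)
      by simp
  also have "\<dots> = Zero C (?P (Suc (Suc 0))) b"
    using res_diff_comp[OF m, of 0] comp_zero[OF l(1)] res_ob_Ob[OF m] by simp
  finally have "s \<cdot> ?d 1 = Zero C (?P (Suc (Suc 0))) x"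
    using monic_zero[OF se(6) comp_arr[OF s(1) d[of 1, simplified]] se(2)] by simp
  then obtain t where t: "t \<Colon> ?P 0 \<leadsto> x" "t \<cdot> ?d 0 = s"
    using Ext_cocycle_lift[OF m tr[unfolded One_nat_def] s(1)] by auto
  have "l \<cdot> ?d 0 = (i \<cdot> t) \<cdot> ?d 0"
    using assoc[OF se(4) t(1) d[of 0]] s(2) t(2) by simp
  \<comment> \<open>\<open>u\<close> is induced by the difference of \<open>l\<close> and
    \<open>i \<cdot> t\<close>. As \<open>g \<cdot> i\<close> is zero, the change does not affect
    the composite with \<open>g\<close>.\<close>
  then obtain u where u: "u \<Colon> m \<leadsto> b" "l = i \<cdot> t \<boxplus> u \<cdot> ?e"
    using cokernel_diff[OF res_aug_cokernel[OF m] res_ob_Ob[OF m] l(1) comp_arr[OF se(4) t(1)]]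
      by metis
  have "\<phi> \<cdot> ?e = g \<cdot> (i \<cdot> t) \<boxplus> g \<cdot> (u \<cdot> ?e)"
    using comp_add_right[OF se(5) comp_arr[OF se(4) t(1)] comp_arr[OF u(1) e]] u(2) l(2) by simp
  also have "\<dots> = (g \<cdot> u) \<cdot> ?e"
    using comp_eq_zero_comp[OF se(10,5,4) t(1)] assoc[OF se(5) u(1) e]
      add_zero_left[OF comp_arr[OF comp_arr[OF se(5) u(1)] e]] by simp
  finally have "g \<cdot> u = \<phi>"
    using epic_cancel[OF res_aug_epic[OF m] comp_arr[OF se(5) u(1)] \<phi>] by simp
  then show "\<exists>l. l \<Colon> m \<leadsto> b \<and> g \<cdot> l = \<phi>" using u(1) by blast
qed

text \<open>Test the lifting property on an embedding of \<open>x\<close> into an injective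
  \<open>j\<close>. There the cocycle \<open>f\<close> becomes a coboundary of some
  \<open>g\<close>, whose image in the cokernel \<open>c\<close> descends to a map out of
  \<open>m\<close>. Subtracting a lift of that map from \<open>g\<close> brings the cochain back
  into \<open>x\<close>.\<close>

lemma trivial_Ext_of_lifts_modulo:
  assumes m: "m \<in> Ob C" and x: "x \<in> Ob C" and lift: "lifts_modulo m x"
  shows "trivial_group (Ext C 1 m x)"
  unfolding One_nat_def trivial_Ext_iff[OF m x]
proof (intro allI impI)
  let ?P = "res_ob C m" and ?d = "res_diff C m" and ?e = "res_aug m"
  note d = res_diff_arr[OF m, of 0] and e = res_aug_arr[OF m]
  note d1 = res_diff_arr[OF m, of "Suc 0"]
  fix f assume f: "f \<Colon> ?P (Suc 0) \<leadsto> x" "f \<cdot> ?d (Suc 0) = Zero C (?P (Suc (Suc 0))) x"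
  obtain j c \<iota> q where j: "injective C j" "short_exact C x \<iota> j q c"
    using short_exact_injective[OF x] .
  note se = short_exactD[OF j(2)]
  have "(\<iota> \<cdot> f) \<cdot> ?d (Suc 0) = Zero C (?P (Suc (Suc 0))) j"
    using comp_comp_eq_zero[OF f(2) se(4) f(1) d1] .
  then obtain g where g: "g \<Colon> ?P 0 \<leadsto> j" "g \<cdot> ?d 0 = \<iota> \<cdot> f"
    using Ext_cocycle_lift[OF m trivial_Ext_injective[OF m j(1)] comp_arr[OF se(4) f(1)]] by metis
  have "(q \<cdot> g) \<cdot> ?d 0 = Zero C (?P (Suc 0)) c"
    using assoc[OF se(5) g(1) d] g(2) comp_eq_zero_comp[OF se(10,5,4) f(1)] by simp
  then obtain \<phi> where \<phi>: "\<phi> \<Colon> m \<leadsto> c" "\<phi> \<cdot> ?e = q \<cdot> g"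
    using cokernel_factor[OF res_aug_cokernel[OF m] comp_arr[OF se(5) g(1)]] by metis
  obtain l where l: "l \<Colon> m \<leadsto> j" "q \<cdot> l = \<phi>" using lifts_moduloD[OF lift j(2) \<phi>(1)] .
  have "q \<cdot> g = q \<cdot> (l \<cdot> ?e)" using assoc[OF se(5) l(1) e] l(2) \<phi>(2) by simp
  then obtain u where u: "u \<Colon> ?P 0 \<leadsto> x" "g = l \<cdot> ?e \<boxplus> \<iota> \<cdot> u"
    using kernel_diff[OF se(8,3) g(1) comp_arr[OF l(1) e]] by metis
  have "\<iota> \<cdot> f = (l \<cdot> ?e) \<cdot> ?d 0 \<boxplus> (\<iota> \<cdot> u) \<cdot> ?d 0"
    using comp_add_left[OF comp_arr[OF l(1) e] comp_arr[OF se(4) u(1)] d] g(2) u(2) by simp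
  also have "\<dots> = \<iota> \<cdot> (u \<cdot> ?d 0)"
    using comp_comp_eq_zero[OF cokernel_comp[OF res_aug_cokernel[OF m]] l(1) e d]
      assoc[OF se(4) u(1) d]
      add_zero_left[OF comp_arr[OF se(4) comp_arr[OF u(1) d]]] by simp
  finally have "u \<cdot> ?d 0 = f" using monic_cancel[OF se(6) f(1) comp_arr[OF u(1) d]] by simp
  then show "\<exists>g. g \<Colon> ?P 0 \<leadsto> x \<and> g \<cdot> ?d 0 = f" using u(1) by blast
qed

section \<open>Pieces of the long exact sequence of Ext in the second variable\<close>

lemma trivial_Ext_extension:
  assumes m: "m \<in> Ob C" and se: "short_exact C x i y p z"
    and tx: "trivial_group (Ext C (Suc n) m x)" and tz: "trivial_group (Ext C (Suc n) m z)"
  shows "trivial_group (Ext C (Suc n) m y)"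
proof -
  let ?P = "res_ob C m" and ?d = "res_diff C m"
  note se = short_exactD[OF se] and d = res_diff_arr[OF m]
  note dd = res_diff_comp[OF m]
  show ?thesis
    unfolding trivial_Ext_iff[OF m se(2)]
  proof (intro allI impI)
    fix f assume f: "f \<Colon> ?P (Suc n) \<leadsto> y" "f \<cdot> ?d (Suc n) = Zero C (?P (Suc (Suc n))) y"
    obtain t where t: "t \<Colon> ?P n \<leadsto> z" "t \<cdot> ?d n = p \<cdot> f"
      using Ext_cocycle_lift[OF m tz comp_arr[OF se(5) f(1)] comp_comp_eq_zero[OF f(2) se(5) f(1) d]] .
    obtain t' where t': "t' \<Colon> ?P n \<leadsto> y" "p \<cdot> t' = t"
      using projective_lift[OF res_projective[OF m] se(7,2) t(1)] .
    have "p \<cdot> f = p \<cdot> (t' \<cdot> ?d n)" using assoc[OF se(5) t'(1) d] t t' by simp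
    then obtain u where u: "u \<Colon> ?P (Suc n) \<leadsto> x" "f = t' \<cdot> ?d n \<boxplus> i \<cdot> u"
      using kernel_diff[OF se(8,3) f(1) comp_arr[OF t'(1) d]] by metis
    have z: "(t' \<cdot> ?d n) \<cdot> ?d (Suc n) = Zero C (?P (Suc (Suc n))) y"
      using comp_comp_eq_zero[OF dd t'(1) d d] .
    have "i \<cdot> (u \<cdot> ?d (Suc n)) = Zero C (?P (Suc (Suc n))) y"
      using comp_add_left[OF comp_arr[OF t'(1) d] comp_arr[OF se(4) u(1)] d] z
        assoc[OF se(4) u(1) d]
        add_zero_left[OF comp_arr[OF se(4) comp_arr[OF u(1) d]]] f(2) u(2) by simp
    then obtain v where v: "v \<Colon> ?P n \<leadsto> x" "v \<cdot> ?d n = u"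
      using Ext_cocycle_lift[OF m tx u(1)] monic_zero[OF se(6) comp_arr[OF u(1) d] se(2)] by metis
    have "(t' \<boxplus> i \<cdot> v) \<cdot> ?d n = f"
      using comp_add_left[OF t'(1) comp_arr[OF se(4) v(1)] d] assoc[OF se(4) v(1) d] v(2) u(2)
        by simp
    then show "\<exists>g. g \<Colon> ?P n \<leadsto> y \<and> g \<cdot> ?d n = f" using t'(1) v(1) se(4) by blast
  qed
qed

text \<open>The connecting map is made explicit: \<open>u\<close> measures the failure of a lift
  \<open>g\<close> of \<open>f\<close> to be a cocycle. In degree one this turns heredity into
  closure of the right class under cokernels of monomorphisms.\<close>

lemma trivial_Ext_quotient:
  assumes m: "m \<in> Ob C" and se: "short_exact C x i y p z"
    and tx: "trivial_group (Ext C (Suc (Suc n)) m x)" and ty: "trivial_group (Ext C (Suc n) m y)"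
  shows "trivial_group (Ext C (Suc n) m z)"
proof -
  let ?P = "res_ob C m" and ?d = "res_diff C m"
  note se = short_exactD[OF se] and d = res_diff_arr[OF m]
  note dd = res_diff_comp[OF m]
  show ?thesis
    unfolding trivial_Ext_iff[OF m se(3)]
  proof (intro allI impI)
    fix f assume f: "f \<Colon> ?P (Suc n) \<leadsto> z" "f \<cdot> ?d (Suc n) = Zero C (?P (Suc (Suc n))) z"
    obtain g where g: "g \<Colon> ?P (Suc n) \<leadsto> y" "p \<cdot> g = f"
      using projective_lift[OF res_projective[OF m] se(7,2) f(1)] .
    have gd: "g \<cdot> ?d (Suc n) \<Colon> ?P (Suc (Suc n)) \<leadsto> y" using g(1) d by blast
    have "p \<cdot> (g \<cdot> ?d (Suc n)) = Zero C (?P (Suc (Suc n))) z" using assoc[OF se(5) g(1) d] g(2) f(2)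
      by simp
    then obtain u where u: "u \<Colon> ?P (Suc (Suc n)) \<leadsto> x" "i \<cdot> u = g \<cdot> ?d (Suc n)"
      using kernel_lift[OF se(8) gd] by metis
    have "i \<cdot> (u \<cdot> ?d (Suc (Suc n))) = Zero C (?P (Suc (Suc (Suc n)))) y"
      using assoc[OF se(4) u(1) d] u(2) comp_comp_eq_zero[OF dd g(1) d d] by simp
    then obtain v where v: "v \<Colon> ?P (Suc n) \<leadsto> x" "v \<cdot> ?d (Suc n) = u"
      using Ext_cocycle_lift[OF m tx u(1)] monic_zero[OF se(6) comp_arr[OF u(1) d] se(2)] by metis
    have iv: "i \<cdot> v \<Colon> ?P (Suc n) \<leadsto> y" using se(4) v(1) by blast
    \<comment> \<open>\<open>w\<close> is the corrected lift of \<open>f\<close>, now a cocycle with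
      values in \<open>y\<close>.\<close>
    obtain w where w: "w \<Colon> ?P (Suc n) \<leadsto> y" "g = i \<cdot> v \<boxplus> w" using add_diff[OF g(1) iv] .
    have "(i \<cdot> v \<boxplus> w) \<cdot> ?d (Suc n) = (i \<cdot> v) \<cdot> ?d (Suc n)"
      using assoc[OF se(4) v(1) d] v(2) u(2) w(2) by simp
    then have "w \<cdot> ?d (Suc n) = Zero C (?P (Suc (Suc n))) y" using add_comp_eqD[OF _ d iv w(1)]
      by simp
    then obtain h where h: "h \<Colon> ?P n \<leadsto> y" "h \<cdot> ?d n = w" using Ext_cocycle_lift[OF m ty w(1)]
      by metis
    have "p \<cdot> g = p \<cdot> (i \<cdot> v) \<boxplus> p \<cdot> w" using comp_add_right[OF se(5) iv w(1)] w(2) by simp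
    also have "\<dots> = p \<cdot> w"
      using comp_eq_zero_comp[OF se(10,5,4) v(1)] add_zero_left[OF comp_arr[OF se(5) w(1)]] by simp
    finally have "(p \<cdot> h) \<cdot> ?d n = f" using assoc[OF se(5) h(1) d] h(2) g(2) by simp
    then show "\<exists>g. g \<Colon> ?P n \<leadsto> z \<and> g \<cdot> ?d n = f" using se(5) h(1) by blast
  qed
qed

text \<open>In \<open>y\<close> the cocycle \<open>f\<close> is bounded by some \<open>g\<close>,
  and \<open>g\<close> is corrected by a lift of a cochain from \<open>z\<close> until it takes
  values in \<open>x\<close>. With \<open>y\<close> injective this is dimension shifting.\<close>

lemma trivial_Ext_subobject:
  assumes m: "m \<in> Ob C" and se: "short_exact C x i y p z"
    and ty: "trivial_group (Ext C (Suc (Suc n)) m y)" and tz: "trivial_group (Ext C (Suc n) m z)"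
  shows "trivial_group (Ext C (Suc (Suc n)) m x)"
proof -
  let ?P = "res_ob C m" and ?d = "res_diff C m"
  note se = short_exactD[OF se] and d = res_diff_arr[OF m]
  note dd = res_diff_comp[OF m]
  show ?thesis
    unfolding trivial_Ext_iff[OF m se(1)]
  proof (intro allI impI)
    fix f assume f: "f \<Colon> ?P (Suc (Suc n)) \<leadsto> x"
      "f \<cdot> ?d (Suc (Suc n)) = Zero C (?P (Suc (Suc (Suc n)))) x"
    obtain g where g: "g \<Colon> ?P (Suc n) \<leadsto> y" "g \<cdot> ?d (Suc n) = i \<cdot> f"
      using Ext_cocycle_lift[OF m ty comp_arr[OF se(4) f(1)] comp_comp_eq_zero[OF f(2) se(4) f(1) d]] .
    have "(p \<cdot> g) \<cdot> ?d (Suc n) = Zero C (?P (Suc (Suc n))) z"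
      using assoc[OF se(5) g(1) d] g(2) comp_eq_zero_comp[OF se(10,5,4) f(1)] by simp
    then obtain h where h: "h \<Colon> ?P n \<leadsto> z" "h \<cdot> ?d n = p \<cdot> g"
      using Ext_cocycle_lift[OF m tz comp_arr[OF se(5) g(1)]] by metis
    obtain h' where h': "h' \<Colon> ?P n \<leadsto> y" "p \<cdot> h' = h"
      using projective_lift[OF res_projective[OF m] se(7,2) h(1)] .
    have hd: "h' \<cdot> ?d n \<Colon> ?P (Suc n) \<leadsto> y" using h'(1) d by blast
    have "p \<cdot> g = p \<cdot> (h' \<cdot> ?d n)" using assoc[OF se(5) h'(1) d] h h' by simp
    then obtain u where u: "u \<Colon> ?P (Suc n) \<leadsto> x" "g = h' \<cdot> ?d n \<boxplus> i \<cdot> u"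
      using kernel_diff[OF se(8,3) g(1) hd] by metis
    have "i \<cdot> f = (h' \<cdot> ?d n) \<cdot> ?d (Suc n) \<boxplus> (i \<cdot> u) \<cdot> ?d (Suc n)"
      using comp_add_left[OF hd comp_arr[OF se(4) u(1)] d] g(2) u(2) by simp
    also have "\<dots> = i \<cdot> (u \<cdot> ?d (Suc n))"
      using comp_comp_eq_zero[OF dd h'(1) d d] assoc[OF se(4) u(1) d]
        add_zero_left[OF comp_arr[OF se(4) comp_arr[OF u(1) d]]] by simp
    finally have "u \<cdot> ?d (Suc n) = f" using monic_cancel[OF se(6) f(1) comp_arr[OF u(1) d]] by simp
    then show "\<exists>g. g \<Colon> ?P (Suc n) \<leadsto> x \<and> g \<cdot> ?d (Suc n) = f" using u(1) by blast
  qed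
qed

text \<open>The square enters only through its universal property, so both legs of one pullback can
  be treated by the same argument.\<close>

lemma pullback_short_exact:
  assumes ab: "short_exact C k m a c e" and d: "d \<Colon> b \<leadsto> e" and p: "p \<Colon> P \<leadsto> a" and q: "q \<Colon> P \<leadsto> b"
    and eq: "c \<cdot> p = d \<cdot> q"
    and ex: "\<And>x u v. u \<Colon> x \<leadsto> a \<Longrightarrow> v \<Colon> x \<leadsto> b \<Longrightarrow> c \<cdot> u = d \<cdot> v \<Longrightarrow> \<exists>w. w \<Colon> x \<leadsto> P \<and> p \<cdot> w = u \<and> q \<cdot> w = v"
    and un: "\<And>x w w'. w \<Colon> x \<leadsto> P \<Longrightarrow> w' \<Colon> x \<leadsto> P \<Longrightarrow> p \<cdot> w = p \<cdot> w' \<Longrightarrow> q \<cdot> w = q \<cdot> w' \<Longrightarrow> w = w'"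
  obtains n where "short_exact C k n P q b"
proof -
  note se = short_exactD[OF ab]
  have Ob: "P \<in> Ob C" "b \<in> Ob C" using q by (auto dest: arr_Ob)
  have zkb: "Zero C k b \<Colon> k \<leadsto> b" using Ob se(1) by blast
  have "c \<cdot> m = d \<cdot> Zero C k b" using se(10) comp_zero[OF d se(1)] by simp
  \<comment> \<open>The kernel inclusion has components \<open>m\<close> into \<open>a\<close> and
    zero into \<open>b\<close>.\<close>
  then obtain n where n: "n \<Colon> k \<leadsto> P" "p \<cdot> n = m" "q \<cdot> n = Zero C k b" using ex[OF se(4) zkb]
    by blast
  have mon: "monic C k P n" using monic_right_factor[OF _ p n(1)] se(6) n(2) by simp
  have "is_kernel C k n P q b"
  proof (rule is_kernelI[OF mon se(1) q n(3)])
    fix x g assume g: "g \<Colon> x \<leadsto> P" "q \<cdot> g = Zero C x b"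
    have "c \<cdot> (p \<cdot> g) = Zero C x e"
      using assoc[OF se(5) p g(1)] assoc[OF d q g(1)] eq g(2) comp_zero[OF d arr_Ob(1)[OF g(1)]]
        by simp
    then obtain y where y: "y \<Colon> x \<leadsto> k" "m \<cdot> y = p \<cdot> g"
      using kernel_lift[OF se(8) comp_arr[OF p g(1)]] by metis
    have "n \<cdot> y = g"
    proof (rule un[OF comp_arr[OF n(1) y(1)] g(1)])
      show "p \<cdot> (n \<cdot> y) = p \<cdot> g" using assoc[OF p n(1) y(1)] n(2) y(2) by simp
      show "q \<cdot> (n \<cdot> y) = q \<cdot> g" using comp_eq_zero_comp[OF n(3) q n(1) y(1)] g(2) by simp
    qed
    then show "\<exists>u. u \<Colon> x \<leadsto> k \<and> n \<cdot> u = g" using y(1) by blast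
  qed
  moreover have "epic C P b q"
  proof (rule epic_projI[OF q])
    fix r h assume r: "projective C r" "h \<Colon> r \<leadsto> b"
    obtain u where u: "u \<Colon> r \<leadsto> a" "c \<cdot> u = d \<cdot> h"
      using projective_lift[OF r(1) se(7,2) comp_arr[OF d r(2)]] .
    then show "\<exists>k. k \<Colon> r \<leadsto> P \<and> q \<cdot> k = h" using ex[OF u(1) r(2)] by blast
  qed
  ultimately show ?thesis using that short_exactI Ob by blast
qed

end

section \<open>Right exact endofunctors and the trivial extension\<close>

locale right_exact_endofunctor = abelian_category C
  for C :: "('o, 'm) cat" (structure) +
  fixes F :: "('o, 'm, 'o, 'm) functor_data"
  assumes additive: "additive_functor C C F" and right_exact: "right_exact C C F"
begin

abbreviation F_ob :: "'o \<Rightarrow> 'o" where "F_ob \<equiv> on_ob F"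
abbreviation F_mor :: "'m \<Rightarrow> 'm" where "F_mor \<equiv> on_mor F"

lemma F_Ob: "a \<in> Ob C \<Longrightarrow> F_ob a \<in> Ob C"
  using additive by (simp add: additive_functor_def)

lemma F_arr: "f \<Colon> a \<leadsto> b \<Longrightarrow> F_mor f \<Colon> F_ob a \<leadsto> F_ob b"
  using additive by (simp add: additive_functor_def arr_def)

lemma F_ident: "a \<in> Ob C \<Longrightarrow> F_mor (Ident C a) = Ident C (F_ob a)"
  using additive by (simp add: additive_functor_def)

lemma F_comp: "g \<Colon> b \<leadsto> c \<Longrightarrow> f \<Colon> a \<leadsto> b \<Longrightarrow> F_mor (g \<cdot> f) = F_mor g \<cdot> F_mor f"
  using additive unfolding additive_functor_def arr_def by blast

lemma F_add: "f \<Colon> a \<leadsto> b \<Longrightarrow> g \<Colon> a \<leadsto> b \<Longrightarrow> F_mor (f \<boxplus> g) = F_mor f \<boxplus> F_mor g"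
  using additive unfolding additive_functor_def arr_def by blast

lemma F_zero:
  assumes "a \<in> Ob C" "b \<in> Ob C"
  shows "F_mor (Zero C a b) = Zero C (F_ob a) (F_ob b)"
proof -
  have z: "Zero C a b \<Colon> a \<leadsto> b" using assms by auto
  show ?thesis using add_eq_self[OF _ F_arr[OF z] F_arr[OF z]] F_add[OF z z] add_zero_right[OF z]
    by simp
qed

lemma F_comp_zero:
  assumes "g \<cdot> f = Zero C a c" "g \<Colon> b \<leadsto> c" "f \<Colon> a \<leadsto> b"
  shows "F_mor g \<cdot> F_mor f = Zero C (F_ob a) (F_ob c)"
  using F_comp[OF assms(2,3)] assms(1) F_zero[OF arr_Ob(1)[OF assms(3)] arr_Ob(2)[OF assms(2)]]
    by simp

lemma F_short_exact:
  assumes "short_exact C a f b g c"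
  shows "exact_at C (F_ob a) (F_mor f) (F_ob b) (F_mor g) (F_ob c)"
    "epic C (F_ob b) (F_ob c) (F_mor g)"
  using right_exact assms by (auto simp: right_exact_def)

lemma F_epic:
  assumes f: "epic C a b f" and Ob: "a \<in> Ob C" "b \<in> Ob C"
  shows "epic C (F_ob a) (F_ob b) (F_mor f)"
proof -
  obtain k i where "is_kernel C k i a f b" using kernels[OF Ob arr_Hom[OF epic_arr[OF f Ob]]]
    by blast
  then show ?thesis using F_short_exact(2)[OF short_exactI[OF _ f Ob]] by blast
qed

end

locale right_exact_endofunctor_enough = right_exact_endofunctor C F + abelian_category_enough C
  for C :: "('o, 'm) cat" (structure) and F :: "('o, 'm, 'o, 'm) functor_data"
begin

text \<open>\<open>right_exact\<close> speaks of short exact sequences, whereas \<open>f\<close> may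
  fail to be monic. Write \<open>f\<close> as an epimorphism \<open>e\<close> followed by the kernel
  \<open>i\<close> of \<open>p\<close>; then \<open>F\<close> keeps \<open>e\<close> epic and makes
  the image of \<open>p\<close> a cokernel of the image of \<open>i\<close>.\<close>

lemma F_cokernel:
  assumes p: "is_cokernel C a f b p q" and Ob: "a \<in> Ob C" "b \<in> Ob C"
  shows "is_cokernel C (F_ob a) (F_mor f) (F_ob b) (F_mor p) (F_ob q)"
proof -
  have pa: "p \<Colon> b \<leadsto> q" and f: "f \<Colon> a \<leadsto> b" using p Ob by (auto simp: is_cokernel_def arr_def)
  have pe: "epic C b q p" using cokernel_epic[OF p Ob] .
  obtain k i where k: "is_kernel C k i b p q" using kernels[OF arr_Ob[OF pa] arr_Hom[OF pa]]
    by blast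
  have i: "i \<Colon> k \<leadsto> b" using k Ob(2) by (rule kernel_arr)
  have se: "short_exact C k i b p q" using short_exactI[OF k pe arr_Ob[OF pa]] .
  obtain e where e: "e \<Colon> a \<leadsto> k" "i \<cdot> e = f" using kernel_lift[OF k f cokernel_comp[OF p]] .
  \<comment> \<open>Place the target \<open>x\<close> of a test map inside an injective. Then
    \<open>m \<cdot> g\<close> extends to \<open>b\<close>, the extension kills \<open>f\<close>, so
    it factors through \<open>p\<close> and vanishes on \<open>k\<close>.\<close>
  have "epic C a k e"
  proof (rule epicI[OF e(1)])
    fix x g assume g: "g \<Colon> k \<leadsto> x" "g \<cdot> e = Zero C a x"
    obtain j m where j: "injective C j" "monic C x j m" "m \<Colon> x \<leadsto> j"
      using injective_hull[OF arr_Ob(2)[OF g(1)]] .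
    have mg: "m \<cdot> g \<Colon> k \<leadsto> j" using j(3) g(1) by blast
    obtain h where h: "h \<Colon> b \<leadsto> j" "h \<cdot> i = m \<cdot> g"
      using injective_extend[OF j(1) kernel_monic[OF k arr_Ob[OF pa]] Ob(2) mg] .
    have "h \<cdot> f = Zero C a j"
      using assoc[OF h(1) i e(1)] assoc[OF j(3) g(1) e(1)] e(2) h(2) g(2) comp_zero[OF j(3) Ob(1)]
        by simp
    then obtain h' where h': "h' \<Colon> q \<leadsto> j" "h' \<cdot> p = h" using cokernel_factor[OF p h(1)] by metis
    have "m \<cdot> g = Zero C k j"
      using comp_comp_eq_zero[OF kernel_comp[OF k] h'(1) pa i] h'(2) h(2) by simp
    then show "g = Zero C k x" using monic_zero[OF j(2) g(1) arr_Ob(2)[OF j(3)]] by simp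
  qed
  then have Fe: "epic C (F_ob a) (F_ob k) (F_mor e)" using F_epic arr_Ob[OF e(1)] by blast
  note Fi = F_arr[OF i] and Fee = F_arr[OF e(1)] and Fp = F_arr[OF pa]
  note cok = exact_at_epic_cokernel[OF F_short_exact[OF se] arr_Ob[OF Fi] arr_Ob(2)[OF Fp]]
  show ?thesis
  proof (rule is_cokernelI[OF F_short_exact(2)[OF se] arr_Ob(2)[OF Fp] F_arr[OF f]
        F_comp_zero[OF cokernel_comp[OF p] pa f]])
    fix x u assume u: "u \<Colon> F_ob b \<leadsto> x" "u \<cdot> F_mor f = Zero C (F_ob a) x"
    have "(u \<cdot> F_mor i) \<cdot> F_mor e = Zero C (F_ob a) x"
      using assoc[OF u(1) Fi Fee] F_comp[OF i e(1)] e(2) u(2) by simp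
    then have "u \<cdot> F_mor i = Zero C (F_ob k) x"
      using epic_zero[OF Fe comp_arr[OF u(1) Fi] arr_Ob(1)[OF Fee]] by simp
    then show "\<exists>v. v \<Colon> F_ob q \<leadsto> x \<and> v \<cdot> F_mor p = u" using cokernel_factor[OF cok u(1)] by metis
  qed
qed

text \<open>If the homology of \<open>F P\<close> in degree one is zero, then
  \<open>F P\<^sub>2\<close> maps epically onto the kernel of \<open>F d\<^sub>0\<close>. A
  generalized element killed by \<open>F \<iota>\<close> lifts along \<open>F \<pi>\<close> into
  that kernel, hence comes from \<open>F P\<^sub>2\<close>, and \<open>F \<pi>\<close> kills
  whatever comes from there.\<close>

lemma F_syzygy_monic:
  assumes m: "m \<in> Ob C" and zero: "is_zero_object C (left_derived C C F 1 m)"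
    and pi:
      "is_cokernel C (res_ob C m (Suc (Suc 0))) (res_diff C m (Suc 0)) (res_ob C m (Suc 0)) \<pi> k"
    and iota: "\<iota> \<Colon> k \<leadsto> res_ob C m 0" "\<iota> \<cdot> \<pi> = res_diff C m 0"
  shows "monic C (F_ob k) (F_ob (res_ob C m 0)) (F_mor \<iota>)"
proof -
  let ?P = "res_ob C m" and ?d = "res_diff C m"
  note d = res_diff_arr[OF m] and P = res_ob_Ob[OF m]
  note Fd = F_arr[OF d]
  have dd: "F_mor (?d 0) \<cdot> F_mor (?d (Suc 0)) = Zero C (F_ob (?P (Suc (Suc 0)))) (F_ob (?P 0))"
    using F_comp_zero[OF res_diff_comp[OF m] d d] .
  \<comment> \<open>\<open>left_derived\<close> is a \<open>SOME\<close>, so some homology object is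
    exhibited before the chosen object is known to be one.\<close>
  obtain h where "is_left_derived C C F 1 m h"
  proof -
    obtain k' i where k': "is_kernel C k' i (F_ob (?P (Suc 0))) (F_mor (?d 0)) (F_ob (?P 0))"
      using kernels[OF arr_Ob[OF Fd] arr_Hom[OF Fd]] by blast
    obtain u where u: "u \<Colon> F_ob (?P (Suc (Suc 0))) \<leadsto> k'" "i \<cdot> u = F_mor (?d (Suc 0))"
      using kernel_lift[OF k' Fd dd] .
    obtain p h where "is_cokernel C (F_ob (?P (Suc (Suc 0)))) u k' p h"
      using cokernels[OF arr_Ob[OF u(1)] arr_Hom[OF u(1)]] by blast
    then have "is_left_derived C C F 1 m h"
      using k' u arr_Hom[OF u(1)] by (auto simp: is_homology_def)
    then show ?thesis by (rule that)
  qed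
  then have "is_left_derived C C F 1 m (left_derived C C F 1 m)"
    unfolding left_derived_def by (rule someI)
  then obtain k' i u p h where k':
    "is_kernel C k' i (F_ob (?P (Suc 0))) (F_mor (?d 0)) (F_ob (?P 0))"
    and u': "u \<in> Hom C (F_ob (?P (Suc (Suc 0)))) k'" "i \<cdot> u = F_mor (?d (Suc 0))"
    and p: "is_cokernel C (F_ob (?P (Suc (Suc 0)))) u k' p h" and h: "is_zero_object C h"
    using zero by (auto simp: is_homology_def)
  have i: "i \<Colon> k' \<leadsto> F_ob (?P (Suc 0))" using k' arr_Ob[OF Fd] by (auto intro: kernel_arr)
  have u: "u \<Colon> F_ob (?P (Suc (Suc 0))) \<leadsto> k'" using u' arr_Ob[OF i] arr_Ob[OF Fd]
    by (auto simp: arr_def)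
  have pa: "p \<Colon> k' \<leadsto> h" using p arr_Ob(1)[OF i] by (rule cokernel_arr)
  \<comment> \<open>The cokernel of \<open>u\<close> is the zero object, so any map killing
    \<open>u\<close> factors through zero.\<close>
  have ue: "epic C (F_ob (?P (Suc (Suc 0)))) k' u"
  proof (rule epicI[OF u])
    fix x g assume g: "g \<Colon> k' \<leadsto> x" "g \<cdot> u = Zero C (F_ob (?P (Suc (Suc 0)))) x"
    obtain g' where g': "g' \<Colon> h \<leadsto> x" "g' \<cdot> p = g" using cokernel_factor[OF p g] .
    have "g' = Zero C h x"
      using h g'(1) zero_arr[OF arr_Ob[OF g'(1)]] unfolding is_zero_object_def arr_def by blast
    then show "g = Zero C k' x" using g' zero_comp[OF pa arr_Ob(2)[OF g(1)]] by simp
  qed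
  have pia: "\<pi> \<Colon> ?P (Suc 0) \<leadsto> k" using pi P by (rule cokernel_arr)
  have pie: "epic C (F_ob (?P (Suc 0))) (F_ob k) (F_mor \<pi>)"
    using F_epic[OF cokernel_epic[OF pi P P] arr_Ob[OF pia]] .
  have fact: "F_mor \<iota> \<cdot> F_mor \<pi> = F_mor (?d 0)" using F_comp[OF iota(1) pia] iota(2) by simp
  note Fi = F_arr[OF iota(1)] and Fpi = F_arr[OF pia]
  show ?thesis
  proof (rule monic_projI[OF Fi])
    fix r z assume r: "projective C r" "z \<Colon> r \<leadsto> F_ob k" "F_mor \<iota> \<cdot> z = Zero C r (F_ob (?P 0))"
    obtain w where w: "w \<Colon> r \<leadsto> F_ob (?P (Suc 0))" "F_mor \<pi> \<cdot> w = z"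
      using projective_lift[OF r(1) pie arr_Ob(1)[OF Fpi] r(2)] .
    have "F_mor (?d 0) \<cdot> w = Zero C r (F_ob (?P 0))"
      using assoc[OF Fi Fpi w(1)] fact w(2) r(3) by simp
    then obtain w' where w': "w' \<Colon> r \<leadsto> k'" "i \<cdot> w' = w" using kernel_lift[OF k' w(1)] by metis
    obtain v where v: "v \<Colon> r \<leadsto> F_ob (?P (Suc (Suc 0)))" "u \<cdot> v = w'"
      using projective_lift[OF r(1) ue arr_Ob(1)[OF u] w'(1)] .
    have "w = F_mor (?d (Suc 0)) \<cdot> v" using assoc[OF i u v(1)] v(2) w'(2) u'(2) by simp
    then show "z = Zero C r (F_ob k)"
      using comp_eq_zero_comp[OF F_comp_zero[OF cokernel_comp[OF pi] pia d] Fpi Fd v(1)] w(2)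
        by simp
  qed
qed

end

section \<open>Preadditive structure of the trivial extension\<close>

context right_exact_endofunctor
begin

abbreviation trivext :: "('o \<times> 'm, 'm) cat" where "trivext \<equiv> right_trivial_extension C F"

lemma trivext_simps [simp]:
  "Comp trivext = Comp C" "Add trivext = Add C" "Ident trivext x = Ident C (fst x)"
  "Zero trivext x y = Zero C (fst x) (fst y)"
  by (simp_all add: right_trivial_extension_def split_beta)

text \<open>The locale notion of arrow becomes available for the trivial extension only after the
  category axioms are proved, and those proofs already need it; \<open>trivext_arr_eq\<close>
  identifies the two afterwards.\<close>

definition trivext_arr :: "'m \<Rightarrow> 'o \<times> 'm \<Rightarrow> 'o \<times> 'm \<Rightarrow> bool" where
  "trivext_arr f x y \<longleftrightarrow> x \<in> Ob trivext \<and> y \<in> Ob trivext \<and> f \<in> Hom trivext x y"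

lemma Ob_trivext_iff:
  "x \<in> Ob trivext \<longleftrightarrow> snd x \<Colon> F_ob (fst x) \<leadsto> fst x \<and>
     snd x \<cdot> F_mor (snd x) = Zero C (F_ob (F_ob (fst x))) (fst x)"
  using F_Ob by (cases x) (auto simp: right_trivial_extension_def arr_def)

lemma trivext_arr_iff:
  "trivext_arr f x y \<longleftrightarrow>
    x \<in> Ob trivext \<and> y \<in> Ob trivext \<and> f \<Colon> fst x \<leadsto> fst y \<and> f \<cdot> snd x = snd y \<cdot> F_mor f"
  unfolding trivext_arr_def by (cases x; cases y) (auto simp: right_trivial_extension_def arr_def)

lemma trivext_arrD:
  assumes "trivext_arr f x y"
  shows "x \<in> Ob trivext" "y \<in> Ob trivext" "f \<Colon> fst x \<leadsto> fst y" "f \<cdot> snd x = snd y \<cdot> F_mor f"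
  using assms by (auto simp: trivext_arr_iff)

lemma trivext_struct:
  assumes "x \<in> Ob trivext"
  shows "snd x \<Colon> F_ob (fst x) \<leadsto> fst x"
    "snd x \<cdot> F_mor (snd x) = Zero C (F_ob (F_ob (fst x))) (fst x)"
    "fst x \<in> Ob C"
  using assms arr_Ob by (auto simp: Ob_trivext_iff)

lemma trivext_arr_ident:
  assumes "x \<in> Ob trivext"
  shows "trivext_arr (Ident C (fst x)) x x"
  using assms trivext_struct[OF assms] F_ident[of "fst x"]
    ident_left[OF trivext_struct(1)[OF assms]]
    ident_right[OF trivext_struct(1)[OF assms]]
  by (auto simp: trivext_arr_iff)

lemma trivext_arr_comp:
  assumes g: "trivext_arr g y z" and f: "trivext_arr f x y"
  shows "trivext_arr (g \<cdot> f) x z"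
proof -
  note f' = trivext_arrD[OF f] and g' = trivext_arrD[OF g]
  have "(g \<cdot> f) \<cdot> snd x = g \<cdot> (snd y \<cdot> F_mor f)"
    using assoc[OF g'(3) f'(3) trivext_struct(1)[OF f'(1)]] f'(4) by simp
  also have "\<dots> = snd z \<cdot> F_mor (g \<cdot> f)"
    using assoc[OF g'(3) trivext_struct(1)[OF f'(2)] F_arr[OF f'(3)]] g'(4) F_comp[OF g'(3) f'(3)]
      assoc[OF trivext_struct(1)[OF g'(2)] F_arr[OF g'(3)] F_arr[OF f'(3)]] by simp
  finally show ?thesis using f' g' by (auto simp: trivext_arr_iff)
qed

lemma trivext_arr_zero:
  assumes "x \<in> Ob trivext" "y \<in> Ob trivext"
  shows "trivext_arr (Zero C (fst x) (fst y)) x y"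
proof -
  note x = trivext_struct[OF assms(1)] and y = trivext_struct[OF assms(2)]
  show ?thesis
    using assms x(3) y(3) zero_comp[OF x(1) y(3)] F_zero[OF x(3) y(3)]
      comp_zero[OF y(1) F_Ob[OF x(3)]]
    by (auto simp: trivext_arr_iff)
qed

lemma trivext_arr_add:
  assumes f: "trivext_arr f x y" and g: "trivext_arr g x y"
  shows "trivext_arr (f \<boxplus> g) x y"
proof -
  note f' = trivext_arrD[OF f] and g' = trivext_arrD[OF g]
  have "(f \<boxplus> g) \<cdot> snd x = snd y \<cdot> F_mor (f \<boxplus> g)"
    using comp_add_left[OF f'(3) g'(3) trivext_struct(1)[OF f'(1)]] F_add[OF f'(3) g'(3)]
      comp_add_right[OF trivext_struct(1)[OF f'(2)] F_arr[OF f'(3)] F_arr[OF g'(3)]] f'(4) g'(4)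
        by simp
  then show ?thesis using f' g' by (auto simp: trivext_arr_iff)
qed

text \<open>Negation is taken in \<open>C\<close>. It respects the structure maps because
  \<open>g \<cdot> snd x\<close> and \<open>snd y \<cdot> F_mor g\<close> are both the negative of
  \<open>f \<cdot> snd x\<close>.\<close>

lemma trivext_arr_neg:
  assumes f: "trivext_arr f x y"
  obtains g where "trivext_arr g x y" "g \<boxplus> f = Zero C (fst x) (fst y)"
proof -
  note f' = trivext_arrD[OF f]
  note x = trivext_struct[OF f'(1)] and y = trivext_struct[OF f'(2)]
  obtain g where g: "g \<Colon> fst x \<leadsto> fst y" "Zero C (fst x) (fst y) = f \<boxplus> g"
    using add_diff[OF zero_arr[OF x(3) y(3)] f'(3)] .
  have gx: "g \<cdot> snd x \<Colon> F_ob (fst x) \<leadsto> fst y" and gy: "snd y \<cdot> F_mor g \<Colon> F_ob (fst x) \<leadsto> fst y"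
    and fx: "f \<cdot> snd x \<Colon> F_ob (fst x) \<leadsto> fst y"
    using g(1) f'(3) x(1) y(1) F_arr by blast+
  have "f \<cdot> snd x \<boxplus> g \<cdot> snd x = Zero C (F_ob (fst x)) (fst y)"
    using comp_add_left[OF f'(3) g(1) x(1)] g(2) zero_comp[OF x(1) y(3)] by simp
  moreover have "f \<cdot> snd x \<boxplus> snd y \<cdot> F_mor g = Zero C (F_ob (fst x)) (fst y)"
    using comp_add_right[OF y(1) F_arr[OF f'(3)] F_arr[OF g(1)]] F_add[OF f'(3) g(1)] g(2)
      F_zero[OF x(3) y(3)] comp_zero[OF y(1) F_Ob[OF x(3)]] f'(4) by simp
  ultimately have "g \<cdot> snd x = snd y \<cdot> F_mor g" using add_cancel[OF _ fx gx gy] by simp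
  then have "trivext_arr g x y" using g(1) f' by (simp add: trivext_arr_iff)
  moreover have "g \<boxplus> f = Zero C (fst x) (fst y)" using g add_commute[OF g(1) f'(3)] by simp
  ultimately show ?thesis by (rule that)
qed

lemma trivext_preadditive: "preadditive_category trivext"
proof (intro preadditive_category.intro category.intro preadditive_category_axioms.intro)
  fix a b c f g
  assume "a \<in> Ob trivext" "b \<in> Ob trivext" "c \<in> Ob trivext" "f \<in> Hom trivext a b"
    "g \<in> Hom trivext b c"
  then show "g \<cdot>\<^bsub>trivext\<^esub> f \<in> Hom trivext a c" using trivext_arr_comp[of g b c f a]
    by (simp add: trivext_arr_def)
next
  fix a assume "a \<in> Ob trivext"
  then show "Ident trivext a \<in> Hom trivext a a" using trivext_arr_ident
    by (auto simp: trivext_arr_def)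
next
  fix a b f assume "a \<in> Ob trivext" "b \<in> Ob trivext" "f \<in> Hom trivext a b"
  then have "trivext_arr f a b" by (simp add: trivext_arr_def)
  then show "f \<cdot>\<^bsub>trivext\<^esub> Ident trivext a = f" "Ident trivext b \<cdot>\<^bsub>trivext\<^esub> f = f"
    using ident_right[OF trivext_arrD(3)] ident_left[OF trivext_arrD(3)] by simp_all
next
  fix a b c e f g h
  assume "a \<in> Ob trivext" "b \<in> Ob trivext" "c \<in> Ob trivext" "e \<in> Ob trivext"
    "f \<in> Hom trivext a b" "g \<in> Hom trivext b c" "h \<in> Hom trivext c e"
  then have "trivext_arr f a b" "trivext_arr g b c" "trivext_arr h c e"
    by (simp_all add: trivext_arr_def)
  then show "h \<cdot>\<^bsub>trivext\<^esub> g \<cdot>\<^bsub>trivext\<^esub> f = h \<cdot>\<^bsub>trivext\<^esub> (g \<cdot>\<^bsub>trivext\<^esub> f)"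
    using assoc trivext_arrD(3) by simp blast
next
  fix a b assume ab: "a \<in> Ob trivext" "b \<in> Ob trivext"
  have h: "f \<in> carrier (hom_group trivext a b) \<longleftrightarrow> trivext_arr f a b" for f
    using ab by (simp add: hom_group_def trivext_arr_def)
  have s: "f \<otimes>\<^bsub>hom_group trivext a b\<^esub> g = f \<boxplus> g" "\<one>\<^bsub>hom_group trivext a b\<^esub> = Zero C (fst a) (fst b)"
    for f g
    by (simp_all add: hom_group_def)
  have inv: "\<exists>g\<in>carrier (hom_group trivext a b). g \<boxplus> f = Zero C (fst a) (fst b)"
    if "trivext_arr f a b" for f
    using trivext_arr_neg[OF that] h by metis
  show "comm_group (hom_group trivext a b)"
    by (rule comm_groupI; unfold h s)
      (auto intro: trivext_arr_add trivext_arr_zero ab add_assoc[OF trivext_arrD(3) trivext_arrD(3) trivext_arrD(3)] inv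
        add_commute[OF trivext_arrD(3) trivext_arrD(3)] add_zero_left[OF trivext_arrD(3)])
next
  fix a b c f f' g
  assume "a \<in> Ob trivext" "b \<in> Ob trivext" "c \<in> Ob trivext"
    "f \<in> Hom trivext a b" "f' \<in> Hom trivext a b" "g \<in> Hom trivext b c"
  then have "trivext_arr f a b" "trivext_arr f' a b" "trivext_arr g b c"
    by (simp_all add: trivext_arr_def)
  then show "g \<cdot>\<^bsub>trivext\<^esub> Add trivext f f' = Add trivext (g \<cdot>\<^bsub>trivext\<^esub> f) (g \<cdot>\<^bsub>trivext\<^esub> f')"
    using comp_add_right trivext_arrD(3) by simp blast
next
  fix a b c f g g'
  assume "a \<in> Ob trivext" "b \<in> Ob trivext" "c \<in> Ob trivext"
    "f \<in> Hom trivext a b" "g \<in> Hom trivext b c" "g' \<in> Hom trivext b c"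
  then have "trivext_arr f a b" "trivext_arr g b c" "trivext_arr g' b c"
    by (simp_all add: trivext_arr_def)
  then show "Add trivext g g' \<cdot>\<^bsub>trivext\<^esub> f = Add trivext (g \<cdot>\<^bsub>trivext\<^esub> f) (g' \<cdot>\<^bsub>trivext\<^esub> f)"
    using comp_add_left trivext_arrD(3) by simp blast
qed

sublocale A: preadditive_category trivext
  by (rule trivext_preadditive)

end

section \<open>Kernels and cokernels over the forgetful functor\<close>

context right_exact_endofunctor
begin

lemma trivext_arr_eq: "A.arr f x y \<longleftrightarrow> trivext_arr f x y"
  by (simp add: A.arr_def trivext_arr_def)

lemma trivext_zero_object: "\<exists>z. is_zero_object trivext z"
proof -
  obtain z where z: "is_zero_object C z" using zero_object by blast
  then have zOb: "z \<in> Ob C" by (simp add: is_zero_object_def)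
  let ?x = "(z, Zero C (F_ob z) z)"
  have zz: "Zero C (F_ob z) z \<Colon> F_ob z \<leadsto> z" using F_Ob[OF zOb] zOb by blast
  have x: "?x \<in> Ob trivext"
    using zz zero_comp[OF F_arr[OF zz] zOb] by (simp add: Ob_trivext_iff)
  have "(\<exists>!f. f \<in> Hom trivext ?x a) \<and> (\<exists>!f. f \<in> Hom trivext a ?x)" if a: "a \<in> Ob trivext" for a
  proof -
    have "f = g" if "trivext_arr f ?x a" "trivext_arr g ?x a" for f g
      using that z by (auto simp: trivext_arr_iff arr_def is_zero_object_def)
    moreover have "f = g" if "trivext_arr f a ?x" "trivext_arr g a ?x" for f g
      using that z by (auto simp: trivext_arr_iff arr_def is_zero_object_def)
    moreover have "trivext_arr (Zero C z (fst a)) ?x a" "trivext_arr (Zero C (fst a) z) a ?x"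
      using trivext_arr_zero[OF x a] trivext_arr_zero[OF a x] by auto
    ultimately show ?thesis using a x unfolding trivext_arr_def by blast
  qed
  then show ?thesis using x unfolding is_zero_object_def by blast
qed

lemma trivext_monicI:
  assumes m: "monic C (fst x) (fst y) f" and f: "trivext_arr f x y"
  shows "monic trivext x y f"
proof (rule A.monicI)
  fix z g assume g: "A.arr g z x" "f \<cdot>\<^bsub>trivext\<^esub> g = Zero trivext z y"
  show "g = Zero trivext z x"
    using monic_zero[OF m, of g "fst z"] g trivext_arrD(3) arr_Ob(2)[OF trivext_arrD(3)[OF f]]
      by (simp add: trivext_arr_eq)
qed (use f in \<open>simp add: trivext_arr_eq\<close>)

lemma trivext_epicI:
  assumes m: "epic C (fst x) (fst y) f" and f: "trivext_arr f x y"
  shows "epic trivext x y f"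
proof (rule A.epicI)
  fix z g assume g: "A.arr g y z" "g \<cdot>\<^bsub>trivext\<^esub> f = Zero trivext x z"
  show "g = Zero trivext y z"
    using epic_zero[OF m, of g "fst z"] g trivext_arrD(3) arr_Ob(1)[OF trivext_arrD(3)[OF f]]
      by (simp add: trivext_arr_eq)
qed (use f in \<open>simp add: trivext_arr_eq\<close>)

lemma trivext_arr_monic_cancel:
  assumes i: "monic C (fst w) (fst x) i" "trivext_arr i w x" and iu: "trivext_arr (i \<cdot> u) z x"
    and u: "u \<Colon> fst z \<leadsto> fst w"
  shows "trivext_arr u z w"
proof -
  note i' = trivext_arrD[OF i(2)] and iu' = trivext_arrD[OF iu]
  note w = trivext_struct[OF i'(1)] and x = trivext_struct[OF i'(2)]
    and z = trivext_struct[OF iu'(1)]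
  have "i \<cdot> (u \<cdot> snd z) = snd x \<cdot> (F_mor i \<cdot> F_mor u)"
    using assoc[OF i'(3) u z(1)] iu'(4) F_comp[OF i'(3) u] by simp
  also have "\<dots> = i \<cdot> (snd w \<cdot> F_mor u)"
    using assoc[OF x(1) F_arr[OF i'(3)] F_arr[OF u]] assoc[OF i'(3) w(1) F_arr[OF u]] i'(4) by simp
  finally have "u \<cdot> snd z = snd w \<cdot> F_mor u"
    using monic_cancel[OF i(1) comp_arr[OF u z(1)] comp_arr[OF w(1) F_arr[OF u]]] by simp
  then show ?thesis using i'(1) iu'(1) u by (simp add: trivext_arr_iff)
qed

text \<open>The map to be cancelled is \<open>F_mor p\<close>, so right exactness enters through
  \<open>F_epic\<close>; the monic version cancels \<open>i\<close> itself.\<close>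

lemma trivext_arr_epic_cancel:
  assumes p: "epic C (fst x) (fst w) p" "trivext_arr p x w" and up: "trivext_arr (u \<cdot> p) x z"
    and u: "u \<Colon> fst w \<leadsto> fst z"
  shows "trivext_arr u w z"
proof -
  note p' = trivext_arrD[OF p(2)] and up' = trivext_arrD[OF up]
  note x = trivext_struct[OF p'(1)] and w = trivext_struct[OF p'(2)]
    and z = trivext_struct[OF up'(2)]
  note Fp = F_arr[OF p'(3)] and Fu = F_arr[OF u]
  have "(u \<cdot> snd w) \<cdot> F_mor p = (u \<cdot> p) \<cdot> snd x"
    using assoc[OF u w(1) Fp] assoc[OF u p'(3) x(1)] p'(4) by simp
  also have "\<dots> = (snd z \<cdot> F_mor u) \<cdot> F_mor p"
    using up'(4) F_comp[OF u p'(3)] assoc[OF z(1) Fu Fp] by simp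
  finally have "u \<cdot> snd w = snd z \<cdot> F_mor u"
    using epic_cancel[OF F_epic[OF p(1) x(3) w(3)] comp_arr[OF u w(1)] comp_arr[OF z(1) Fu]] by simp
  then show ?thesis using p'(2) up'(2) u by (simp add: trivext_arr_iff)
qed

text \<open>The factorization found in \<open>C\<close> is automatically a morphism of the trivial
  extension, by \<open>trivext_arr_monic_cancel\<close>.\<close>

lemma trivext_is_kernelI:
  assumes k: "is_kernel C (fst w) i (fst x) f (fst y)" and i: "trivext_arr i w x"
    and f: "trivext_arr f x y"
  shows "is_kernel trivext w i x f y"
proof -
  note f' = trivext_arrD[OF f] and i' = trivext_arrD[OF i]
  have mon: "monic C (fst w) (fst x) i" using kernel_monic[OF k arr_Ob[OF f'(3)]] .
  show ?thesis
  proof (rule A.is_kernelI)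
    show "monic trivext w x i" using trivext_monicI[OF mon i] .
    show "w \<in> Ob trivext" by fact
    show "A.arr f x y" using f by (simp add: trivext_arr_eq)
    show "f \<cdot>\<^bsub>trivext\<^esub> i = Zero trivext w y" using kernel_comp[OF k] by simp
  next
    fix z g assume "A.arr g z x" "f \<cdot>\<^bsub>trivext\<^esub> g = Zero trivext z y"
    then have g: "trivext_arr g z x" "f \<cdot> g = Zero C (fst z) (fst y)"
      by (simp_all add: trivext_arr_eq)
    obtain u where u: "u \<Colon> fst z \<leadsto> fst w" "i \<cdot> u = g"
      using kernel_lift[OF k trivext_arrD(3)[OF g(1)] g(2)] .
    then show "\<exists>u. A.arr u z w \<and> i \<cdot>\<^bsub>trivext\<^esub> u = g"
      using trivext_arr_monic_cancel[OF mon i _ u(1)] g(1) by (auto simp: trivext_arr_eq)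
  qed
qed

lemma trivext_is_cokernelI:
  assumes k: "is_cokernel C (fst x) f (fst y) p (fst w)" and p: "trivext_arr p y w"
    and f: "trivext_arr f x y"
  shows "is_cokernel trivext x f y p w"
proof -
  note f' = trivext_arrD[OF f] and p' = trivext_arrD[OF p]
  have epi: "epic C (fst y) (fst w) p" using cokernel_epic[OF k arr_Ob[OF f'(3)]] .
  show ?thesis
  proof (rule A.is_cokernelI)
    show "epic trivext y w p" using trivext_epicI[OF epi p] .
    show "w \<in> Ob trivext" by fact
    show "A.arr f x y" using f by (simp add: trivext_arr_eq)
    show "p \<cdot>\<^bsub>trivext\<^esub> f = Zero trivext x w" using cokernel_comp[OF k] by simp
  next
    fix z g assume "A.arr g y z" "g \<cdot>\<^bsub>trivext\<^esub> f = Zero trivext x z"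
    then have g: "trivext_arr g y z" "g \<cdot> f = Zero C (fst x) (fst z)"
      by (simp_all add: trivext_arr_eq)
    obtain u where u: "u \<Colon> fst w \<leadsto> fst z" "u \<cdot> p = g"
      using cokernel_factor[OF k trivext_arrD(3)[OF g(1)] g(2)] .
    then show "\<exists>u. A.arr u w z \<and> u \<cdot>\<^bsub>trivext\<^esub> p = g"
      using trivext_arr_epic_cancel[OF epi p _ u(1)] g(1) by (auto simp: trivext_arr_eq)
  qed
qed

text \<open>The structure map is the restriction of \<open>snd x\<close>: \<open>f\<close> kills
  \<open>snd x \<cdot> F_mor i\<close>, which thus factors through \<open>i\<close>. Its square
  vanishes because \<open>i\<close> is monic.\<close>

lemma trivext_kernel_structure:
  assumes k: "is_kernel C k i (fst x) f (fst y)" and f: "trivext_arr f x y"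
  obtains w where "fst w = k" "trivext_arr i w x"
proof -
  note f' = trivext_arrD[OF f]
  note x = trivext_struct[OF f'(1)] and y = trivext_struct[OF f'(2)]
  have i: "i \<Colon> k \<leadsto> fst x" using k x(3) by (rule kernel_arr)
  note Fi = F_arr[OF i] and mon = kernel_monic[OF k x(3) y(3)]
  have "f \<cdot> (snd x \<cdot> F_mor i) = (snd y \<cdot> F_mor f) \<cdot> F_mor i"
    using assoc[OF f'(3) x(1) Fi] f'(4) by simp
  also have "\<dots> = Zero C (F_ob k) (fst y)"
    using comp_comp_eq_zero[OF F_comp_zero[OF kernel_comp[OF k] f'(3) i] y(1) F_arr[OF f'(3)] Fi] .
  finally obtain \<kappa> where \<kappa>: "\<kappa> \<Colon> F_ob k \<leadsto> k" "i \<cdot> \<kappa> = snd x \<cdot> F_mor i"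
    using kernel_lift[OF k comp_arr[OF x(1) Fi]] by metis
  note F\<kappa> = F_arr[OF \<kappa>(1)] and Fx = F_arr[OF x(1)]
  have "i \<cdot> (\<kappa> \<cdot> F_mor \<kappa>) = snd x \<cdot> F_mor (i \<cdot> \<kappa>)"
    using assoc[OF i \<kappa>(1) F\<kappa>] \<kappa>(2) assoc[OF x(1) Fi F\<kappa>] F_comp[OF i \<kappa>(1)] by simp
  also have "\<dots> = snd x \<cdot> (F_mor (snd x) \<cdot> F_mor (F_mor i))"
    using \<kappa>(2) F_comp[OF x(1) Fi] by simp
  also have "\<dots> = Zero C (F_ob (F_ob k)) (fst x)"
    using comp_eq_zero_comp[OF x(2,1) Fx F_arr[OF Fi]] .
  finally have "\<kappa> \<cdot> F_mor \<kappa> = Zero C (F_ob (F_ob k)) k"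
    using monic_zero[OF mon comp_arr[OF \<kappa>(1) F\<kappa>] x(3)] by simp
  then have "trivext_arr i (k, \<kappa>) x" using \<kappa> i f'(1) by (simp add: trivext_arr_iff Ob_trivext_iff)
  then show ?thesis using that[of "(k, \<kappa>)"] by simp
qed

end

section \<open>Abelian structure of the trivial extension\<close>

context right_exact_endofunctor_enough
begin

text \<open>A structure map on \<open>q\<close> starts at \<open>F_ob q\<close>, so it can be
  induced only because \<open>F_mor p\<close> is a cokernel of \<open>F_mor f\<close>. Its square is
  seen to vanish after cancelling \<open>F_mor (F_mor p)\<close>.\<close>

lemma trivext_cokernel_structure:
  assumes q: "is_cokernel C (fst x) f (fst y) p q" and f: "trivext_arr f x y"
  obtains w where "fst w = q" "trivext_arr p y w"
proof -
  note f' = trivext_arrD[OF f]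
  note x = trivext_struct[OF f'(1)] and y = trivext_struct[OF f'(2)]
  have p: "p \<Colon> fst y \<leadsto> q" using q y(3) by (rule cokernel_arr)
  have pe: "epic C (fst y) q p" using cokernel_epic[OF q x(3) y(3)] .
  note Fp = F_arr[OF p] and Ff = F_arr[OF f'(3)] and qOb = arr_Ob(2)[OF p]
  have "(p \<cdot> snd y) \<cdot> F_mor f = p \<cdot> (f \<cdot> snd x)"
    using assoc[OF p y(1) Ff] f'(4) by simp
  also have "\<dots> = Zero C (F_ob (fst x)) q"
    using comp_eq_zero_comp[OF cokernel_comp[OF q] p f'(3) x(1)] .
  finally obtain \<theta> where \<theta>: "\<theta> \<Colon> F_ob q \<leadsto> q" "\<theta> \<cdot> F_mor p = p \<cdot> snd y"
    using cokernel_factor[OF F_cokernel[OF q x(3) y(3)] comp_arr[OF p y(1)]] by metis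
  note F\<theta> = F_arr[OF \<theta>(1)] and Fy = F_arr[OF y(1)] and FFp = F_arr[OF Fp]
  have "(\<theta> \<cdot> F_mor \<theta>) \<cdot> F_mor (F_mor p) = \<theta> \<cdot> F_mor (p \<cdot> snd y)"
    using assoc[OF \<theta>(1) F\<theta> FFp] F_comp[OF \<theta>(1) Fp] \<theta>(2) by simp
  also have "\<dots> = (p \<cdot> snd y) \<cdot> F_mor (snd y)"
    using F_comp[OF p y(1)] assoc[OF \<theta>(1) Fp Fy] \<theta>(2) by simp
  also have "\<dots> = Zero C (F_ob (F_ob (fst y))) q" using comp_comp_eq_zero[OF y(2) p y(1) Fy] .
  finally have "\<theta> \<cdot> F_mor \<theta> = Zero C (F_ob (F_ob q)) q"
    using epic_zero[OF F_epic[OF F_epic[OF pe y(3) qOb] arr_Ob[OF Fp]] comp_arr[OF \<theta>(1) F\<theta>] arr_Ob(1)[OF FFp]]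
    by simp
  then have "trivext_arr p y (q, \<theta>)" using \<theta> p f'(2) by (simp add: trivext_arr_iff Ob_trivext_iff)
  then show ?thesis using that[of "(q, \<theta>)"] by simp
qed

lemma trivext_kernels:
  assumes "trivext_arr f x y"
  obtains w i where "is_kernel trivext w i x f y" "is_kernel C (fst w) i (fst x) f (fst y)"
    "trivext_arr i w x"
proof -
  note f = trivext_arrD(3)[OF assms]
  obtain k i where k: "is_kernel C k i (fst x) f (fst y)"
    using kernels[OF arr_Ob[OF f] arr_Hom[OF f]] by blast
  obtain w where w: "fst w = k" "trivext_arr i w x" using trivext_kernel_structure[OF k assms] .
  then show ?thesis using that trivext_is_kernelI assms k by blast
qed

lemma trivext_cokernels:
  assumes "trivext_arr f x y"
  obtains w p where "is_cokernel trivext x f y p w" "is_cokernel C (fst x) f (fst y) p (fst w)"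
    "trivext_arr p y w"
proof -
  note f = trivext_arrD(3)[OF assms]
  obtain p q where q: "is_cokernel C (fst x) f (fst y) p q"
    using cokernels[OF arr_Ob[OF f] arr_Hom[OF f]] by blast
  obtain w where w: "fst w = q" "trivext_arr p y w" using trivext_cokernel_structure[OF q assms] .
  then show ?thesis using that trivext_is_cokernelI assms q by blast
qed

text \<open>The kernel computed in \<open>C\<close> carries a structure map, so its inclusion is a
  morphism of the trivial extension killed by \<open>f\<close>, and hence zero. This gives monicity
  against all test objects of \<open>C\<close>, with or without a structure map.\<close>

lemma trivext_monicD:
  assumes m: "monic trivext x y f" and f: "trivext_arr f x y"
  shows "monic C (fst x) (fst y) f"
proof -
  note f' = trivext_arrD[OF f]
  obtain w i where k: "is_kernel trivext w i x f y" "is_kernel C (fst w) i (fst x) f (fst y)"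
    "trivext_arr i w x"
    using trivext_kernels[OF f] .
  have i0: "i = Zero C (fst w) (fst x)"
    using A.monic_zero[OF m, of i w] k(3) f'(2) kernel_comp[OF k(2)] by (simp add: trivext_arr_eq)
  show ?thesis
  proof (rule monicI[OF f'(3)])
    fix z g assume g: "g \<Colon> z \<leadsto> fst x" "f \<cdot> g = Zero C z (fst y)"
    obtain u where u: "u \<Colon> z \<leadsto> fst w" "i \<cdot> u = g" using kernel_lift[OF k(2) g] .
    then show "g = Zero C z (fst x)" using zero_comp[OF u(1) arr_Ob(1)[OF f'(3)]] i0 by simp
  qed
qed

lemma trivext_epicD:
  assumes m: "epic trivext x y f" and f: "trivext_arr f x y"
  shows "epic C (fst x) (fst y) f"
proof -
  note f' = trivext_arrD[OF f]
  obtain w p where k: "is_cokernel trivext x f y p w" "is_cokernel C (fst x) f (fst y) p (fst w)"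
    "trivext_arr p y w"
    using trivext_cokernels[OF f] .
  have p0: "p = Zero C (fst y) (fst w)"
    using A.epic_zero[OF m, of p w] k(3) f'(1) cokernel_comp[OF k(2)] by (simp add: trivext_arr_eq)
  show ?thesis
  proof (rule epicI[OF f'(3)])
    fix z g assume g: "g \<Colon> fst y \<leadsto> z" "g \<cdot> f = Zero C (fst x) z"
    obtain u where u: "u \<Colon> fst w \<leadsto> z" "u \<cdot> p = g" using cokernel_factor[OF k(2) g] .
    then show "g = Zero C (fst y) z" using comp_zero[OF u(1) arr_Ob(2)[OF f'(3)]] p0 by simp
  qed
qed

text \<open>Compare with the kernel built over \<open>C\<close>: its inclusion factors through
  \<open>i\<close>, which hands the factorization property for test objects of \<open>C\<close> on
  to \<open>i\<close>.\<close>

lemma trivext_is_kernelD: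
  assumes k: "is_kernel trivext w i x f y" and f: "trivext_arr f x y"
  shows "is_kernel C (fst w) i (fst x) f (fst y)" "trivext_arr i w x"
proof -
  note f' = trivext_arrD[OF f]
  show i: "trivext_arr i w x" using A.kernel_arr[OF k f'(1)] by (simp add: trivext_arr_eq)
  note i' = trivext_arrD[OF i]
  have mon: "monic C (fst w) (fst x) i" using trivext_monicD[OF A.kernel_monic[OF k f'(1,2)] i] .
  obtain w' i2 where k': "is_kernel trivext w' i2 x f y" "is_kernel C (fst w') i2 (fst x) f (fst y)"
    "trivext_arr i2 w' x"
    using trivext_kernels[OF f] .
  obtain v where "A.arr v w' w" "i \<cdot>\<^bsub>trivext\<^esub> v = i2"
    using A.kernel_lift[OF k, of i2 w'] k'(3) A.kernel_comp[OF k'(1)] by (auto simp: trivext_arr_eq)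
  then have v: "v \<Colon> fst w' \<leadsto> fst w" "i \<cdot> v = i2" using trivext_arrD(3)
    by (auto simp: trivext_arr_eq)
  show "is_kernel C (fst w) i (fst x) f (fst y)"
  proof (rule is_kernelI[OF mon arr_Ob(1)[OF i'(3)] f'(3)])
    show "f \<cdot> i = Zero C (fst w) (fst y)" using A.kernel_comp[OF k] by simp
  next
    fix z g assume g: "g \<Colon> z \<leadsto> fst x" "f \<cdot> g = Zero C z (fst y)"
    obtain u where u: "u \<Colon> z \<leadsto> fst w'" "i2 \<cdot> u = g" using kernel_lift[OF k'(2) g] .
    then have "i \<cdot> (v \<cdot> u) = g" using assoc[OF i'(3) v(1) u(1)] v(2) by simp
    then show "\<exists>u. u \<Colon> z \<leadsto> fst w \<and> i \<cdot> u = g" using comp_arr[OF v(1) u(1)] by blast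
  qed
qed

lemma trivext_biproducts:
  assumes x: "x \<in> Ob trivext" and y: "y \<in> Ob trivext"
  shows "\<exists>s i j p q. is_biproduct trivext x y s i j p q"
proof -
  note x' = trivext_struct[OF x] and y' = trivext_struct[OF y]
  obtain s i j p q where bp: "is_biproduct C (fst x) (fst y) s i j p q"
    using biproducts[OF x'(3) y'(3)] by blast
  note ar = biproduct_arr[OF bp x'(3) y'(3)] and eqs = biproduct_eqs[OF bp x'(3) y'(3)]
  note i = ar(1) and j = ar(2) and p = ar(3) and q = ar(4)
  note joint = biproduct_jointly_monic[OF bp x'(3) y'(3)]
  note Fi = F_arr[OF i] and Fj = F_arr[OF j] and Fp = F_arr[OF p] and Fq = F_arr[OF q]
  have xp: "snd x \<cdot> F_mor p \<Colon> F_ob s \<leadsto> fst x" and yq: "snd y \<cdot> F_mor q \<Colon> F_ob s \<leadsto> fst y"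
    using x'(1) y'(1) Fp Fq by auto
  \<comment> \<open>\<open>\<sigma>\<close> is forced by the demand that both projections be
    morphisms. The identities it has to satisfy are checked after \<open>p\<close> and
    \<open>q\<close>.\<close>
  define \<sigma> where "\<sigma> = i \<cdot> (snd x \<cdot> F_mor p) \<boxplus> j \<cdot> (snd y \<cdot> F_mor q)"
  have \<sigma>: "\<sigma> \<Colon> F_ob s \<leadsto> s" using i j xp yq by (auto simp: \<sigma>_def)
  have p\<sigma>: "p \<cdot> \<sigma> = snd x \<cdot> F_mor p" and q\<sigma>: "q \<cdot> \<sigma> = snd y \<cdot> F_mor q"
    using biproduct_pair[OF bp x'(3) y'(3) xp yq] by (simp_all add: \<sigma>_def)
  have sq: "r \<cdot> (\<sigma> \<cdot> F_mor \<sigma>) = Zero C (F_ob (F_ob s)) (fst z)"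
    if r: "r \<Colon> s \<leadsto> fst z" and z: "z \<in> Ob trivext" and r\<sigma>: "r \<cdot> \<sigma> = snd z \<cdot> F_mor r" for r z
  proof -
    note z' = trivext_struct[OF z] and Fr = F_arr[OF r] and F\<sigma> = F_arr[OF \<sigma>]
    have "r \<cdot> (\<sigma> \<cdot> F_mor \<sigma>) = snd z \<cdot> F_mor (r \<cdot> \<sigma>)"
      using assoc[OF r \<sigma> F\<sigma>] r\<sigma> assoc[OF z'(1) Fr F\<sigma>] F_comp[OF r \<sigma>] by simp
    also have "\<dots> = snd z \<cdot> (F_mor (snd z) \<cdot> F_mor (F_mor r))" using r\<sigma> F_comp[OF z'(1) Fr] by simp
    also have "\<dots> = Zero C (F_ob (F_ob s)) (fst z)"
      using comp_eq_zero_comp[OF z'(2,1) F_arr[OF z'(1)] F_arr[OF Fr]] .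
    finally show ?thesis .
  qed
  have sOb: "s \<in> Ob C" using i by (rule arr_Ob)
  have z: "Zero C (F_ob (F_ob s)) s \<Colon> F_ob (F_ob s) \<leadsto> s" using F_Ob sOb by blast
  have "\<sigma> \<cdot> F_mor \<sigma> = Zero C (F_ob (F_ob s)) s"
    using joint[OF comp_arr[OF \<sigma> F_arr[OF \<sigma>]] z] sq[OF p x p\<sigma>] sq[OF q y q\<sigma>]
      comp_zero[OF p arr_Ob(1)[OF z]] comp_zero[OF q arr_Ob(1)[OF z]] by simp
  then have S: "(s, \<sigma>) \<in> Ob trivext" using \<sigma> by (simp add: Ob_trivext_iff)
  have hp: "trivext_arr p (s, \<sigma>) x" and hq: "trivext_arr q (s, \<sigma>) y" using S x y p q p\<sigma> q\<sigma>
    by (simp_all add: trivext_arr_iff)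
  have "i \<cdot> snd x = \<sigma> \<cdot> F_mor i"
  proof (rule joint[OF comp_arr[OF i x'(1)] comp_arr[OF \<sigma> Fi]])
    show "p \<cdot> (i \<cdot> snd x) = p \<cdot> (\<sigma> \<cdot> F_mor i)"
      using assoc[OF p i x'(1)] assoc[OF p \<sigma> Fi] p\<sigma> eqs(1) ident_left[OF x'(1)]
        assoc[OF x'(1) Fp Fi]
        F_comp[OF p i] F_ident[OF x'(3)] ident_right[OF x'(1)] by simp
    show "q \<cdot> (i \<cdot> snd x) = q \<cdot> (\<sigma> \<cdot> F_mor i)"
      using comp_eq_zero_comp[OF eqs(4) q i x'(1)] assoc[OF q \<sigma> Fi] q\<sigma>
        comp_comp_eq_zero[OF F_comp_zero[OF eqs(4) q i] y'(1) Fq Fi] by simp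
  qed
  then have hi: "trivext_arr i x (s, \<sigma>)" using S x i by (simp add: trivext_arr_iff)
  have "j \<cdot> snd y = \<sigma> \<cdot> F_mor j"
  proof (rule joint[OF comp_arr[OF j y'(1)] comp_arr[OF \<sigma> Fj]])
    show "q \<cdot> (j \<cdot> snd y) = q \<cdot> (\<sigma> \<cdot> F_mor j)"
      using assoc[OF q j y'(1)] assoc[OF q \<sigma> Fj] q\<sigma> eqs(2) ident_left[OF y'(1)]
        assoc[OF y'(1) Fq Fj]
        F_comp[OF q j] F_ident[OF y'(3)] ident_right[OF y'(1)] by simp
    show "p \<cdot> (j \<cdot> snd y) = p \<cdot> (\<sigma> \<cdot> F_mor j)"
      using comp_eq_zero_comp[OF eqs(3) p j y'(1)] assoc[OF p \<sigma> Fj] p\<sigma>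
        comp_comp_eq_zero[OF F_comp_zero[OF eqs(3) p j] x'(1) Fp Fj] by simp
  qed
  then have hj: "trivext_arr j y (s, \<sigma>)" using S y j by (simp add: trivext_arr_iff)
  have "is_biproduct trivext x y (s, \<sigma>) i j p q"
    unfolding is_biproduct_def using S hp hq hi hj eqs by (simp add: trivext_arr_def)
  then show ?thesis by blast
qed

sublocale A: abelian_category trivext
proof
  show "\<exists>z. is_zero_object trivext z" by (rule trivext_zero_object)
  show "\<exists>s i j p q. is_biproduct trivext a b s i j p q" if "a \<in> Ob trivext" "b \<in> Ob trivext" for a b
    using trivext_biproducts[OF that] .
  show "\<exists>k i. is_kernel trivext k i a f b"
    if "a \<in> Ob trivext" "b \<in> Ob trivext" "f \<in> Hom trivext a b" for a b f
  proof -
    have "trivext_arr f a b" using that by (simp add: trivext_arr_def)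
    then obtain w i where "is_kernel trivext w i a f b" by (rule trivext_kernels)
    then show ?thesis by blast
  qed
  show "\<exists>p q. is_cokernel trivext a f b p q"
    if "a \<in> Ob trivext" "b \<in> Ob trivext" "f \<in> Hom trivext a b" for a b f
  proof -
    have "trivext_arr f a b" using that by (simp add: trivext_arr_def)
    then obtain w p where "is_cokernel trivext a f b p w" by (rule trivext_cokernels)
    then show ?thesis by blast
  qed
next
  fix x y f assume xy: "x \<in> Ob trivext" "y \<in> Ob trivext" "monic trivext x y f"
  then have f: "trivext_arr f x y" by (simp add: trivext_arr_def monic_def)
  note Ob = arr_Ob[OF trivext_arrD(3)[OF f]]
  obtain w p where q: "is_cokernel C (fst x) f (fst y) p (fst w)" "trivext_arr p y w"
    using trivext_cokernels[OF f] .
  have "is_kernel trivext x f y p w"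
    using trivext_is_kernelI[OF monic_cokernel_kernel[OF trivext_monicD[OF xy(3) f] q(1) Ob] f q(2)]
      .
  then show "\<exists>c\<in>Ob trivext. \<exists>g. is_kernel trivext x f y g c" using trivext_arrD(2)[OF q(2)] by blast
next
  fix x y f assume xy: "x \<in> Ob trivext" "y \<in> Ob trivext" "epic trivext x y f"
  then have f: "trivext_arr f x y" by (simp add: trivext_arr_def epic_def)
  note Ob = arr_Ob[OF trivext_arrD(3)[OF f]]
  obtain w i where k: "is_kernel C (fst w) i (fst x) f (fst y)" "trivext_arr i w x"
    using trivext_kernels[OF f] .
  have "is_cokernel trivext w i x f y"
    using trivext_is_cokernelI[OF epic_kernel_cokernel[OF trivext_epicD[OF xy(3) f] k(1) Ob] f k(2)]
      .
  then show "\<exists>c\<in>Ob trivext. \<exists>g. is_cokernel trivext c g x f y" using trivext_arrD(1)[OF k(2)]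
    by blast
qed

lemma trivext_short_exactD:
  assumes "short_exact trivext x f y g z"
  shows "short_exact C (fst x) f (fst y) g (fst z)"
proof -
  note se = A.short_exactD[OF assms]
  have g: "trivext_arr g y z" using se(5) by (simp add: trivext_arr_eq)
  show ?thesis
    using short_exactI[OF trivext_is_kernelD(1)[OF se(8) g] trivext_epicD[OF se(7) g] arr_Ob[OF trivext_arrD(3)[OF g]]] .
qed

end

section \<open>Free objects of the trivial extension\<close>

context right_exact_endofunctor_enough
begin

text \<open>\<open>t\<close> is the value at \<open>b\<close> of the left adjoint \<open>T\<close> of the forgetful functor, that is \<open>b \<oplus> F b\<close> with
  the structure map that sends the summand \<open>F b\<close> of \<open>F (b \<oplus> F b)\<close> identically to \<open>F b\<close>;
  \<open>i\<close> is the unit of the adjunction.\<close>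

definition free_on :: "'o \<Rightarrow> 'o \<times> 'm \<Rightarrow> 'm \<Rightarrow> 'm \<Rightarrow> 'm \<Rightarrow> 'm \<Rightarrow> bool" where
  "free_on b t i j p q \<longleftrightarrow> b \<in> Ob C \<and> is_biproduct C b (F_ob b) (fst t) i j p q \<and> snd t = j \<cdot> F_mor p"

lemma free_on_exists:
  assumes b: "b \<in> Ob C"
  obtains t i j p q where "free_on b t i j p q"
proof -
  obtain s i j p q where "is_biproduct C b (F_ob b) s i j p q" using biproducts[OF b F_Ob[OF b]]
    by blast
  then show ?thesis using that[of "(s, j \<cdot> F_mor p)"] b by (simp add: free_on_def)
qed

context
  fixes b t i j p q assumes free: "free_on b t i j p q"
begin

lemma free_on_biproduct: "is_biproduct C b (F_ob b) (fst t) i j p q" "b \<in> Ob C" "F_ob b \<in> Ob C"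
  using free F_Ob by (auto simp: free_on_def)

lemmas free_arr = biproduct_arr[OF free_on_biproduct]
lemmas free_eqs = biproduct_eqs[OF free_on_biproduct]

text \<open>The structure map lands in the summand \<open>j\<close>, which \<open>p\<close> kills,
  so applying it twice gives zero.\<close>

lemma free_on_Ob: "t \<in> Ob trivext"
proof -
  note j = free_arr(2) and p = free_arr(3)
  have st: "snd t = j \<cdot> F_mor p" using free by (simp add: free_on_def)
  note Fp = F_arr[OF p]
  have jp: "j \<cdot> F_mor p \<Colon> F_ob (fst t) \<leadsto> fst t" using j Fp by blast
  note Fjp = F_arr[OF jp]
  have "p \<cdot> (j \<cdot> F_mor p) = Zero C (F_ob (fst t)) b"
    using comp_eq_zero_comp[OF free_eqs(3) p j Fp] .
  then have "F_mor p \<cdot> F_mor (j \<cdot> F_mor p) = Zero C (F_ob (F_ob (fst t))) (F_ob b)"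
    using F_comp_zero[OF _ p jp] by simp
  then have "(j \<cdot> F_mor p) \<cdot> F_mor (j \<cdot> F_mor p) = Zero C (F_ob (F_ob (fst t))) (fst t)"
    using comp_comp_eq_zero[OF _ j Fp Fjp] by simp
  then show ?thesis using st jp by (simp add: Ob_trivext_iff)
qed

text \<open>The adjoint of \<open>h\<close>: on the summand \<open>F b\<close> the structure maps
  force \<open>snd n \<cdot> F_mor h\<close>. In \<open>snd n \<cdot> F_mor e\<close> this summand
  contributes nothing, because \<open>snd n \<cdot> F_mor (snd n)\<close> is zero.\<close>

lemma free_on_extend:
  assumes n: "n \<in> Ob trivext" and h: "h \<Colon> b \<leadsto> fst n"
  obtains e where "trivext_arr e t n" "e \<cdot> i = h" "e \<cdot> j = snd n \<cdot> F_mor h"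
    "e = h \<cdot> p \<boxplus> (snd n \<cdot> F_mor h) \<cdot> q"
proof -
  note i = free_arr(1) and j = free_arr(2) and p = free_arr(3) and q = free_arr(4)
  note n' = trivext_struct[OF n] and Fh = F_arr[OF h] and Fp = F_arr[OF p] and Fq = F_arr[OF q]
  have nh: "snd n \<cdot> F_mor h \<Colon> F_ob b \<leadsto> fst n" using n'(1) Fh by blast
  define e where "e = h \<cdot> p \<boxplus> (snd n \<cdot> F_mor h) \<cdot> q"
  have hp: "h \<cdot> p \<Colon> fst t \<leadsto> fst n" and nq: "(snd n \<cdot> F_mor h) \<cdot> q \<Colon> fst t \<leadsto> fst n"
    using h p nh q by auto
  then have e: "e \<Colon> fst t \<leadsto> fst n" by (auto simp: e_def)
  note ei = biproduct_copair[OF free_on_biproduct h nh, folded e_def]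
  have "snd n \<cdot> F_mor ((snd n \<cdot> F_mor h) \<cdot> q) = Zero C (F_ob (fst t)) (fst n)"
  proof -
    have hq: "F_mor h \<cdot> q \<Colon> fst t \<leadsto> F_ob (fst n)" using Fh q by blast
    have "F_mor ((snd n \<cdot> F_mor h) \<cdot> q) = F_mor (snd n) \<cdot> F_mor (F_mor h \<cdot> q)"
      using assoc[OF n'(1) Fh q] F_comp[OF n'(1) hq] by simp
    then show ?thesis using comp_eq_zero_comp[OF n'(2,1) F_arr[OF n'(1)] F_arr[OF hq]] by simp
  qed
  then have "snd n \<cdot> F_mor e = snd n \<cdot> F_mor (h \<cdot> p)"
    using F_add[OF hp nq] comp_add_right[OF n'(1) F_arr[OF hp] F_arr[OF nq]]
      add_zero_right[OF comp_arr[OF n'(1) F_arr[OF hp]]] by (simp add: e_def)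
  also have "\<dots> = (e \<cdot> j) \<cdot> F_mor p" using F_comp[OF h p] assoc[OF n'(1) Fh Fp] ei(2) by simp
  also have "\<dots> = e \<cdot> snd t" using assoc[OF e j Fp] free by (simp add: free_on_def)
  finally have "trivext_arr e t n" using e n free_on_Ob by (simp add: trivext_arr_iff)
  then show ?thesis using that ei e_def by blast
qed

text \<open>Since \<open>snd t \<cdot> F_mor i = j\<close>, a morphism out of \<open>t\<close> is
  known on \<open>F b\<close> once it is known on \<open>b\<close>.\<close>

lemma free_on_inr:
  assumes e: "trivext_arr e t n"
  shows "e \<cdot> j = snd n \<cdot> F_mor (e \<cdot> i)"
proof -
  note i = free_arr(1) and j = free_arr(2) and p = free_arr(3)
  note e' = trivext_arrD[OF e] and Fi = F_arr[OF i] and Fp = F_arr[OF p]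
  note n' = trivext_struct[OF e'(2)] and Fe = F_arr[OF e'(3)]
  have ej: "e \<cdot> j \<Colon> F_ob b \<leadsto> fst n" using e'(3) j by blast
  have pi: "F_mor p \<cdot> F_mor i = Ident C (F_ob b)"
    using F_comp[OF p i] free_eqs(1) F_ident[OF free_on_biproduct(2)] by simp
  have st: "snd t = j \<cdot> F_mor p" using free by (simp add: free_on_def)
  have "e \<cdot> j = ((e \<cdot> j) \<cdot> F_mor p) \<cdot> F_mor i"
    using assoc[OF ej Fp Fi] pi ident_right[OF ej] by simp
  also have "\<dots> = (snd n \<cdot> F_mor e) \<cdot> F_mor i" using assoc[OF e'(3) j Fp] st e'(4) by simp
  also have "\<dots> = snd n \<cdot> F_mor (e \<cdot> i)" using assoc[OF n'(1) Fe Fi] F_comp[OF e'(3) i] by simp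
  finally show ?thesis .
qed

lemma free_on_unique:
  assumes e: "trivext_arr e t n" "trivext_arr e' t n" and eq: "e \<cdot> i = e' \<cdot> i"
  shows "e = e'"
  using biproduct_jointly_epic[OF free_on_biproduct trivext_arrD(3)[OF e(1)] trivext_arrD(3)[OF e(2)] eq]
    free_on_inr[OF e(1)] free_on_inr[OF e(2)] eq by simp

end

text \<open>\<open>T\<close> acts on \<open>\<iota>\<close> as \<open>\<iota>\<close> on the first
  summand and as \<open>F \<iota>\<close> on the second, so monicity is checked on the two
  components \<open>pe\<close> and \<open>qe\<close>.\<close>

lemma free_on_monic:
  assumes k: "free_on k t i j p q" and l: "free_on l t' i' j' p' q'"
    and \<iota>: "monic C k l \<iota>" and F\<iota>: "monic C (F_ob k) (F_ob l) (F_mor \<iota>)"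
  obtains e where "trivext_arr e t t'" "e \<cdot> i = i' \<cdot> \<iota>" "monic C (fst t) (fst t') e"
proof -
  note ar = free_arr[OF k] and ar' = free_arr[OF l] and bp = free_on_biproduct[OF k]
    and bp' = free_on_biproduct[OF l]
  have \<iota>a: "\<iota> \<Colon> k \<leadsto> l" using monic_arr[OF \<iota> bp(2) bp'(2)] .
  note F\<iota>a = F_arr[OF \<iota>a]
  have i\<iota>: "i' \<cdot> \<iota> \<Colon> k \<leadsto> fst t'" using ar'(1) \<iota>a by blast
  obtain e where e: "trivext_arr e t t'" "e \<cdot> i = i' \<cdot> \<iota>" "e \<cdot> j = snd t' \<cdot> F_mor (i' \<cdot> \<iota>)"
    using free_on_extend[OF k free_on_Ob[OF l] i\<iota>] .
  have ea: "e \<Colon> fst t \<leadsto> fst t'" using trivext_arrD(3)[OF e(1)] .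
  have "e \<cdot> j = j' \<cdot> F_mor \<iota>"
  proof -
    note Fi = F_arr[OF ar'(1)] and Fp = F_arr[OF ar'(3)]
    have "snd t' \<cdot> F_mor i' = j'"
      using l assoc[OF ar'(2) Fp Fi] F_comp[OF ar'(3,1)] free_eqs(1)[OF l] F_ident[OF bp'(2)]
        ident_right[OF ar'(2)]
      by (simp add: free_on_def)
    then show ?thesis
      using e(3) F_comp[OF ar'(1) \<iota>a] assoc[OF trivext_struct(1)[OF free_on_Ob[OF l]] Fi F\<iota>a]
        by simp
  qed
  note ej = this
  have pe: "p' \<cdot> e = \<iota> \<cdot> p"
  proof (rule biproduct_jointly_epic[OF bp])
    show "(p' \<cdot> e) \<cdot> i = (\<iota> \<cdot> p) \<cdot> i"
      using assoc[OF ar'(3) ea ar(1)] e(2) assoc[OF ar'(3,1) \<iota>a] free_eqs(1)[OF l] ident_left[OF \<iota>a]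
        assoc[OF \<iota>a ar(3,1)] free_eqs(1)[OF k] ident_right[OF \<iota>a] by simp
    show "(p' \<cdot> e) \<cdot> j = (\<iota> \<cdot> p) \<cdot> j"
      using assoc[OF ar'(3) ea ar(2)] ej comp_eq_zero_comp[OF free_eqs(3)[OF l] ar'(3,2) F\<iota>a]
        comp_comp_eq_zero[OF free_eqs(3)[OF k] \<iota>a ar(3,2)] by simp
  qed (use ar ar' ea \<iota>a in auto)
  have qe: "q' \<cdot> e = F_mor \<iota> \<cdot> q"
  proof (rule biproduct_jointly_epic[OF bp])
    show "(q' \<cdot> e) \<cdot> i = (F_mor \<iota> \<cdot> q) \<cdot> i"
      using assoc[OF ar'(4) ea ar(1)] e(2) comp_eq_zero_comp[OF free_eqs(4)[OF l] ar'(4,1) \<iota>a]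
        comp_comp_eq_zero[OF free_eqs(4)[OF k] F\<iota>a ar(4,1)] by simp
    show "(q' \<cdot> e) \<cdot> j = (F_mor \<iota> \<cdot> q) \<cdot> j"
      using assoc[OF ar'(4) ea ar(2)] ej assoc[OF ar'(4,2) F\<iota>a] free_eqs(2)[OF l] ident_left[OF F\<iota>a]
        assoc[OF F\<iota>a ar(4,2)] free_eqs(2)[OF k] ident_right[OF F\<iota>a] by simp
  qed (use ar ar' ea F\<iota>a in auto)
  have "monic C (fst t) (fst t') e"
  proof (rule monicI[OF ea])
    fix x g assume g: "g \<Colon> x \<leadsto> fst t" "e \<cdot> g = Zero C x (fst t')"
    have x: "x \<in> Ob C" using g(1) by (rule arr_Ob)
    have "\<iota> \<cdot> (p \<cdot> g) = Zero C x l"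
      using assoc[OF \<iota>a ar(3) g(1)] assoc[OF ar'(3) ea g(1)] pe g(2) comp_zero[OF ar'(3) x] by simp
    then have pg: "p \<cdot> g = Zero C x k" using monic_zero[OF \<iota> comp_arr[OF ar(3) g(1)] bp'(2)] by simp
    have "F_mor \<iota> \<cdot> (q \<cdot> g) = Zero C x (F_ob l)"
      using assoc[OF F\<iota>a ar(4) g(1)] assoc[OF ar'(4) ea g(1)] qe g(2) comp_zero[OF ar'(4) x] by simp
    then have qg: "q \<cdot> g = Zero C x (F_ob k)" using monic_zero[OF F\<iota> comp_arr[OF ar(4) g(1)] bp'(3)]
      by simp
    show "g = Zero C x (fst t)"
      using biproduct_jointly_monic[OF bp g(1) zero_arr[OF x arr_Ob(2)[OF g(1)]]] pg qg
        comp_zero[OF ar(3) x] comp_zero[OF ar(4) x] by simp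
  qed
  then show ?thesis using that e by blast
qed

text \<open>This is where \<open>F X \<subseteq> Y\<close> enters: with \<open>k\<close> and \<open>F x\<close> in \<open>Y\<close>, the second sequence puts \<open>U n\<close> in
  \<open>Y\<close>, so the first one is a special precover of \<open>m\<close>.\<close>

lemma free_on_cover:
  assumes se: "short_exact C k \<kappa> x e (fst m)" and m: "m \<in> Ob trivext"
    and free: "free_on x t i j p q"
  obtains n \<nu> h u v where "short_exact trivext n \<nu> t h m" "short_exact C k u (fst n) v (F_ob x)"
proof -
  note se = short_exactD[OF se]
  note ar = free_arr[OF free] and bp = free_on_biproduct[OF free]
  obtain h where h: "trivext_arr h t m" "h \<cdot> i = e" "h \<cdot> j = snd m \<cdot> F_mor e"
    using free_on_extend[OF free m se(5)] .
  note h' = trivext_arrD(3)[OF h(1)]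
  have hj: "h \<cdot> j \<Colon> F_ob x \<leadsto> fst m" using h' ar(2) by blast
  have he: "epic C (fst t) (fst m) h" using epic_left_factor[OF _ h' ar(1)] h(2) se(7) by simp
  obtain n \<nu> where n: "is_kernel trivext n \<nu> t h m" "is_kernel C (fst n) \<nu> (fst t) h (fst m)"
    "trivext_arr \<nu> n t"
    using trivext_kernels[OF h(1)] .
  have sA: "short_exact trivext n \<nu> t h m"
    using A.short_exactI[OF n(1) trivext_epicI[OF he h(1)]] trivext_arrD[OF h(1)] by blast
  note \<nu> = trivext_arrD(3)[OF n(3)] and \<nu>m = kernel_monic[OF n(2) arr_Ob[OF h']]
  have i\<kappa>: "i \<cdot> \<kappa> \<Colon> k \<leadsto> fst t" using ar(1) se(4) by blast
  have "h \<cdot> (i \<cdot> \<kappa>) = Zero C k (fst m)" using assoc[OF h' ar(1) se(4)] h(2) se(10) by simp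
  then obtain u where u: "u \<Colon> k \<leadsto> fst n" "\<nu> \<cdot> u = i \<cdot> \<kappa>" using kernel_lift[OF n(2) i\<kappa>] by metis
  \<comment> \<open>Points of \<open>n\<close> are pairs \<open>(a, w)\<close> in
    \<open>x \<oplus> F x\<close> with \<open>e a + snd m (F e w) = 0\<close>. The map
    \<open>q \<cdot> \<nu>\<close> reads off \<open>w\<close>, and its kernel consists of the
    \<open>a\<close> with \<open>e a = 0\<close>, that is, of \<open>k\<close>.\<close>
  have v: "q \<cdot> \<nu> \<Colon> fst n \<leadsto> F_ob x" using ar(4) \<nu> by blast
  have split: "z = i \<cdot> (p \<cdot> z) \<boxplus> j \<cdot> (q \<cdot> z)" if z: "z \<Colon> y \<leadsto> fst t" for y z
    using biproduct_jointly_monic[OF bp z]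
      biproduct_pair[OF bp comp_arr[OF ar(3) z] comp_arr[OF ar(4) z]] ar z
    by (metis add_arr comp_arr)
  have um: "monic C k (fst n) u"
  proof (rule monicI[OF u(1)])
    fix y g assume g: "g \<Colon> y \<leadsto> k" "u \<cdot> g = Zero C y (fst n)"
    have "i \<cdot> (\<kappa> \<cdot> g) = Zero C y (fst t)"
      using assoc[OF ar(1) se(4) g(1)] u(2) assoc[OF \<nu> u(1) g(1)] g
        comp_zero[OF \<nu> arr_Ob(1)[OF g(1)]] by simp
    then have "p \<cdot> (i \<cdot> (\<kappa> \<cdot> g)) = Zero C y x" using comp_zero[OF ar(3) arr_Ob(1)[OF g(1)]] by simp
    then have "\<kappa> \<cdot> g = Zero C y x"
      using assoc[OF ar(3,1) comp_arr[OF se(4) g(1)]] free_eqs(1)[OF free]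
        ident_left[OF comp_arr[OF se(4) g(1)]] by simp
    then show "g = Zero C y k" using monic_zero[OF se(6) g(1) se(2)] by simp
  qed
  have "is_kernel C k u (fst n) (q \<cdot> \<nu>) (F_ob x)"
  proof (rule is_kernelI[OF um se(1) v])
    show "(q \<cdot> \<nu>) \<cdot> u = Zero C k (F_ob x)"
      using assoc[OF ar(4) \<nu> u(1)] u(2) comp_eq_zero_comp[OF free_eqs(4)[OF free] ar(4,1) se(4)]
        by simp
  next
    fix y z assume z: "z \<Colon> y \<leadsto> fst n" "(q \<cdot> \<nu>) \<cdot> z = Zero C y (F_ob x)"
    have y: "y \<in> Ob C" using z(1) by (rule arr_Ob)
    have \<nu>z: "\<nu> \<cdot> z \<Colon> y \<leadsto> fst t" using \<nu> z(1) by blast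
    have p\<nu>z: "p \<cdot> (\<nu> \<cdot> z) \<Colon> y \<leadsto> x" using ar(3) \<nu>z by blast
    have "q \<cdot> (\<nu> \<cdot> z) = Zero C y (F_ob x)" using assoc[OF ar(4) \<nu> z(1)] z(2) by simp
    then have eq: "\<nu> \<cdot> z = i \<cdot> (p \<cdot> (\<nu> \<cdot> z))"
      using split[OF \<nu>z] comp_zero[OF ar(2) y] add_zero_right[OF comp_arr[OF ar(1) p\<nu>z]] by simp
    have "e \<cdot> (p \<cdot> (\<nu> \<cdot> z)) = h \<cdot> (\<nu> \<cdot> z)" using assoc[OF h' ar(1) p\<nu>z] h(2) eq by simp
    also have "\<dots> = Zero C y (fst m)" using comp_eq_zero_comp[OF kernel_comp[OF n(2)] h' \<nu> z(1)] .
    finally obtain w where w: "w \<Colon> y \<leadsto> k" "\<kappa> \<cdot> w = p \<cdot> (\<nu> \<cdot> z)" using kernel_lift[OF se(8) p\<nu>z]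
      by metis
    have "\<nu> \<cdot> (u \<cdot> w) = \<nu> \<cdot> z"
      using assoc[OF \<nu> u(1) w(1)] u(2) assoc[OF ar(1) se(4) w(1)] w(2) eq by simp
    then have "u \<cdot> w = z" using monic_cancel[OF \<nu>m comp_arr[OF u(1) w(1)] z(1)] by simp
    then show "\<exists>w. w \<Colon> y \<leadsto> k \<and> u \<cdot> w = z" using w(1) by blast
  qed
  moreover have "epic C (fst n) (F_ob x) (q \<cdot> \<nu>)"
  proof (rule epic_projI[OF v])
    fix r w assume r: "projective C r" "w \<Colon> r \<leadsto> F_ob x"
    have rOb: "r \<in> Ob C" using r(2) by (rule arr_Ob)
    have hjw: "(h \<cdot> j) \<cdot> w \<Colon> r \<leadsto> fst m" using hj r(2) by blast
    have z: "Zero C r (fst m) \<Colon> r \<leadsto> fst m" using rOb se(3) by blast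
    \<comment> \<open>\<open>d\<close> is the negative of \<open>(h \<cdot> j) \<cdot> w\<close>; a
      preimage \<open>a\<close> of it under \<open>e\<close> completes \<open>w\<close> to a point
      of \<open>n\<close>.\<close>
    obtain d where d: "d \<Colon> r \<leadsto> fst m" "Zero C r (fst m) = (h \<cdot> j) \<cdot> w \<boxplus> d"
      using add_diff[OF z hjw] .
    obtain a where a: "a \<Colon> r \<leadsto> x" "e \<cdot> a = d" using projective_lift[OF r(1) se(7,2) d(1)] .
    have ia: "i \<cdot> a \<Colon> r \<leadsto> fst t" and jw: "j \<cdot> w \<Colon> r \<leadsto> fst t" using ar(1,2) a(1) r(2) by auto
    have "h \<cdot> (i \<cdot> a \<boxplus> j \<cdot> w) = d \<boxplus> (h \<cdot> j) \<cdot> w"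
      using comp_add_right[OF h' ia jw] assoc[OF h' ar(1) a(1)] assoc[OF h' ar(2) r(2)] h(2) a(2)
        by simp
    also have "\<dots> = Zero C r (fst m)" using d add_commute[OF d(1) hjw] by simp
    finally obtain y where y: "y \<Colon> r \<leadsto> fst n" "\<nu> \<cdot> y = i \<cdot> a \<boxplus> j \<cdot> w"
      using kernel_lift[OF n(2) add_arr[OF ia jw]] by metis
    have "(q \<cdot> \<nu>) \<cdot> y = w"
      using assoc[OF ar(4) \<nu> y(1)] y(2) biproduct_pair(2)[OF bp a(1) r(2)] by simp
    then show "\<exists>y. y \<Colon> r \<leadsto> fst n \<and> (q \<cdot> \<nu>) \<cdot> y = w" using y(1) by blast
  qed
  ultimately have "short_exact C k u (fst n) (q \<cdot> \<nu>) (F_ob x)"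
    using short_exactI arr_Ob[OF v] by blast
  then show ?thesis using that sA by blast
qed

end

section \<open>Transfer of lifting properties along the adjunction\<close>

locale trivial_extension_enough = right_exact_endofunctor_enough C F
  for C :: "('o, 'm) cat" (structure) and F :: "('o, 'm, 'o, 'm) functor_data" +
  assumes trivext_projectives: "enough_projectives (right_trivial_extension C F)"
    and trivext_injectives: "enough_injectives (right_trivial_extension C F)"
begin

sublocale A: abelian_category_enough trivext
  by unfold_locales (rule trivext_projectives, rule trivext_injectives)

text \<open>\<open>U\<close> is exact, so a lifting problem for \<open>t\<close> becomes one for
  \<open>b\<close>. The adjoint of its solution solves the original problem, because maps out of a
  free object agree if they agree on \<open>b\<close>.\<close>

lemma trivext_lifts_modulo_free:
  assumes free: "free_on b t i j p q" and lift: "lifts_modulo b (fst n)"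
  shows "A.lifts_modulo t n"
  unfolding A.lifts_modulo_def
proof (intro allI impI)
  fix a e g c \<phi> assume se: "short_exact trivext n a e g c" and \<phi>: "A.arr \<phi> t c"
  have \<phi>': "trivext_arr \<phi> t c" and g: "trivext_arr g e c" using \<phi> A.short_exactD(5)[OF se]
    by (simp_all add: trivext_arr_eq)
  note ar = free_arr[OF free]
  have \<phi>i: "\<phi> \<cdot> i \<Colon> b \<leadsto> fst c" using trivext_arrD(3)[OF \<phi>'] ar(1) by blast
  obtain l where l: "l \<Colon> b \<leadsto> fst e" "g \<cdot> l = \<phi> \<cdot> i"
    using lifts_moduloD[OF lift trivext_short_exactD[OF se] \<phi>i] .
  obtain l' where l': "trivext_arr l' t e" "l' \<cdot> i = l"
    using free_on_extend[OF free trivext_arrD(1)[OF g] l(1)] .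
  have "g \<cdot> l' = \<phi>"
    using free_on_unique[OF free trivext_arr_comp[OF g l'(1)] \<phi>']
      assoc[OF trivext_arrD(3)[OF g] trivext_arrD(3)[OF l'(1)] ar(1)]
      l l'(2) by simp
  then show "\<exists>l. A.arr l t e \<and> g \<cdot>\<^bsub>trivext\<^esub> l = \<phi>" using l'(1) by (auto simp: trivext_arr_eq)
qed

text \<open>\<open>T\<close> need not preserve monomorphisms, so \<open>fst J\<close> is only shown
  to be injective relative to those \<open>\<iota>\<close> that \<open>F\<close> keeps monic. For
  these, \<open>free_on_monic\<close> provides the monomorphism along which the adjoint of
  \<open>h\<close> is extended.\<close>

lemma injective_extend_along:
  assumes J: "injective trivext J" and \<iota>: "monic C k l \<iota>" "monic C (F_ob k) (F_ob l) (F_mor \<iota>)"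
    and Ob: "k \<in> Ob C" "l \<in> Ob C" and h: "h \<Colon> k \<leadsto> fst J"
  obtains g where "g \<Colon> l \<leadsto> fst J" "g \<cdot> \<iota> = h"
proof -
  obtain t i j p q where k: "free_on k t i j p q" using free_on_exists[OF Ob(1)] .
  obtain t' i' j' p' q' where l: "free_on l t' i' j' p' q'" using free_on_exists[OF Ob(2)] .
  obtain e where e: "trivext_arr e t t'" "e \<cdot> i = i' \<cdot> \<iota>" "monic C (fst t) (fst t') e"
    using free_on_monic[OF k l \<iota>] .
  have JOb: "J \<in> Ob trivext" using J by (simp add: injective_def)
  obtain h' where h': "trivext_arr h' t J" "h' \<cdot> i = h" using free_on_extend[OF k JOb h] .
  obtain \<psi> where "A.arr \<psi> t' J" "\<psi> \<cdot>\<^bsub>trivext\<^esub> e = h'"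
    using A.injective_extend[OF J trivext_monicI[OF e(3,1)] free_on_Ob[OF l]] h'(1)
      by (auto simp: trivext_arr_eq)
  then have \<psi>: "trivext_arr \<psi> t' J" "\<psi> \<cdot> e = h'" by (simp_all add: trivext_arr_eq)
  note \<psi>' = trivext_arrD(3)[OF \<psi>(1)] and i = free_arr(1)[OF k] and i' = free_arr(1)[OF l]
  have "(\<psi> \<cdot> i') \<cdot> \<iota> = h"
    using assoc[OF \<psi>' i' monic_arr[OF \<iota>(1) Ob]] e(2) assoc[OF \<psi>' trivext_arrD(3)[OF e(1)] i] \<psi>(2)
      h'(2) by simp
  then show ?thesis using that comp_arr[OF \<psi>' i'] by blast
qed

text \<open>The argument of \<open>trivial_Ext_of_lifts_modulo\<close>, split between two
  categories: the injective embedding and the lifting problem live in the trivial extension, the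
  extension along \<open>\<iota>\<close> and the descent along \<open>e\<close> in \<open>C\<close>.
  The adjoint \<open>\<phi>'\<close> of \<open>\<phi>\<close> connects them.\<close>

lemma extend_of_A_lifts_modulo:
  assumes se: "short_exact C k \<iota> l e x" and F\<iota>: "monic C (F_ob k) (F_ob l) (F_mor \<iota>)"
    and free: "free_on x t i j p q" and n: "n \<in> Ob trivext" and lift: "A.lifts_modulo t n"
    and f: "f \<Colon> k \<leadsto> fst n"
  obtains u where "u \<Colon> l \<leadsto> fst n" "u \<cdot> \<iota> = f"
proof -
  note se = short_exactD[OF se]
  obtain J c m q' where J: "injective trivext J" "short_exact trivext n m J q' c"
    using A.short_exact_injective[OF n] .
  have m: "trivext_arr m n J" and q: "trivext_arr q' J c" using A.short_exactD(4,5)[OF J(2)]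
    by (simp_all add: trivext_arr_eq)
  note J' = short_exactD[OF trivext_short_exactD[OF J(2)]]
  have mf: "m \<cdot> f \<Colon> k \<leadsto> fst J" using J'(4) f by blast
  obtain g where g: "g \<Colon> l \<leadsto> fst J" "g \<cdot> \<iota> = m \<cdot> f"
    using injective_extend_along[OF J(1) se(6) F\<iota> se(1,2) mf] .
  have "(q' \<cdot> g) \<cdot> \<iota> = Zero C k (fst c)"
    using assoc[OF J'(5) g(1) se(4)] g(2) comp_eq_zero_comp[OF J'(10,5,4) f] by simp
  then obtain \<phi> where \<phi>: "\<phi> \<Colon> x \<leadsto> fst c" "\<phi> \<cdot> e = q' \<cdot> g"
    using cokernel_factor[OF se(9) comp_arr[OF J'(5) g(1)]] by metis
  obtain \<phi>' where \<phi>': "trivext_arr \<phi>' t c" "\<phi>' \<cdot> i = \<phi>"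
    using free_on_extend[OF free trivext_arrD(2)[OF q] \<phi>(1)] .
  obtain l' where "A.arr l' t J" "q' \<cdot>\<^bsub>trivext\<^esub> l' = \<phi>'"
    using A.lifts_moduloD[OF lift J(2)] \<phi>'(1) by (auto simp: trivext_arr_eq)
  then have l': "l' \<Colon> fst t \<leadsto> fst J" "q' \<cdot> l' = \<phi>'" using trivext_arrD(3)
    by (auto simp: trivext_arr_eq)
  note i = free_arr(1)[OF free]
  have li: "l' \<cdot> i \<Colon> x \<leadsto> fst J" using l'(1) i by blast
  have lie: "(l' \<cdot> i) \<cdot> e \<Colon> l \<leadsto> fst J" using li se(5) by blast
  have "q' \<cdot> g = q' \<cdot> ((l' \<cdot> i) \<cdot> e)"
    using assoc[OF J'(5) li se(5)] assoc[OF J'(5) l'(1) i] l'(2) \<phi>'(2) \<phi>(2) by simp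
  then obtain u where u: "u \<Colon> l \<leadsto> fst n" "g = (l' \<cdot> i) \<cdot> e \<boxplus> m \<cdot> u"
    using kernel_diff[OF J'(8,3) g(1) lie] by metis
  have "m \<cdot> f = ((l' \<cdot> i) \<cdot> e) \<cdot> \<iota> \<boxplus> (m \<cdot> u) \<cdot> \<iota>"
    using comp_add_left[OF lie comp_arr[OF J'(4) u(1)] se(4)] g(2) u(2) by simp
  also have "\<dots> = m \<cdot> (u \<cdot> \<iota>)"
    using comp_comp_eq_zero[OF se(10) li se(5,4)] assoc[OF J'(4) u(1) se(4)]
      add_zero_left[OF comp_arr[OF J'(4) comp_arr[OF u(1) se(4)]]] by simp
  finally have "u \<cdot> \<iota> = f" using monic_cancel[OF J'(6) f comp_arr[OF u(1) se(4)]] by simp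
  then show ?thesis using that u(1) by blast
qed

end

section \<open>Cotorsion pairs\<close>

lemma cotorsion_pair_right_iff:
  assumes "cotorsion_pair C X Y"
  shows "y \<in> Y \<longleftrightarrow> y \<in> Ob C \<and> (\<forall>x\<in>X. trivial_group (Ext C 1 x y))"
proof -
  have "Y = right_perp C X" using assms unfolding cotorsion_pair_def by (rule conjunct2)
  then have "y \<in> Y \<longleftrightarrow> y \<in> right_perp C X" by (rule arg_cong)
  then show ?thesis by (simp only: right_perp_def mem_Collect_eq)
qed

lemma cotorsion_pair_left_iff:
  assumes "cotorsion_pair C X Y"
  shows "x \<in> X \<longleftrightarrow> x \<in> Ob C \<and> (\<forall>y\<in>Y. trivial_group (Ext C 1 x y))"
proof -
  have "X = left_perp C Y" using assms unfolding cotorsion_pair_def by (rule conjunct1)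
  then have "x \<in> X \<longleftrightarrow> x \<in> left_perp C Y" by (rule arg_cong)
  then show ?thesis by (simp only: left_perp_def mem_Collect_eq)
qed

lemma cotorsion_pair_left_Ob: "cotorsion_pair C X Y \<Longrightarrow> x \<in> X \<Longrightarrow> x \<in> Ob C"
  by (rule cotorsion_pair_left_iff[THEN iffD1, THEN conjunct1])

lemma cotorsion_pair_Ext: "cotorsion_pair C X Y \<Longrightarrow> x \<in> X \<Longrightarrow> y \<in> Y \<Longrightarrow> trivial_group (Ext C 1 x y)"
  by (rule cotorsion_pair_left_iff[THEN iffD1, THEN conjunct2, THEN bspec])

text \<open>The induction fixes \<open>x\<close> and lets \<open>y\<close> vary: embedding
  \<open>y\<close> into an injective trades degree \<open>n + 2\<close> at \<open>y\<close> for
  degree \<open>n + 1\<close> at the cokernel, which stays in \<open>Y\<close> because injectives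
  belong to \<open>Y\<close> and \<open>quot\<close> applies.\<close>

lemma (in abelian_category_enough) cotorsion_hereditary:
  assumes tors: "cotorsion_pair C X Y"
    and quot: "\<And>y1 f y2 g y3. short_exact C y1 f y2 g y3 \<Longrightarrow> y1 \<in> Y \<Longrightarrow> y2 \<in> Y \<Longrightarrow> y3 \<in> Y"
  shows "hereditary_cotorsion_pair C X Y"
proof -
  note X = cotorsion_pair_left_Ob[OF tors] and XY = cotorsion_pair_Ext[OF tors]
    and Yiff = cotorsion_pair_right_iff[OF tors]
  have inj: "j \<in> Y" if "injective C j" for j
    unfolding Yiff using trivial_Ext_injective[OF X that, of _ 0] that by (simp add: injective_def)
  have "trivial_group (Ext C (Suc n) x y)" if x: "x \<in> X" and y: "y \<in> Y" for n x y
    using y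
  proof (induction n arbitrary: y)
    case 0
    then show ?case using XY[OF x] by simp
  next
    case (Suc n)
    obtain j c m q where j: "injective C j" "short_exact C y m j q c"
      using short_exact_injective[OF Yiff[THEN iffD1, THEN conjunct1, OF Suc.prems]] .
    have "c \<in> Y" using quot[OF j(2) Suc.prems inj[OF j(1)]] .
    then show ?case
      using trivial_Ext_subobject[OF X[OF x] j(2) trivial_Ext_injective[OF X[OF x] j(1)] Suc.IH]
        by simp
  qed
  then have "trivial_group (Ext C i x y)" if "i \<ge> 1" "x \<in> X" "y \<in> Y" for i x y
    using that by (cases i) auto
  then show ?thesis using tors by (auto simp: hereditary_cotorsion_pair_def)
qed

text \<open>Salce's trick: pull back a special precover of the cokernel of an injective embedding.\<close>

lemma (in abelian_category_enough) complete_cotorsion_pairI: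
  assumes tors: "cotorsion_pair C X Y"
    and pre: "\<And>e. e \<in> Ob C \<Longrightarrow> \<exists>x\<in>X. \<exists>y\<in>Y. \<exists>f g. short_exact C y f x g e"
  shows "complete_cotorsion_pair C X Y"
proof -
  note X = cotorsion_pair_left_Ob[OF tors] and XY = cotorsion_pair_Ext[OF tors]
    and Yiff = cotorsion_pair_right_iff[OF tors]
  have "\<exists>x\<in>X. \<exists>y\<in>Y. \<exists>f g. short_exact C e f y g x" if e: "e \<in> Ob C" for e
  proof -
    obtain j c m q where j: "injective C j" "short_exact C e m j q c"
      using short_exact_injective[OF e] .
    note q = short_exactD(5)[OF j(2)]
    obtain x y f g where x: "x \<in> X" "y \<in> Y" "short_exact C y f x g c" using pre[OF arr_Ob(2)[OF q]]
      by blast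
    note g = short_exactD(5)[OF x(3)]
    obtain P a b where P: "a \<Colon> P \<leadsto> j" "b \<Colon> P \<leadsto> x" "q \<cdot> a = g \<cdot> b"
      "\<And>z u v. u \<Colon> z \<leadsto> j \<Longrightarrow> v \<Colon> z \<leadsto> x \<Longrightarrow> q \<cdot> u = g \<cdot> v \<Longrightarrow> \<exists>w. w \<Colon> z \<leadsto> P \<and> a \<cdot> w = u \<and> b \<cdot> w = v"
      "\<And>z w w'. w \<Colon> z \<leadsto> P \<Longrightarrow> w' \<Colon> z \<leadsto> P \<Longrightarrow> a \<cdot> w = a \<cdot> w' \<Longrightarrow> b \<cdot> w = b \<cdot> w' \<Longrightarrow> w = w'"
      using pullback[OF q g] by metis
    obtain n where n: "short_exact C e n P b x"
      by (rule pullback_short_exact[OF j(2) g P(1,2,3)]) (use P(4,5) in blast)+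
    \<comment> \<open>The same square read along its other leg: \<open>P\<close> is an extension of
      the injective \<open>j\<close> by \<open>y\<close>, and therefore lies in
      \<open>Y\<close>.\<close>
    obtain n' where n': "short_exact C y n' P a j"
    proof (rule pullback_short_exact[OF x(3) q P(2,1) P(3)[symmetric]])
      show "\<exists>w. w \<Colon> z \<leadsto> P \<and> b \<cdot> w = u \<and> a \<cdot> w = v" if "u \<Colon> z \<leadsto> x" "v \<Colon> z \<leadsto> j" "g \<cdot> u = q \<cdot> v"
        for z u v
        using P(4)[OF that(2,1)] that(3) by auto
      show "w = w'" if "w \<Colon> z \<leadsto> P" "w' \<Colon> z \<leadsto> P" "b \<cdot> w = b \<cdot> w'" "a \<cdot> w = a \<cdot> w'" for z w w'
        using P(5) that by blast
    qed
    have "trivial_group (Ext C 1 x' P)" if "x' \<in> X" for x'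
      using trivial_Ext_extension[OF X[OF that] n', of 0] XY[OF that x(2)]
        trivial_Ext_injective[OF X[OF that] j(1), of 0] by simp
    then have "P \<in> Y" using arr_Ob(1)[OF P(1)] by (simp add: Yiff)
    then show ?thesis using x(1) n by blast
  qed
  then show ?thesis using tors pre by (simp add: complete_cotorsion_pair_def)
qed

section \<open>The induced cotorsion pair\<close>

context trivial_extension_enough
begin

text \<open>The left class is an orthogonal by definition, so the cotorsion pair property comes down
  to \<open>perp\<close>, where an object right orthogonal to that class is tested on free objects
  over \<open>X\<close> alone.\<close>

theorem trivial_extension_cotorsion_pair:
  assumes complete: "complete_cotorsion_pair C X Y" and hered: "hereditary_cotorsion_pair C X Y"
    and L1: "\<forall>x\<in>X. is_zero_object C (left_derived C C F 1 x)" and FX: "F_ob ` X \<subseteq> Y"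
  defines "UY \<equiv> preimage_class trivext forgetful Y"
  shows "complete_cotorsion_pair trivext (left_perp trivext UY) UY"
    and "hereditary_cotorsion_pair trivext (left_perp trivext UY) UY"
proof -
  have torsC: "cotorsion_pair C X Y" using complete by (simp add: complete_cotorsion_pair_def)
  note X = cotorsion_pair_left_Ob[OF torsC] and Yiff = cotorsion_pair_right_iff[OF torsC]
  have XY: "trivial_group (Ext C (Suc n) x y)" if "x \<in> X" "y \<in> Y" for n x y
    using hered that by (auto simp: hereditary_cotorsion_pair_def)
  have UY: "n \<in> UY \<longleftrightarrow> n \<in> Ob trivext \<and> fst n \<in> Y" for n
    by (simp add: UY_def preimage_class_def forgetful_def)
  \<comment> \<open>Free objects on \<open>X\<close> are both the test objects for
    \<open>perp\<close> and the middle terms of the precovers.\<close>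
  have free: "t \<in> left_perp trivext UY" if x: "x \<in> X" and t: "free_on x t i j p q" for x t i j p q
  proof -
    have "trivial_group (Ext trivext 1 t n)" if "n \<in> UY" for n
    proof -
      have n: "n \<in> Ob trivext" "fst n \<in> Y" using that UY by auto
      have "lifts_modulo x (fst n)"
        using lifts_modulo_of_trivial_Ext[OF X[OF x]] XY[OF x n(2), of 0] by simp
      then show ?thesis
        using A.trivial_Ext_of_lifts_modulo[OF free_on_Ob[OF t] n(1)]
          trivext_lifts_modulo_free[OF t] by blast
    qed
    then show ?thesis using free_on_Ob[OF t] by (simp add: left_perp_def)
  qed
  have perp: "n \<in> UY" if n: "n \<in> right_perp trivext (left_perp trivext UY)" for n
  proof -
    have nOb: "n \<in> Ob trivext" using n by (simp add: right_perp_def)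
    have "trivial_group (Ext C 1 x (fst n))" if x: "x \<in> X" for x
    proof -
      obtain t i j p q where t: "free_on x t i j p q" using free_on_exists[OF X[OF x]] .
      have "trivial_group (Ext trivext 1 t n)" using n free[OF x t] by (simp add: right_perp_def)
      then have lift: "A.lifts_modulo t n" using A.lifts_modulo_of_trivial_Ext[OF free_on_Ob[OF t]]
        by blast
      obtain k \<iota> \<pi> where s: "short_exact C k \<iota> (res_ob C x 0) (res_aug x) x"
        "is_cokernel C (res_ob C x (Suc (Suc 0))) (res_diff C x (Suc 0)) (res_ob C x (Suc 0)) \<pi> k"
        "\<iota> \<cdot> \<pi> = res_diff C x 0"
        using syzygy[OF X[OF x]] .
      \<comment> \<open>The vanishing of the first derived functor on \<open>X\<close> makes the
        syzygy inclusion admissible for \<open>extend_of_A_lifts_modulo\<close>.\<close>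
      have F\<iota>: "monic C (F_ob k) (F_ob (res_ob C x 0)) (F_mor \<iota>)"
        using F_syzygy_monic[OF X[OF x] _ s(2) short_exactD(4)[OF s(1)] s(3)] L1 x by blast
      show ?thesis
        using trivial_Ext_of_syzygy_extend[OF X[OF x] s trivext_struct(3)[OF nOb]]
          extend_of_A_lifts_modulo[OF s(1) F\<iota> t nOb lift] by metis
    qed
    then show ?thesis using nOb trivext_struct(3)[OF nOb] by (simp add: UY Yiff)
  qed
  have tors: "cotorsion_pair trivext (left_perp trivext UY) UY"
    unfolding cotorsion_pair_def
  proof (intro conjI refl subset_antisym subsetI)
    fix n assume "n \<in> UY"
    then show "n \<in> right_perp trivext (left_perp trivext UY)"
      using UY by (simp add: right_perp_def left_perp_def)
  qed (rule perp)
  have ext: "y2 \<in> Y" if se: "short_exact C y1 f y2 g y3" and y: "y1 \<in> Y" "y3 \<in> Y" for y1 f y2 g y3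
    using trivial_Ext_extension[OF X se, of _ 0] XY[OF _ y(1), of _ 0] XY[OF _ y(2), of _ 0]
      short_exactD(2)[OF se]
    by (simp add: Yiff)
  \<comment> \<open>Instantiating \<open>XY\<close> with \<open>1\<close> gives the vanishing of the
    second Ext, the target of the connecting map in \<open>trivial_Ext_quotient\<close>.\<close>
  have quot: "y3 \<in> Y" if se: "short_exact C y1 f y2 g y3" and y: "y1 \<in> Y" "y2 \<in> Y" for y1 f y2 g y3
    using trivial_Ext_quotient[OF X se, of _ 0] XY[OF _ y(1), of _ 1] XY[OF _ y(2), of _ 0]
      short_exactD(3)[OF se]
    by (simp add: Yiff)
  show "hereditary_cotorsion_pair trivext (left_perp trivext UY) UY"
  proof (rule A.cotorsion_hereditary[OF tors])
    fix y1 f y2 g y3 assume se: "short_exact trivext y1 f y2 g y3" and y: "y1 \<in> UY" "y2 \<in> UY"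
    then show "y3 \<in> UY" using quot[OF trivext_short_exactD[OF se]] A.short_exactD(3)[OF se]
      by (simp add: UY)
  qed
  show "complete_cotorsion_pair trivext (left_perp trivext UY) UY"
  proof (rule A.complete_cotorsion_pairI[OF tors])
    fix m assume m: "m \<in> Ob trivext"
    obtain x k \<kappa> e where x: "x \<in> X" "k \<in> Y" "short_exact C k \<kappa> x e (fst m)"
      using complete trivext_struct(3)[OF m] unfolding complete_cotorsion_pair_def by blast
    obtain t i j p q where t: "free_on x t i j p q" using free_on_exists[OF X[OF x(1)]] .
    obtain n \<nu> h u v where n: "short_exact trivext n \<nu> t h m" "short_exact C k u (fst n) v (F_ob x)"
      using free_on_cover[OF x(3) m t] .
    have "n \<in> UY" using ext[OF n(2) x(2)] FX x(1) A.short_exactD(1)[OF n(1)] by (auto simp: UY)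
    then show "\<exists>x\<in>left_perp trivext UY. \<exists>y\<in>UY. \<exists>f g. short_exact trivext y f x g m"
      using free[OF x(1) t] n(1) by blast
  qed
qed

end

theorem corollary5p5:
  fixes B :: "('o, 'm) cat"
    and F :: "('o, 'm, 'o, 'm) functor_data"
    and A :: "('o \<times> 'm, 'm) cat"
    and X Y :: "'o set"
    and UY :: "('o \<times> 'm) set"
  assumes "abelian_category B"
    and "enough_projectives B" and "enough_injectives B"
    and "additive_functor B B F" and "right_exact B B F"
  defines "A \<equiv> right_trivial_extension B F"
  assumes "enough_projectives A" and "enough_injectives A"
    and "complete_cotorsion_pair B X Y" and "hereditary_cotorsion_pair B X Y"
    and "\<forall>x\<in>X. is_zero_object B (left_derived B B F 1 x)"
    and "on_ob F ` X \<subseteq> Y"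
  defines "UY \<equiv> preimage_class A forgetful Y"
  shows "complete_cotorsion_pair A (left_perp A UY) UY \<and>
         hereditary_cotorsion_pair A (left_perp A UY) UY"
proof -
  interpret abelian_category B by fact
  interpret trivial_extension_enough B F
    using assms(2-8) unfolding A_def by unfold_locales
  show ?thesis
    using trivial_extension_cotorsion_pair[OF assms(9-12)] unfolding UY_def A_def by blast
qed

end
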